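(* Let $p,q>0$ and $a\in\mathbb{R}$, let $(W_t)_{t\ge 0}$, $(W^{(1)}_t)_{t\ge 0}$, $(W^{(2)}_t)_{t\ge 0}$ be three independent standard one-dimensional Brownian motions (started at $0$), and let $\mathfrak Z_t=(X_t,Y_t,Z_t)$, $t\ge0$, be the Brownian motion with drift on $\mathrm{Sol}(p,q)$ given by $$Z_t = a\,t + W_t,\qquad X_t=\int_0^t e^{pZ_s}\,dW^{(1)}_s,\qquad Y_t=\int_0^t e^{-qZ_s}\,dW^{(2)}_s .$$ (i) If $a>0$, then $$\lim_{t\to\infty}Y_t=Y_\infty:=\int_0^\infty e^{-qZ_s}\,dW^{(2)}_s\quad\text{almost surely.}$$ That is, $\mathfrak Z_t\to(\varpi_p,Y_\infty)$ almost surely in the topology of $\widehat{\mathrm{Sol}}(p,q)$. (ii) If $a<0$, then $$\lim_{t\to\infty}X_t=X_\infty:=\int_0^\infty e^{pZ_s}\,dW^{(1)}_s\quad\text{almost surely.}$$ That is, $\mathfrak Z_t\to(X_\infty,\varpi_q)$ almost surely in the topology of $\widehat{\mathrm{Sol}}(p,q)$. In both cases (i) and (ii), the respective limiting random variable is almost surely finite. (iii) If $a=0$, then $$|X_t|+e^{Z_t}\to\infty\quad\text{and}\quad |Y_t|+e^{-Z_t}\to\infty\quad\text{almost surely.}$$ That is, $\mathfrak Z_t\to(\varpi_p,\varpi_q)$ almost surely in the topology of $\widehat{\mathrm{Sol}}(p,q)$.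
   Context: $\mathrm{Sol}(p,q)$ is $\mathbb{R}^3$ with coordinates $(x,y,z)$ and Riemannian metric $ds^2=e^{-2pz}\,dx^2+e^{2qz}\,dy^2+dz^2$. The integrals are Itô stochastic integrals (continuous versions); $(\mathfrak Z_t)$ is the continuous diffusion started at $(0,0,0)$ with generator $\frac12\bigl(e^{2pz}\partial_x^2+e^{-2qz}\partial_y^2+\partial_z^2\bigr)+a\,\partial_z$. For $p>0$, $\mathbb{H}(p)$ is $\mathbb{R}^2$ with coordinates $(x,z)$ and metric $e^{-2pz}dx^2+dz^2$ (the hyperbolic plane of curvature $-p^2$ in logarithmic coordinates; the upper half-plane point is $x+\mathrm{i}\,e^{pz}$ up to scaling). Its geometric compactification $\widehat{\mathbb H}(p)$ is the usual closed disk, obtained by adding the bottom boundary line $\mathbb{R}$ and a point at infinity $\varpi_p$: a family of points $(x,z)$ converges to $\xi\in\mathbb{R}$ when $z\to-\infty$ and $x\to\xi$, and converges to $\varpi_p$ when $|x|+e^{z}\to\infty$. $\mathrm{Sol}(p,q)$ embeds into $\mathbb{H}(p)\times\mathbb{H}(q)$ via $(x,y,z)\mapsto\bigl((x,z),(y,-z)\bigr)$, and $\widehat{\mathrm{Sol}}(p,q)$ is the closure of its image in the compact space $\widehat{\mathbb H}(p)\times\widehat{\mathbb H}(q)$, with the induced topology. *)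

theory Defs
  imports "HOL-Probability.Probability"
begin

section \<open>The compactification of Sol(p,q)\<close>

text \<open>
  With \<open>u = exp (p * z) / p\<close> the metric \<open>exp (- 2 * p * z) dx^2 + dz^2\<close> of H(p) becomes
  \<open>(dx^2 + du^2) / (p * u)^2\<close>, so \<open>(x, z) \<mapsto> x + i u\<close> is the upper half-plane model.  The closed
  disk is the closed upper half-plane together with one point at infinity; its underlying space does
  not depend on \<open>p\<close>, only the embedding does.
\<close>

definition hyp_compactification :: "complex option topology" where
  "hyp_compactification = Alexandroff_compactification (top_of_set {w. 0 \<le> Im w})"

definition hyp_point :: "real \<Rightarrow> real \<Rightarrow> real \<Rightarrow> complex option" where
  "hyp_point p x z = Some (Complex x (exp (p * z) / p))"

definition hyp_boundary :: "real \<Rightarrow> complex option" where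
  "hyp_boundary \<xi> = Some (complex_of_real \<xi>)"

definition hyp_infinity :: "complex option" where
  "hyp_infinity = None"

definition sol_embedding ::
    "real \<Rightarrow> real \<Rightarrow> real \<times> real \<times> real \<Rightarrow> complex option \<times> complex option" where
  "sol_embedding p q = (\<lambda>(x, y, z). (hyp_point p x z, hyp_point q y (- z)))"

definition sol_compactification ::
    "real \<Rightarrow> real \<Rightarrow> (complex option \<times> complex option) topology" where
  "sol_compactification p q =
     (let T = prod_topology hyp_compactification hyp_compactification
      in subtopology T (T closure_of range (sol_embedding p q)))"

text \<open>The two kinds of convergence to the boundary, in the coordinates \<open>(x, z)\<close>.\<close>

lemma limitin_hyp_boundary_iff:
  assumes "p > 0"
  shows "limitin hyp_compactification (\<lambda>t. hyp_point p (x t) (z t)) (hyp_boundary \<xi>) F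
     \<longleftrightarrow> (x \<longlongrightarrow> \<xi>) F \<and> filterlim z at_bot F"
proof -
  let ?H = "{w::complex. 0 \<le> Im w}"
  let ?w = "\<lambda>t. Complex (x t) (exp (p * z t) / p)"
  have inH: "?w t \<in> ?H" for t using assms by simp
  have 1: "limitin hyp_compactification (\<lambda>t. Some (?w t)) (Some (of_real \<xi>)) F
     \<longleftrightarrow> limitin (top_of_set ?H) ?w (of_real \<xi>) F"
  proof
    assume L: "limitin hyp_compactification (\<lambda>t. Some (?w t)) (Some (of_real \<xi>)) F"
    show "limitin (top_of_set ?H) ?w (of_real \<xi>) F"
      unfolding limitin_def
    proof (intro conjI allI impI)
      fix U assume U: "openin (top_of_set ?H) U \<and> complex_of_real \<xi> \<in> U"
      then have "openin hyp_compactification (Some ` U)"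
        unfolding hyp_compactification_def by (simp add: openin_Alexandroff_compactification_image_Some)
      with L U have "eventually (\<lambda>t. Some (?w t) \<in> Some ` U) F"
        unfolding limitin_def by blast
      then show "eventually (\<lambda>t. ?w t \<in> U) F" by (rule eventually_mono) auto
    qed simp
  next
    assume L: "limitin (top_of_set ?H) ?w (of_real \<xi>) F"
    show "limitin hyp_compactification (\<lambda>t. Some (?w t)) (Some (of_real \<xi>)) F"
      unfolding limitin_def
    proof (intro conjI allI impI)
      show "Some (complex_of_real \<xi>) \<in> topspace hyp_compactification"
        by (simp add: hyp_compactification_def)
      fix V assume V: "openin hyp_compactification V \<and> Some (complex_of_real \<xi>) \<in> V"
      then obtain U where U: "openin (top_of_set ?H) U" "Some ` U \<subseteq> V" "complex_of_real \<xi> \<in> U"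
      proof (cases "\<exists>U. openin (top_of_set ?H) U \<and> V = Some ` U")
        case True
        with V that show ?thesis by blast
      next
        case False
        with V obtain C where C: "closedin (top_of_set ?H) C"
            "V = topspace hyp_compactification - Some ` C"
          unfolding hyp_compactification_def openin_Alexandroff_compactification by auto
        have "openin (top_of_set ?H) (?H - C)"
          using C by (simp add: openin_diff)
        moreover have "Some ` (?H - C) \<subseteq> V"
          using C by (auto simp: hyp_compactification_def)
        moreover have "complex_of_real \<xi> \<in> ?H - C" using V C by auto
        ultimately show ?thesis using that by blast
      qed
      with L have "eventually (\<lambda>t. ?w t \<in> U) F" unfolding limitin_def by blast
      then show "eventually (\<lambda>t. Some (?w t) \<in> V) F"
        by (rule eventually_mono) (use U in auto)
    qed
  qed
  have 2: "limitin (top_of_set ?H) ?w (of_real \<xi>) F \<longleftrightarrow> (?w \<longlongrightarrow> of_real \<xi>) F"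
    unfolding limitin_subtopology using inH by simp
  have 3: "(?w \<longlongrightarrow> of_real \<xi>) F \<longleftrightarrow> (x \<longlongrightarrow> \<xi>) F \<and> ((\<lambda>t. exp (p * z t) / p) \<longlongrightarrow> 0) F"
    by (simp add: tendsto_complex_iff)
  have 4: "((\<lambda>t. exp (p * z t) / p) \<longlongrightarrow> 0) F \<longleftrightarrow> filterlim z at_bot F"
  proof
    assume "((\<lambda>t. exp (p * z t) / p) \<longlongrightarrow> 0) F"
    from tendsto_mult_left[OF this, of p] have "((\<lambda>t. exp (p * z t)) \<longlongrightarrow> 0) F"
      using assms by simp
    then have L: "filterlim (\<lambda>t. exp (p * z t)) (at_right 0) F"
      by (simp add: filterlim_at_right_to_0 filterlim_at)
    have "filterlim (\<lambda>t. ln (exp (p * z t))) at_bot F"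
      by (rule filterlim_compose[OF ln_at_0 L])
    then have "filterlim (\<lambda>t. p * z t) at_bot F" by simp
    then have "filterlim (\<lambda>t. inverse p * (p * z t)) at_bot F"
      by (rule filterlim_tendsto_pos_mult_at_bot[OF tendsto_const[of "inverse p"], rotated])
        (use assms in simp)
    moreover have "(\<lambda>t. inverse p * (p * z t)) = z" using assms by (simp add: fun_eq_iff)
    ultimately show "filterlim z at_bot F" by simp
  next
    assume "filterlim z at_bot F"
    then have "filterlim (\<lambda>t. p * z t) at_bot F"
      by (rule filterlim_tendsto_pos_mult_at_bot[OF tendsto_const[of p], rotated])
        (use assms in simp)
    then have "((\<lambda>t. exp (p * z t)) \<longlongrightarrow> 0) F"
      by (rule filterlim_compose[OF exp_at_bot])
    then show "((\<lambda>t. exp (p * z t) / p) \<longlongrightarrow> 0) F" by (rule tendsto_divide_zero)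
  qed
  show ?thesis
    using 1 2 3 4 by (simp add: hyp_point_def hyp_boundary_def)
qed

lemma limitin_hyp_infinity_iff:
  assumes "p > 0"
  shows "limitin hyp_compactification (\<lambda>t. hyp_point p (x t) (z t)) hyp_infinity F
     \<longleftrightarrow> filterlim (\<lambda>t. \<bar>x t\<bar> + exp (z t)) at_top F"
proof -
  let ?H = "{w::complex. 0 \<le> Im w}"
  let ?w = "\<lambda>t. Complex (x t) (exp (p * z t) / p)"
  have inH: "?w t \<in> ?H" for t using assms by simp
  show ?thesis
  proof
    assume L: "limitin hyp_compactification (\<lambda>t. hyp_point p (x t) (z t)) hyp_infinity F"
    show "filterlim (\<lambda>t. \<bar>x t\<bar> + exp (z t)) at_top F"
      unfolding filterlim_at_top_gt[where c=1]
    proof (intro allI impI)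
      fix C :: real assume C: "1 < C"
      define K where "K = cbox (Complex (- C) 0) (Complex C (exp (p * ln C) / p))"
      have K: "compact K" "K \<subseteq> ?H"
        by (auto simp: K_def in_cbox_complex_iff)
      then have "openin hyp_compactification (topspace hyp_compactification - Some ` K)"
        unfolding hyp_compactification_def openin_Alexandroff_compactification
        by (intro disjI2 exI[of _ K])
          (auto simp: compactin_subtopology intro!: closed_subset compact_imp_closed)
      moreover have "hyp_infinity \<in> topspace hyp_compactification - Some ` K"
        by (simp add: hyp_compactification_def hyp_infinity_def image_iff)
      ultimately have "eventually (\<lambda>t. hyp_point p (x t) (z t)
          \<in> topspace hyp_compactification - Some ` K) F"
        using L unfolding limitin_def by blast
      then show "eventually (\<lambda>t. C \<le> \<bar>x t\<bar> + exp (z t)) F"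
      proof (rule eventually_mono)
        fix t assume *: "hyp_point p (x t) (z t) \<in> topspace hyp_compactification - Some ` K"
        show "C \<le> \<bar>x t\<bar> + exp (z t)"
        proof (rule ccontr)
          assume n: "\<not> ?thesis"
          then have "\<bar>x t\<bar> \<le> C" using exp_gt_zero[of "z t"] by linarith
          moreover have "exp (z t) \<le> C" using n by linarith
          then have "z t \<le> ln C" using C by (simp add: ln_ge_iff)
          ultimately have "?w t \<in> K"
            using assms by (auto simp: K_def in_cbox_complex_iff divide_right_mono)
          with * show False by (simp add: hyp_point_def)
        qed
      qed
    qed
  next
    assume L: "filterlim (\<lambda>t. \<bar>x t\<bar> + exp (z t)) at_top F"
    show "limitin hyp_compactification (\<lambda>t. hyp_point p (x t) (z t)) hyp_infinity F"
      unfolding limitin_def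
    proof (intro conjI allI impI)
      show "hyp_infinity \<in> topspace hyp_compactification"
        by (simp add: hyp_compactification_def hyp_infinity_def)
      fix V assume V: "openin hyp_compactification V \<and> hyp_infinity \<in> V"
      then obtain K where K: "compactin (top_of_set ?H) K"
          "V = topspace hyp_compactification - Some ` K"
        unfolding hyp_compactification_def openin_Alexandroff_compactification hyp_infinity_def
        by auto
      then have "bounded K" by (simp add: compactin_subtopology compact_imp_bounded)
      then obtain R where R: "R > 0" "\<And>w. w \<in> K \<Longrightarrow> norm w \<le> R"
        by (auto simp: bounded_pos)
      have "eventually (\<lambda>t. R + exp (ln (p * R) / p) < \<bar>x t\<bar> + exp (z t)) F"
        using L unfolding filterlim_at_top_dense by blast
      then show "eventually (\<lambda>t. hyp_point p (x t) (z t) \<in> V) F"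
      proof (rule eventually_mono)
        fix t assume t: "R + exp (ln (p * R) / p) < \<bar>x t\<bar> + exp (z t)"
        have "?w t \<notin> K"
        proof
          assume "?w t \<in> K"
          then have n: "norm (?w t) \<le> R" by (rule R)
          have "\<bar>x t\<bar> \<le> R" using abs_Re_le_cmod[of "?w t"] n by simp
          moreover have "exp (p * z t) / p \<le> R" using abs_Im_le_cmod[of "?w t"] n assms by simp
          then have "exp (p * z t) \<le> p * R" using assms by (simp add: field_simps)
          then have "p * z t \<le> ln (p * R)" using assms R by (simp add: ln_ge_iff)
          then have "z t \<le> ln (p * R) / p" using assms by (simp add: field_simps)
          ultimately show False using t by (simp add: add_mono leD)
        qed
        then show "hyp_point p (x t) (z t) \<in> V"
          using K inH by (auto simp: hyp_point_def hyp_compactification_def)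
      qed
    qed
  qed
qed


section \<open>Brownian motion\<close>

text \<open>Processes are indexed by \<open>real\<close>; only times \<open>t \<ge> 0\<close> carry meaning.\<close>

definition brownian_motion :: "'a measure \<Rightarrow> (real \<Rightarrow> 'a \<Rightarrow> real) \<Rightarrow> bool" where
  "brownian_motion M W \<longleftrightarrow>
     (\<forall>t\<ge>0. W t \<in> borel_measurable M) \<and>
     (AE \<omega> in M. W 0 \<omega> = 0) \<and>
     (\<forall>s\<ge>0. \<forall>t>s. distributed M lborel (\<lambda>\<omega>. W t \<omega> - W s \<omega>) (normal_density 0 (sqrt (t - s)))) \<and>
     (\<forall>n. \<forall>\<tau>::nat \<Rightarrow> real. 0 \<le> \<tau> 0 \<and> strict_mono \<tau> \<longrightarrow>
        prob_space.indep_vars M (\<lambda>_. borel) (\<lambda>i \<omega>. W (\<tau> (Suc i)) \<omega> - W (\<tau> i) \<omega>) {..<n}) \<and>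
     (AE \<omega> in M. continuous_on {0..} (\<lambda>t. W t \<omega>))"

text \<open>Independence of entire processes, as random elements of the product space \<open>\<real>\<^bsup>[0,\<infinity>)\<^esup>\<close>.\<close>

definition independent_processes :: "'a measure \<Rightarrow> (real \<Rightarrow> 'a \<Rightarrow> real) list \<Rightarrow> bool" where
  "independent_processes M Ws \<longleftrightarrow>
     prob_space.indep_vars M (\<lambda>_. \<Pi>\<^sub>M t\<in>{0..}. borel)
       (\<lambda>i \<omega>. \<lambda>t\<in>{0..}. (Ws ! i) t \<omega>) {..<length Ws}"

definition natural_filtration ::
    "'a measure \<Rightarrow> (real \<Rightarrow> 'a \<Rightarrow> real) set \<Rightarrow> real \<Rightarrow> 'a measure" where
  "natural_filtration M \<W> t =
     sigma (space M) {W s -` A \<inter> space M | W s A. W \<in> \<W> \<and> 0 \<le> s \<and> s \<le> t \<and> A \<in> sets borel}"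


section \<open>The Ito integral\<close>

text \<open>
  The integral over \<open>[0,\<infinity>)\<close> of an adapted, jointly measurable process \<open>H\<close> with
  \<open>\<integral> H^2 ds < \<infinity>\<close> almost surely: the limit in probability of the elementary integrals of bounded
  simple predictable processes \<open>H\<^sub>n\<close> with \<open>\<integral> (H\<^sub>n - H)^2 ds \<longrightarrow> 0\<close> in probability.  The limit is
  determined only up to null sets, hence a relation rather than a function.  The integrator is
  meant to be a Brownian motion with increments after \<open>t\<close> independent of \<open>F t\<close>.
\<close>

definition conv_zero_in_prob :: "'a measure \<Rightarrow> (nat \<Rightarrow> 'a \<Rightarrow> ennreal) \<Rightarrow> bool" where
  "conv_zero_in_prob M U \<longleftrightarrow>
     (\<forall>\<epsilon>>0. (\<lambda>n. measure M {\<omega> \<in> space M. U n \<omega> > ennreal \<epsilon>}) \<longlonglongrightarrow> 0)"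

text \<open>
  A simple predictable process \<open>\<Sum>i<k. \<xi> i * indicator {\<tau> i<..\<tau> (Suc i)}\<close> is represented by the
  triple \<open>(k, \<tau>, \<xi>)\<close>.
\<close>

type_synonym 'a simple_process = "nat \<times> (nat \<Rightarrow> real) \<times> (nat \<Rightarrow> 'a \<Rightarrow> real)"

definition simple_predictable ::
    "'a measure \<Rightarrow> (real \<Rightarrow> 'a measure) \<Rightarrow> 'a simple_process \<Rightarrow> bool" where
  "simple_predictable M F = (\<lambda>(k, \<tau>, \<xi>).
     0 \<le> \<tau> 0 \<and> strict_mono \<tau> \<and>
     (\<forall>i<k. \<xi> i \<in> borel_measurable (F (\<tau> i))) \<and>
     (\<exists>C. \<forall>i<k. \<forall>\<omega>\<in>space M. \<bar>\<xi> i \<omega>\<bar> \<le> C))"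

definition simple_value :: "'a simple_process \<Rightarrow> real \<Rightarrow> 'a \<Rightarrow> real" where
  "simple_value = (\<lambda>(k, \<tau>, \<xi>) s \<omega>. \<Sum>i<k. \<xi> i \<omega> * indicator {\<tau> i<..\<tau> (Suc i)} s)"

definition simple_integral :: "(real \<Rightarrow> 'a \<Rightarrow> real) \<Rightarrow> 'a simple_process \<Rightarrow> 'a \<Rightarrow> real" where
  "simple_integral W = (\<lambda>(k, \<tau>, \<xi>) \<omega>. \<Sum>i<k. \<xi> i \<omega> * (W (\<tau> (Suc i)) \<omega> - W (\<tau> i) \<omega>))"

definition ito_integrand ::
    "'a measure \<Rightarrow> (real \<Rightarrow> 'a measure) \<Rightarrow> (real \<Rightarrow> 'a \<Rightarrow> real) \<Rightarrow> bool" where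
  "ito_integrand M F H \<longleftrightarrow>
     (\<lambda>(s, \<omega>). H s \<omega>) \<in> borel_measurable (restrict_space borel {0..} \<Otimes>\<^sub>M M) \<and>
     (\<forall>s\<ge>0. H s \<in> borel_measurable (F s)) \<and>
     (AE \<omega> in M. (\<integral>\<^sup>+ s\<in>{0..}. ennreal ((H s \<omega>)\<^sup>2) \<partial>lborel) < \<infinity>)"

definition has_ito_integral ::
    "'a measure \<Rightarrow> (real \<Rightarrow> 'a measure) \<Rightarrow> (real \<Rightarrow> 'a \<Rightarrow> real) \<Rightarrow> (real \<Rightarrow> 'a \<Rightarrow> real)
       \<Rightarrow> ('a \<Rightarrow> real) \<Rightarrow> bool" where
  "has_ito_integral M F W H I \<longleftrightarrow>
     ito_integrand M F H \<and> I \<in> borel_measurable M \<and>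
     (\<exists>S :: nat \<Rightarrow> 'a simple_process.
        (\<forall>n. simple_predictable M F (S n)) \<and>
        conv_zero_in_prob M
          (\<lambda>n \<omega>. \<integral>\<^sup>+ s\<in>{0..}. ennreal ((simple_value (S n) s \<omega> - H s \<omega>)\<^sup>2) \<partial>lborel) \<and>
        conv_zero_in_prob M (\<lambda>n \<omega>. ennreal \<bar>simple_integral W (S n) \<omega> - I \<omega>\<bar>))"

text \<open>\<open>X\<close> is a continuous version of the process \<open>t \<mapsto> \<integral>\<^sub>0\<^sup>t H dW\<close>.\<close>

definition ito_integral_process ::
    "'a measure \<Rightarrow> (real \<Rightarrow> 'a measure) \<Rightarrow> (real \<Rightarrow> 'a \<Rightarrow> real) \<Rightarrow> (real \<Rightarrow> 'a \<Rightarrow> real)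
       \<Rightarrow> (real \<Rightarrow> 'a \<Rightarrow> real) \<Rightarrow> bool" where
  "ito_integral_process M F W H X \<longleftrightarrow>
     (\<forall>t\<ge>0. has_ito_integral M F W (\<lambda>s \<omega>. indicator {0..t} s * H s \<omega>) (X t)) \<and>
     (AE \<omega> in M. continuous_on {0..} (\<lambda>t. X t \<omega>))"

end

theory Submission
  imports Defs
begin

text \<open>
  Write \<open>Z\<^sub>t = a t + W\<^sub>t\<close> for the vertical coordinate.  The two cases \<open>a > 0\<close> and \<open>a < 0\<close> are exchanged by
  swapping the two factors, so consider \<open>a > 0\<close> and \<open>a = 0\<close>.

  \<^emph>\<open>Nonzero drift.\<close>  Brownian motion grows sublinearly (\<open>sublinear_growth\<close>), so \<open>Z\<^sub>t \<rightarrow> \<infinity>\<close> and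
  \<open>\<integral> exp (- 2 q Z\<^sub>s) ds < \<infinity>\<close> almost surely (\<open>exponential_energy_finite\<close>).  For an integrand \<open>H\<close> of
  finite energy \<open>\<integral> H\<^sup>2 ds\<close> the oscillation of the integral process after time \<open>T\<close> is controlled by
  \<open>P (sup\<^sub>t |Y\<^sub>t - Y\<^sub>T| > \<epsilon>) \<le> P (\<integral>\<^sub>T\<^sup>\<infinity> H\<^sup>2 ds > \<delta>) + 16 \<delta> / \<epsilon>\<^sup>2\<close>, where \<open>t\<close> ranges over \<open>[T, \<infinity>)\<close>
  (\<open>ito_maximal_inequality_finite\<close>).  Letting \<open>T \<rightarrow> \<infinity>\<close> and then \<open>\<delta> \<rightarrow> 0\<close> shows that the paths of \<open>Y\<close>
  are Cauchy at infinity; the limit is the integral over the half line, which is unique up to null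
  sets (\<open>ito_integral_process_tendsto\<close>).

  \<^emph>\<open>Zero drift.\<close>  Put \<open>u = exp (p z) / p\<close>.  On functions of \<open>(x, u)\<close> the generator of \<open>(X, Z)\<close> is
  \<open>p\<^sup>2 u\<^sup>2 / 2\<close> times the Laplacian of \<open>\<real>\<^sup>3\<close> in cylindrical coordinates, with \<open>u\<close> the distance from the axis:
  up to a time change \<open>(X, exp (p Z) / p)\<close> is a three-dimensional Brownian motion seen modulo
  rotations about the axis, and three-dimensional Brownian motion is transient.  Concretely
  \<open>g = (1 + x\<^sup>2 + u\<^sup>2)\<^bsup>-1/2\<^esup>\<close> is superharmonic on \<open>\<real>\<^sup>3\<close>, so \<open>g (X\<^sub>t, Z\<^sub>t)\<close> is a bounded nonnegative
  supermartingale.  At the first time at which \<open>Z \<ge> K\<close> it is at most \<open>p exp (- p K)\<close>, so the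
  probability that it exceeds \<open>\<epsilon>\<close> at some later time is at most \<open>p exp (- p K) / \<epsilon>\<close>.  Since \<open>sup Z = \<infinity>\<close>
  almost surely (\<open>unbounded_above\<close>), \<open>g (X\<^sub>t, Z\<^sub>t) \<rightarrow> 0\<close>, that is, \<open>|X\<^sub>t| + exp Z\<^sub>t \<rightarrow> \<infinity>\<close>
  (\<open>driftless_transience\<close>).  The other factor is treated by replacing \<open>W\<close> with \<open>- W\<close>.

  \<^emph>\<open>Discretisation.\<close>  Stochastic integrals are given only as limits in probability of sums over
  finite grids, so every estimate is first proved for such sums, where only the law of an
  increment and its independence of the past are used.  For the supermartingale this means an Euler scheme with mesh \<open>h\<close>:
  one step increases the expectation of \<open>g\<close> by at most \<open>31 p\<^sup>3 h\<^bsup>3/2\<^esup>\<close> (\<open>plummer_step\<close>), and the total error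
  over a bounded time interval vanishes as \<open>h \<rightarrow> 0\<close>.  The estimates then pass to finite sets of times,
  to the dyadic rationals by monotone convergence, and to all times by continuity of the paths.
\<close>


section \<open>Increments of a Brownian motion and the past\<close>

lemma (in prob_space) indep_set_mono:
  assumes "indep_set A B" "A' \<subseteq> A" "B' \<subseteq> B"
  shows "indep_set A' B'"
proof (rule indep_setI)
  show "A' \<subseteq> events" "B' \<subseteq> events" using assms unfolding indep_sets2_eq by (auto dest: subset_trans)
  show "prob (a \<inter> b) = prob a * prob b" if "a \<in> A'" "b \<in> B'" for a b
    by (rule indep_setD[OF assms(1)]) (use that assms in auto)
qed

text \<open>The past up to \<open>s\<close> is generated by the intersection-stable family of finite-dimensional cylinders.
  Such a cylinder is, up to the null set \<open>V 0 \<noteq> 0\<close>, an event about the increments over the grid formed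
  by \<open>0\<close>, its finitely many times and \<open>s\<close>, and these are independent of the increment from \<open>s\<close> to \<open>t\<close>.\<close>

lemma (in prob_space) indep_set_past_increment:
  fixes V :: "real \<Rightarrow> 'a \<Rightarrow> real"
  assumes bm: "brownian_motion M V" and st: "0 \<le> s" "s < t"
  shows "indep_set
     (sigma_sets (space M) {V r -` A \<inter> space M | r A. 0 \<le> r \<and> r \<le> s \<and> A \<in> sets borel})
     (sigma_sets (space M) {(\<lambda>\<omega>. V t \<omega> - V s \<omega>) -` A \<inter> space M | A. A \<in> sets borel})"
proof -
  have Vm[measurable]: "V r \<in> borel_measurable M" if "0 \<le> r" for r
    using bm that by (auto simp: brownian_motion_def)
  have V0: "AE \<omega> in M. V 0 \<omega> = 0" using bm by (auto simp: brownian_motion_def)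
  define C where "C = {{\<omega> \<in> space M. \<forall>r\<in>J. V r \<omega> \<in> A r} | J A.
     finite J \<and> J \<subseteq> {0..s} \<and> (\<forall>r\<in>J. A r \<in> sets borel)}"
  define D where "D = {(\<lambda>\<omega>. V t \<omega> - V s \<omega>) -` A \<inter> space M | A. A \<in> sets borel}"
  have C_ev: "C \<subseteq> events"
  proof
    fix E assume "E \<in> C"
    then obtain J A where J: "finite J" "J \<subseteq> {0..s}" "\<And>r. r \<in> J \<Longrightarrow> A r \<in> sets borel"
      and E: "E = {\<omega> \<in> space M. \<forall>r\<in>J. V r \<omega> \<in> A r}" unfolding C_def by blast
    show "E \<in> events" unfolding E
    proof (intro sets.sets_Collect_finite_All J)
      fix r assume r: "r \<in> J"
      have "V r -` A r \<inter> space M \<in> events"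
        by (rule measurable_sets[OF Vm J(3)[OF r]]) (use r J in auto)
      then show "{\<omega> \<in> space M. V r \<omega> \<in> A r} \<in> events" by (simp add: vimage_def Int_def conj_commute)
    qed
  qed
  have D_ev: "D \<subseteq> events" using st by (auto simp: D_def intro!: measurable_sets[where A=borel])
  have "indep_set C D"
    unfolding indep_sets2_eq
  proof (intro conjI C_ev D_ev ballI)
    fix E E2 assume "E \<in> C" "E2 \<in> D"
    then obtain J A where J: "finite J" "J \<subseteq> {0..s}" "\<And>r. r \<in> J \<Longrightarrow> A r \<in> sets borel"
      and E: "E = {\<omega> \<in> space M. \<forall>r\<in>J. V r \<omega> \<in> A r}" unfolding C_def by blast
    obtain A2 where A2: "A2 \<in> sets borel" and E2: "E2 = (\<lambda>\<omega>. V t \<omega> - V s \<omega>) -` A2 \<inter> space M"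
      using \<open>E2 \<in> D\<close> unfolding D_def by blast
    define xs where "xs = sorted_list_of_set (J \<union> {0, s})"
    define n where "n = length xs - 1"
    \<comment> \<open>beyond the listed times the grid continues with \<open>t, t + 1, \<dots>\<close>, because independence of increments is stated for infinite increasing sequences\<close>
    define \<tau> where "\<tau> = (\<lambda>i. if i < length xs then xs ! i else t + real (i - length xs))"
    have fin: "finite (J \<union> {0, s})" using J by auto
    have setxs: "set xs = J \<union> {0, s}" unfolding xs_def using fin by (simp del: insert_iff Un_insert_right)
    have lenpos: "length xs > 0" using setxs by auto
    have srt: "sorted xs" "distinct xs" unfolding xs_def by simp_all
    have xs_lt: "xs ! i < xs ! j" if "i < j" "j < length xs" for i j
    proof -
      have "xs ! i \<le> xs ! j" by (rule sorted_nth_mono[OF srt(1)]) (use that in auto)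
      moreover have "xs ! i \<noteq> xs ! j" using nth_eq_iff_index_eq[OF srt(2), of i j] that by auto
      ultimately show ?thesis by linarith
    qed
    have xs_le: "xs ! i \<le> s" if "i < length xs" for i
    proof -
      have "xs ! i \<in> J \<union> {0, s}" using nth_mem[OF that] setxs by simp
      then show ?thesis using J(2) st by auto
    qed
    have sm: "strict_mono \<tau>"
    proof (rule strict_monoI)
      fix i j :: nat assume "i < j"
      then show "\<tau> i < \<tau> j"
        using xs_lt[of i j] xs_le[of i] st by (auto simp: \<tau>_def)
    qed
    have xs_ge: "0 \<le> xs ! i" if "i < length xs" for i
    proof -
      have "xs ! i \<in> J \<union> {0, s}" using nth_mem[OF that] setxs by simp
      then show ?thesis using J(2) st by auto
    qed
    have idx_ex: "\<exists>j\<le>n. \<tau> j = r" if "r \<in> J \<union> {0, s}" for r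
    proof -
      have "r \<in> set xs" using that setxs by simp
      then obtain j where "j < length xs" "xs ! j = r" unfolding in_set_conv_nth by (elim exE conjE)
      then show ?thesis by (intro exI[of _ j]) (auto simp: \<tau>_def n_def)
    qed
    have \<tau>0: "\<tau> 0 = 0"
    proof -
      obtain j where "j \<le> n" "\<tau> j = 0" using idx_ex[of 0] by auto
      moreover have "\<tau> 0 \<ge> 0" using xs_ge[of 0] lenpos by (simp add: \<tau>_def)
      ultimately show ?thesis using strict_mono_mono[OF sm, THEN monoD, of 0 j] by simp
    qed
    have \<tau>n: "\<tau> n = s"
    proof -
      obtain j where "j \<le> n" "\<tau> j = s" using idx_ex[of s] by auto
      moreover have "\<tau> n \<le> s" using xs_le[of n] lenpos by (simp add: \<tau>_def n_def)
      ultimately show ?thesis using strict_mono_mono[OF sm, THEN monoD, of j n] by simp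
    qed
    have \<tau>Sn: "\<tau> (Suc n) = t" using lenpos by (simp add: \<tau>_def n_def)
    have \<tau>nn: "0 \<le> \<tau> i" for i using strict_mono_mono[OF sm, THEN monoD, of 0 i] \<tau>0 by simp
    define \<Delta> where "\<Delta> = (\<lambda>i \<omega>. V (\<tau> (Suc i)) \<omega> - V (\<tau> i) \<omega>)"
    have \<Delta>m[measurable]: "\<Delta> i \<in> borel_measurable M" for i
      unfolding \<Delta>_def by (intro borel_measurable_diff Vm \<tau>nn)
    have "indep_vars (\<lambda>_. borel) \<Delta> {..<Suc n}"
    proof -
      have "\<forall>n. \<forall>\<tau>::nat \<Rightarrow> real. 0 \<le> \<tau> 0 \<and> strict_mono \<tau> \<longrightarrow>
          indep_vars (\<lambda>_. borel) (\<lambda>i \<omega>. V (\<tau> (Suc i)) \<omega> - V (\<tau> i) \<omega>) {..<n}"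
        using bm unfolding brownian_motion_def by (elim conjE)
      from this[THEN spec[of _ "Suc n"], THEN spec[of _ \<tau>]] show ?thesis
        unfolding \<Delta>_def using \<tau>nn sm by simp
    qed
    then have ind: "indep_var (PiM {..<n} (\<lambda>_. borel)) (\<lambda>\<omega>. \<lambda>i\<in>{..<n}. \<Delta> i \<omega>)
        (PiM {n} (\<lambda>_. borel)) (\<lambda>\<omega>. \<lambda>i\<in>{n}. \<Delta> i \<omega>)"
      by (rule indep_var_restrict) auto
    have "\<forall>r\<in>J. \<exists>j. j \<le> n \<and> \<tau> j = r" using idx_ex by simp
    from bchoice[OF this] obtain idx where idx': "\<forall>r\<in>J. idx r \<le> n \<and> \<tau> (idx r) = r" by (elim exE)
    have idx: "idx r \<le> n" "\<tau> (idx r) = r" if "r \<in> J" for r using idx' that by auto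
    have tel: "(\<Sum>i<j. \<Delta> i \<omega>) = V (\<tau> j) \<omega> - V 0 \<omega>" for j \<omega>
      by (induction j) (auto simp: \<Delta>_def \<tau>0)
    define S where "S = {f \<in> space (PiM {..<n} (\<lambda>_. borel :: real measure)). \<forall>r\<in>J. (\<Sum>i<idx r. f i) \<in> A r}"
    define S2 where "S2 = {f \<in> space (PiM {n} (\<lambda>_. borel :: real measure)). f n \<in> A2}"
    have S: "S \<in> sets (PiM {..<n} (\<lambda>_. borel))"
      unfolding S_def
    proof (intro sets.sets_Collect_finite_All J)
      fix r assume r: "r \<in> J"
      have "(\<lambda>f. \<Sum>i<idx r. f i) \<in> borel_measurable (PiM {..<n} (\<lambda>_. borel :: real measure))"
        by (intro borel_measurable_sum measurable_component_singleton) (use idx[OF r] in auto)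
      from measurable_sets[OF this J(3)[OF r]]
      show "{f \<in> space (PiM {..<n} (\<lambda>_. borel :: real measure)). (\<Sum>i<idx r. f i) \<in> A r} \<in> sets (PiM {..<n} (\<lambda>_. borel))"
        by (simp add: vimage_def Int_def conj_commute)
    qed
    have S2: "S2 \<in> sets (PiM {n} (\<lambda>_. borel))"
      unfolding S2_def using A2 by measurable
    define E' where "E' = (\<lambda>\<omega>. \<lambda>i\<in>{..<n}. \<Delta> i \<omega>) -` S \<inter> space M"
    have E2': "E2 = (\<lambda>\<omega>. \<lambda>i\<in>{n}. \<Delta> i \<omega>) -` S2 \<inter> space M"
      unfolding E2 S2_def by (auto simp: space_PiM \<Delta>_def \<tau>n \<tau>Sn)
    have E'ev: "E' \<in> events" unfolding E'_def
      by (rule measurable_sets[OF _ S]) (auto intro: measurable_restrict)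
    have sum_eq: "(\<Sum>i<idx r. (\<lambda>i\<in>{..<n}. \<Delta> i \<omega>) i) = (\<Sum>i<idx r. \<Delta> i \<omega>)" if "r \<in> J" for r \<omega>
      using idx[OF that] by (intro sum.cong) auto
    have eq: "(\<Sum>i<idx r. (\<lambda>i\<in>{..<n}. \<Delta> i \<omega>) i) = V r \<omega> - V 0 \<omega>" if "r \<in> J" for r \<omega>
      using sum_eq[OF that, of \<omega>] tel[of \<omega> "idx r"] idx(2)[OF that] by (simp only:)
    have "\<omega> \<in> E' \<longleftrightarrow> \<omega> \<in> space M \<and> (\<forall>r\<in>J. (\<Sum>i<idx r. (\<lambda>i\<in>{..<n}. \<Delta> i \<omega>) i) \<in> A r)" for \<omega>
      unfolding E'_def S_def by (auto simp: space_PiM)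
    then have E'_iff: "\<omega> \<in> E' \<longleftrightarrow> \<omega> \<in> space M \<and> (\<forall>r\<in>J. V r \<omega> - V 0 \<omega> \<in> A r)" for \<omega>
      by (simp only: eq cong: ball_cong)
    have ae: "AE \<omega> in M. (\<omega> \<in> E) = (\<omega> \<in> E')"
      using V0 by eventually_elim (auto simp: E E'_iff)
    have Eev: "E \<in> events" "E2 \<in> events" using \<open>E \<in> C\<close> \<open>E2 \<in> D\<close> C_ev D_ev by auto
    have "prob (E \<inter> E2) = prob (E' \<inter> E2)"
      by (rule finite_measure_eq_AE) (use ae Eev E'ev in auto)
    also have "\<dots> = prob E' * prob E2"
    proof -
      have *: "indep_set (sigma_sets (space M) {(\<lambda>\<omega>. \<lambda>i\<in>{..<n}. \<Delta> i \<omega>) -` A \<inter> space M |A. A \<in> sets (PiM {..<n} (\<lambda>_. borel))})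
          (sigma_sets (space M) {(\<lambda>\<omega>. \<lambda>i\<in>{n}. \<Delta> i \<omega>) -` A \<inter> space M |A. A \<in> sets (PiM {n} (\<lambda>_. borel))})"
        using ind unfolding indep_var_eq by auto
      show ?thesis
        by (rule indep_setD[OF *]) (use S S2 in \<open>auto simp: E'_def E2'\<close>)
    qed
    also have "prob E' = prob E" by (rule finite_measure_eq_AE) (use ae Eev E'ev in auto)
    finally show "prob (E \<inter> E2) = prob E * prob E2" .
  qed
  moreover have "Int_stable C"
    unfolding Int_stable_def
  proof (intro ballI)
    fix E E' assume "E \<in> C" "E' \<in> C"
    from \<open>E \<in> C\<close> obtain J A where J: "finite J" "J \<subseteq> {0..s}" "\<forall>r\<in>J. A r \<in> sets borel"
      and E: "E = {\<omega> \<in> space M. \<forall>r\<in>J. V r \<omega> \<in> A r}" unfolding C_def by blast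
    from \<open>E' \<in> C\<close> obtain J' A' where J': "finite J'" "J' \<subseteq> {0..s}" "\<forall>r\<in>J'. A' r \<in> sets borel"
      and E': "E' = {\<omega> \<in> space M. \<forall>r\<in>J'. V r \<omega> \<in> A' r}" unfolding C_def by blast
    define A'' where "A'' = (\<lambda>r. (if r \<in> J then A r else UNIV) \<inter> (if r \<in> J' then A' r else UNIV))"
    have "E \<inter> E' = {\<omega> \<in> space M. \<forall>r\<in>J \<union> J'. V r \<omega> \<in> A'' r}"
      unfolding E E' A''_def by (intro set_eqI) (simp, blast)
    moreover have "\<forall>r\<in>J \<union> J'. A'' r \<in> sets borel"
      using J(3) J'(3) unfolding A''_def by simp
    ultimately show "E \<inter> E' \<in> C" unfolding C_def
      by (intro CollectI exI[of _ "J \<union> J'"] exI[of _ A'']) (simp add: J J')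
  qed
  moreover have "Int_stable D"
    unfolding Int_stable_def D_def
  proof safe
    fix A B :: "real set" assume "A \<in> sets borel" "B \<in> sets borel"
    then show "\<exists>Aa. ((\<lambda>\<omega>. V t \<omega> - V s \<omega>) -` A \<inter> space M) \<inter> ((\<lambda>\<omega>. V t \<omega> - V s \<omega>) -` B \<inter> space M)
      = (\<lambda>\<omega>. V t \<omega> - V s \<omega>) -` Aa \<inter> space M \<and> Aa \<in> sets borel"
      by (intro exI[of _ "A \<inter> B"]) auto
  qed
  ultimately have *: "indep_set (sigma_sets (space M) C) (sigma_sets (space M) D)"
    by (rule indep_set_sigma_sets)
  have sub: "sigma_sets (space M) {V r -` A \<inter> space M | r A. 0 \<le> r \<and> r \<le> s \<and> A \<in> sets borel}
      \<subseteq> sigma_sets (space M) C"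
  proof (rule sigma_sets_mono', safe)
    fix r A assume "0 \<le> r" "r \<le> s" "A \<in> sets (borel :: real measure)"
    then show "V r -` A \<inter> space M \<in> C" unfolding C_def
      by (intro CollectI exI[of _ "{r}"] exI[of _ "\<lambda>_. A"]) auto
  qed
  show ?thesis
    by (rule indep_set_mono[OF * sub]) (simp add: D_def)
qed

text \<open>The past of one process together with the entire paths of all the others.  An increment of the
  distinguished process is independent even of this large \<open>\<sigma>\<close>-algebra, which allows the increments of
  two different Brownian motions over the same time interval to be averaged one after the other.\<close>

definition past_and_others :: "'a measure \<Rightarrow> (real \<Rightarrow> 'a \<Rightarrow> real) list \<Rightarrow> nat \<Rightarrow> real \<Rightarrow> 'a measure" where
  "past_and_others M Ws i s = sigma (space M)
     {(Ws ! j) r -` A \<inter> space M | j r A. j < length Ws \<and> 0 \<le> r \<and> (j = i \<longrightarrow> r \<le> s) \<and> A \<in> sets borel}"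

lemma space_past_and_others[simp]: "space (past_and_others M Ws i s) = space M"
  by (simp add: past_and_others_def space_measure_of_conv)

lemma sets_past_and_others:
  "sets (past_and_others M Ws i s) = sigma_sets (space M)
     {(Ws ! j) r -` A \<inter> space M | j r A. j < length Ws \<and> 0 \<le> r \<and> (j = i \<longrightarrow> r \<le> s) \<and> A \<in> sets borel}"
  unfolding past_and_others_def by (rule sets_measure_of) auto

text \<open>Events \<open>E \<inter> E'\<close> with \<open>E\<close> in the past of the \<open>i\<close>-th process and \<open>E'\<close> determined by the other processes
  form an intersection-stable generator; on it the claim follows by first splitting off \<open>E'\<close>
  (independence of the processes) and then the increment (independence of increments).\<close>

lemma (in prob_space) indep_set_past_and_others:
  assumes ind: "independent_processes M Ws" and i: "i < length Ws"
    and bm: "brownian_motion M (Ws ! i)" and st: "0 \<le> s" "s < t"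
  shows "indep_set (sets (past_and_others M Ws i s))
     (sigma_sets (space M) {(\<lambda>\<omega>. (Ws ! i) t \<omega> - (Ws ! i) s \<omega>) -` A \<inter> space M | A. A \<in> sets borel})"
proof -
  let ?P = "PiM {0::real..} (\<lambda>_. borel :: real measure)"
  let ?V = "Ws ! i"
  define X where "X = (\<lambda>i \<omega>. \<lambda>t\<in>{0..}. (Ws ! i) t \<omega>)"
  define K where "K = (\<lambda>j. {X j -` A \<inter> space M | A. A \<in> sets ?P})"
  define I where "I = (\<lambda>b. if b then {i} else {..<length Ws} - {i})"
  define D where "D = sigma_sets (space M) {(\<lambda>\<omega>. ?V t \<omega> - ?V s \<omega>) -` A \<inter> space M | A. A \<in> sets borel}"
  define P where "P = sigma_sets (space M) {?V r -` A \<inter> space M | r A. 0 \<le> r \<and> r \<le> s \<and> A \<in> sets borel}"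
  define Q where "Q = sigma_sets (space M) (\<Union>j\<in>I False. K j)"
  have Xm: "X j \<in> measurable M ?P" if "j < length Ws" for j
    using ind that unfolding independent_processes_def X_def indep_vars_def by auto
  have indK: "indep_sets K {..<length Ws}"
    using ind unfolding independent_processes_def indep_vars_def2 K_def X_def by auto
  have Kgen: "(Ws ! j) r -` A \<inter> space M \<in> K j" if "0 \<le> r" "A \<in> sets borel" for j r A
  proof -
    have "(\<lambda>f. f r) -` A \<inter> space ?P \<in> sets ?P"
      by (rule measurable_sets[OF measurable_component_singleton]) (use that in auto)
    moreover have "(Ws ! j) r -` A \<inter> space M = X j -` ((\<lambda>f. f r) -` A \<inter> space ?P) \<inter> space M"
      using that by (auto simp: X_def space_PiM)
    ultimately show ?thesis unfolding K_def by blast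
  qed
  have K_ev: "K j \<subseteq> events" if "j < length Ws" for j
    unfolding K_def using measurable_sets[OF Xm[OF that]] by auto
  have PD: "indep_set P D"
    unfolding P_def D_def by (rule indep_set_past_increment[OF bm st])
  have "indep_sets (\<lambda>b. sigma_sets (space M) (\<Union>j\<in>I b. K j)) UNIV"
  proof (rule indep_sets_collect_sigma)
    have "(\<Union>b. I b) = {..<length Ws}" using i by (auto simp: I_def)
    then show "indep_sets K (\<Union>b\<in>UNIV. I b)" using indK by simp
    show "Int_stable (K j)" for j
      unfolding Int_stable_def K_def
    proof safe
      fix A B assume "A \<in> sets ?P" "B \<in> sets ?P"
      then show "\<exists>Aa. (X j -` A \<inter> space M) \<inter> (X j -` B \<inter> space M) = X j -` Aa \<inter> space M \<and> Aa \<in> sets ?P"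
        by (intro exI[of _ "A \<inter> B"]) auto
    qed
    show "disjoint_family_on I UNIV" by (auto simp: disjoint_family_on_def I_def)
  qed
  then have "indep_sets (case_bool (sigma_sets (space M) (K i)) Q) UNIV"
    by (rule indep_sets_cong[THEN iffD1, rotated -1]) (auto simp: I_def Q_def split: bool.split)
  then have KQ: "indep_set (sigma_sets (space M) (K i)) Q" unfolding indep_set_def .
  have PK: "P \<subseteq> sigma_sets (space M) (K i)"
    unfolding P_def by (rule sigma_sets_mono') (use Kgen in auto)
  have DK: "D \<subseteq> sigma_sets (space M) (K i)"
  proof -
    let ?N = "sigma (space M) (K i)"
    have Ksub: "K i \<subseteq> Pow (space M)" using K_ev[OF i] sets.sets_into_space by blast
    have "?V r \<in> borel_measurable ?N" if "0 \<le> r" for r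
      using Kgen[OF that] Ksub by (intro measurableI) (auto simp: space_measure_of_conv)
    then have "(\<lambda>\<omega>. ?V t \<omega> - ?V s \<omega>) \<in> borel_measurable ?N" using st by auto
    then have "(\<lambda>\<omega>. ?V t \<omega> - ?V s \<omega>) -` A \<inter> space M \<in> sigma_sets (space M) (K i)" if "A \<in> sets borel" for A
      using measurable_sets[OF _ that, of _ ?N] Ksub by (simp add: space_measure_of_conv)
    then show ?thesis unfolding D_def by (intro sigma_sets_mono) auto
  qed
  interpret P: sigma_algebra "space M" P
    unfolding P_def by (rule sigma_algebra_sigma_sets) auto
  interpret Q: sigma_algebra "space M" Q
    unfolding Q_def by (rule sigma_algebra_sigma_sets) (auto simp: K_def)
  interpret KK: sigma_algebra "space M" "sigma_sets (space M) (K i)"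
    by (rule sigma_algebra_sigma_sets) (auto simp: K_def)
  define G where "G = {E \<inter> E' | E E'. E \<in> P \<and> E' \<in> Q}"
  have ev: "P \<subseteq> events" "Q \<subseteq> events" "D \<subseteq> events"
    using PD KQ unfolding indep_sets2_eq by auto
  have "indep_set G D"
    unfolding indep_sets2_eq
  proof (intro conjI ballI)
    show "G \<subseteq> events" "D \<subseteq> events" using ev by (auto simp: G_def)
    fix a d assume "a \<in> G" and d: "d \<in> D"
    then obtain E E' where E: "a = E \<inter> E'" "E \<in> P" "E' \<in> Q" by (auto simp: G_def)
    have "prob (a \<inter> d) = prob ((E \<inter> d) \<inter> E')" by (simp add: E Int_ac)
    also have "\<dots> = prob (E \<inter> d) * prob E'"
      by (rule indep_setD[OF KQ]) (use E d PK DK in auto)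
    also have "prob (E \<inter> d) = prob E * prob d" by (rule indep_setD[OF PD E(2) d])
    also have "prob E * prob d * prob E' = (prob E * prob E') * prob d" by simp
    also have "prob E * prob E' = prob a" unfolding E(1)
      by (rule indep_setD[OF KQ, symmetric]) (use E PK in auto)
    finally show "prob (a \<inter> d) = prob a * prob d" .
  qed
  moreover have "Int_stable G"
    unfolding Int_stable_def
  proof (intro ballI)
    fix a b assume "a \<in> G" "b \<in> G"
    then obtain E E' H H' where *: "a = E \<inter> E'" "E \<in> P" "E' \<in> Q" "b = H \<inter> H'" "H \<in> P" "H' \<in> Q"
      by (auto simp: G_def)
    then have "a \<inter> b = (E \<inter> H) \<inter> (E' \<inter> H')" by auto
    then show "a \<inter> b \<in> G" unfolding G_def using * by blast
  qed
  moreover have "Int_stable D"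
  proof -
    interpret D: sigma_algebra "space M" D
      unfolding D_def by (rule sigma_algebra_sigma_sets) auto
    show ?thesis by (auto simp: Int_stable_def)
  qed
  ultimately have *: "indep_set (sigma_sets (space M) G) (sigma_sets (space M) D)"
    by (rule indep_set_sigma_sets)
  have "sets (past_and_others M Ws i s) \<subseteq> sigma_sets (space M) G"
    unfolding sets_past_and_others
  proof (rule sigma_sets_mono', rule subsetI)
    fix U
    assume "U \<in> {(Ws ! j) r -` A \<inter> space M | j r A.
      j < length Ws \<and> 0 \<le> r \<and> (j = i \<longrightarrow> r \<le> s) \<and> A \<in> sets borel}"
    then obtain j r A where a: "j < length Ws" "0 \<le> r" "j = i \<longrightarrow> r \<le> s" "A \<in> sets borel"
      and U: "U = (Ws ! j) r -` A \<inter> space M" by blast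
    have PG: "a \<in> G" if "a \<in> P" for a
    proof -
      have "a = a \<inter> space M" using P.sets_into_space[OF that] by blast
      then show ?thesis unfolding G_def using that Q.top by blast
    qed
    have QG: "a \<in> G" if "a \<in> Q" for a
    proof -
      have "a = space M \<inter> a" using Q.sets_into_space[OF that] by blast
      then show ?thesis unfolding G_def using that P.top by blast
    qed
    show "U \<in> G"
    proof (cases "j = i")
      case True
      then have "U \<in> P" unfolding P_def U using a by (intro sigma_sets.Basic) auto
      then show ?thesis by (rule PG)
    next
      case False
      then have "U \<in> Q" unfolding Q_def U using a Kgen[of r A j]
        by (intro sigma_sets.Basic) (auto simp: I_def)
      then show ?thesis by (rule QG)
    qed
  qed
  then have "indep_set (sets (past_and_others M Ws i s)) D"
    by (rule indep_set_mono[OF *]) auto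
  then show ?thesis unfolding D_def .
qed


section \<open>Integrators and the maximal inequality for elementary integrals\<close>

text \<open>The filtration is a parameter because the same Brownian motion occurs both with the filtration of
  the stochastic integrals and with the larger one that also contains the paths of the others.\<close>

locale ito_integrator = prob_space M for M :: "'a measure" +
  fixes F :: "real \<Rightarrow> 'a measure" and B :: "real \<Rightarrow> 'a \<Rightarrow> real"
  assumes F_sub: "0 \<le> s \<Longrightarrow> subalgebra M (F s)"
    and F_mono: "0 \<le> s \<Longrightarrow> s \<le> t \<Longrightarrow> subalgebra (F t) (F s)"
    and B_adapted: "0 \<le> t \<Longrightarrow> B t \<in> borel_measurable (F t)"
    and increment_normal: "0 \<le> s \<Longrightarrow> s < t \<Longrightarrow>
      distributed M lborel (\<lambda>\<omega>. B t \<omega> - B s \<omega>) (normal_density 0 (sqrt (t - s)))"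
    and increment_indep: "0 \<le> s \<Longrightarrow> s < t \<Longrightarrow> indep_set (sets (F s))
      (sigma_sets (space M) {(\<lambda>\<omega>. B t \<omega> - B s \<omega>) -` A \<inter> space M | A. A \<in> sets borel})"
begin

lemma space_F: "0 \<le> s \<Longrightarrow> space (F s) = space M"
  using F_sub by (auto simp: subalgebra_def)

lemma F_measurable_M: "0 \<le> s \<Longrightarrow> f \<in> borel_measurable (F s) \<Longrightarrow> f \<in> borel_measurable M"
  using measurable_from_subalg[OF F_sub] .

lemma F_measurable_mono:
  "0 \<le> s \<Longrightarrow> s \<le> t \<Longrightarrow> f \<in> borel_measurable (F s) \<Longrightarrow> f \<in> borel_measurable (F t)"
  using measurable_from_subalg[OF F_mono] .

lemma B_measurable: "0 \<le> t \<Longrightarrow> B t \<in> borel_measurable M"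
  using F_measurable_M B_adapted by blast

lemma
  assumes st: "0 \<le> s" "s < t"
  shows integrable_increment: "integrable M (\<lambda>\<omega>. B t \<omega> - B s \<omega>)"
    and integral_increment: "(\<integral>\<omega>. B t \<omega> - B s \<omega> \<partial>M) = 0"
    and integrable_increment2: "integrable M (\<lambda>\<omega>. (B t \<omega> - B s \<omega>)^2)"
    and integral_increment2: "(\<integral>\<omega>. (B t \<omega> - B s \<omega>)^2 \<partial>M) = t - s"
    and integrable_increment4: "integrable M (\<lambda>\<omega>. (B t \<omega> - B s \<omega>)^4)"
    and integral_increment4: "(\<integral>\<omega>. (B t \<omega> - B s \<omega>)^4 \<partial>M) = 3 * (t - s)^2"
proof -
  have \<sigma>: "0 < sqrt (t - s)" using st by simp
  note D = increment_normal[OF st]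
  have int: "integrable M (\<lambda>\<omega>. (B t \<omega> - B s \<omega>)^k)" for k
    using distributed_integrable[OF D, of "\<lambda>x. x ^ k"] integrable_normal_moment[OF \<sigma>, of 0 k] by simp
  have eq: "(\<integral>\<omega>. (B t \<omega> - B s \<omega>)^k \<partial>M) = (\<integral>x. normal_density 0 (sqrt (t - s)) x * x ^ k \<partial>lborel)" for k
    using distributed_integral[OF D, of "\<lambda>x. x ^ k"] by simp
  show "integrable M (\<lambda>\<omega>. B t \<omega> - B s \<omega>)" using int[of 1] by simp
  show "integrable M (\<lambda>\<omega>. (B t \<omega> - B s \<omega>)^2)" "integrable M (\<lambda>\<omega>. (B t \<omega> - B s \<omega>)^4)" by (fact int)+
  show "(\<integral>\<omega>. B t \<omega> - B s \<omega> \<partial>M) = 0"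
    using eq[of 1] integral_normal_moment_odd[OF \<sigma>, of 0 0] by simp
  show "(\<integral>\<omega>. (B t \<omega> - B s \<omega>)^2 \<partial>M) = t - s"
    using eq[of 2] integral_normal_moment_even[OF \<sigma>, of 0 1] st by simp
  have "(\<integral>\<omega>. (B t \<omega> - B s \<omega>)^4 \<partial>M) = fact 4 / ((2 / (t - s))^2 * fact 2)"
    using eq[of 4] integral_normal_moment_even[OF \<sigma>, of 0 2] st by simp
  also have "\<dots> = 3 * (t - s)^2" using st by (simp add: fact_numeral power2_eq_square field_simps)
  finally show "(\<integral>\<omega>. (B t \<omega> - B s \<omega>)^4 \<partial>M) = 3 * (t - s)^2" .
qed

lemma
  fixes \<phi> :: "'a \<Rightarrow> real" and h :: "real \<Rightarrow> real"
  assumes st: "0 \<le> s" "s < t" and \<phi>: "\<phi> \<in> borel_measurable (F s)" "integrable M \<phi>"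
    and h: "h \<in> borel_measurable borel" "integrable M (\<lambda>\<omega>. h (B t \<omega> - B s \<omega>))"
  shows integrable_mult_increment: "integrable M (\<lambda>\<omega>. \<phi> \<omega> * h (B t \<omega> - B s \<omega>))"
    and integral_mult_increment: "(\<integral>\<omega>. \<phi> \<omega> * h (B t \<omega> - B s \<omega>) \<partial>M)
      = (\<integral>\<omega>. \<phi> \<omega> \<partial>M) * (\<integral>\<omega>. h (B t \<omega> - B s \<omega>) \<partial>M)"
proof -
  let ?D = "\<lambda>\<omega>. B t \<omega> - B s \<omega>"
  have "?D \<in> borel_measurable M" using B_measurable st by (intro borel_measurable_diff) auto
  moreover have "\<phi> \<in> borel_measurable M" using F_measurable_M st \<phi> by blast
  moreover have "sigma_sets (space M) {\<phi> -` A \<inter> space M | A. A \<in> sets borel} \<subseteq> sets (F s)"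
    unfolding space_F[OF st(1), symmetric]
    by (intro sets.sigma_sets_subset) (use measurable_sets[OF \<phi>(1)] in auto)
  then have "indep_set (sigma_sets (space M) {\<phi> -` A \<inter> space M | A. A \<in> sets borel})
     (sigma_sets (space M) {?D -` A \<inter> space M | A. A \<in> sets borel})"
    by (rule indep_set_mono[OF increment_indep[OF st]]) simp
  ultimately have "indep_var borel \<phi> borel ?D" unfolding indep_var_eq by simp
  from indep_var_compose[OF this measurable_ident h(1)]
  have "indep_var borel \<phi> borel (\<lambda>\<omega>. h (?D \<omega>))" by (simp add: comp_def)
  from indep_var_integrable[OF this \<phi>(2) h(2)] indep_var_lebesgue_integral[OF this \<phi>(2) h(2)]
  show "integrable M (\<lambda>\<omega>. \<phi> \<omega> * h (?D \<omega>))"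
    "(\<integral>\<omega>. \<phi> \<omega> * h (?D \<omega>) \<partial>M) = (\<integral>\<omega>. \<phi> \<omega> \<partial>M) * (\<integral>\<omega>. h (?D \<omega>) \<partial>M)" .
qed

definition elementary_sum :: "(nat \<Rightarrow> real) \<Rightarrow> (nat \<Rightarrow> 'a \<Rightarrow> real) \<Rightarrow> nat \<Rightarrow> 'a \<Rightarrow> real" where
  "elementary_sum t \<xi> k \<omega> = (\<Sum>i<k. \<xi> i \<omega> * (B (t (Suc i)) \<omega> - B (t i) \<omega>))"

context
  fixes t :: "nat \<Rightarrow> real" and m :: nat
  assumes t0: "0 \<le> t 0" and t_Suc: "\<And>i. i < m \<Longrightarrow> t i < t (Suc i)"
begin

lemma grid_mono: "i \<le> j \<Longrightarrow> j \<le> m \<Longrightarrow> t i \<le> t j"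
proof (induction j rule: dec_induct)
  case (step k)
  then show ?case using t_Suc[of k] by force
qed simp

lemma grid_nonneg: "i \<le> m \<Longrightarrow> 0 \<le> t i"
  using grid_mono[of 0 i] t0 by simp

lemma elementary_sum_adapted:
  assumes \<xi>: "\<And>i. i < m \<Longrightarrow> \<xi> i \<in> borel_measurable (F (t i))" and k: "k \<le> l" "l \<le> m"
  shows "elementary_sum t \<xi> k \<in> borel_measurable (F (t l))"
  unfolding elementary_sum_def
proof (intro borel_measurable_sum borel_measurable_times borel_measurable_diff)
  fix i assume i: "i \<in> {..<k}"
  show "\<xi> i \<in> borel_measurable (F (t l))"
    by (rule F_measurable_mono[OF _ _ \<xi>]) (use i k grid_nonneg[of i] grid_mono[of i l] in auto)
  show "B (t (Suc i)) \<in> borel_measurable (F (t l))"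
    by (rule F_measurable_mono[OF _ _ B_adapted])
      (use i k grid_nonneg[of "Suc i"] grid_mono[of "Suc i" l] in auto)
  show "B (t i) \<in> borel_measurable (F (t l))"
    by (rule F_measurable_mono[OF _ _ B_adapted])
      (use i k grid_nonneg[of i] grid_mono[of i l] in auto)
qed

text \<open>The mixed term in the square of a partial sum vanishes because the next increment is centred and
  independent of the past.\<close>

lemma elementary_isometry:
  assumes \<xi>: "\<And>i. i < m \<Longrightarrow> \<xi> i \<in> borel_measurable (F (t i))"
    and bd: "\<And>i \<omega>. i < m \<Longrightarrow> \<omega> \<in> space M \<Longrightarrow> \<bar>\<xi> i \<omega>\<bar> \<le> C i"
    and k: "k \<le> m"
  shows "integrable M (\<lambda>\<omega>. (elementary_sum t \<xi> k \<omega>)^2) \<and>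
     (\<integral>\<omega>. (elementary_sum t \<xi> k \<omega>)^2 \<partial>M) = (\<Sum>i<k. (\<integral>\<omega>. (\<xi> i \<omega>)^2 \<partial>M) * (t (Suc i) - t i))"
  using k
proof (induction k)
  case 0
  then show ?case by (simp add: elementary_sum_def)
next
  case (Suc k)
  then have km: "k < m" and kle: "k \<le> m" by auto
  let ?S = "elementary_sum t \<xi> k" and ?D = "\<lambda>\<omega>. B (t (Suc k)) \<omega> - B (t k) \<omega>"
  note st = grid_nonneg[OF kle] t_Suc[OF km]
  have Sm: "?S \<in> borel_measurable (F (t k))" by (rule elementary_sum_adapted[OF \<xi>]) (use kle in auto)
  have SM: "?S \<in> borel_measurable M" using F_measurable_M[OF st(1) Sm] .
  have \<xi>M: "\<xi> k \<in> borel_measurable M" using F_measurable_M[OF st(1) \<xi>[OF km]] .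
  have S2: "integrable M (\<lambda>\<omega>. (?S \<omega>)^2)" using Suc.IH kle by simp
  have S1: "integrable M ?S" by (rule square_integrable_imp_integrable[OF SM S2])
  have "integrable M (\<lambda>\<omega>. C k * ?S \<omega>)" using S1 by simp
  then have S\<xi>: "integrable M (\<lambda>\<omega>. 2 * ?S \<omega> * \<xi> k \<omega>)"
  proof (rule Bochner_Integration.integrable_bound[OF integrable_mult_right[of 2]])
    show "(\<lambda>\<omega>. 2 * ?S \<omega> * \<xi> k \<omega>) \<in> borel_measurable M" using SM \<xi>M by simp
    show "AE \<omega> in M. norm (2 * ?S \<omega> * \<xi> k \<omega>) \<le> norm (2 * (C k * ?S \<omega>))"
    proof (rule AE_I2)
      fix \<omega> assume w: "\<omega> \<in> space M"
      have "\<bar>\<xi> k \<omega>\<bar> \<le> \<bar>C k\<bar>" using bd[OF km w] by linarith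
      from mult_right_mono[OF this, of "2 * \<bar>?S \<omega>\<bar>"]
      show "norm (2 * ?S \<omega> * \<xi> k \<omega>) \<le> norm (2 * (C k * ?S \<omega>))" by (simp add: abs_mult mult_ac)
    qed
  qed
  have \<xi>2: "integrable M (\<lambda>\<omega>. (\<xi> k \<omega>)^2)"
  proof (rule integrable_const_bound[of _ "(C k)^2"])
    show "AE \<omega> in M. norm ((\<xi> k \<omega>)^2) \<le> (C k)^2"
      using bd[OF km] by (intro AE_I2) (metis abs_ge_zero norm_power power_mono real_norm_def)
    show "(\<lambda>\<omega>. (\<xi> k \<omega>)^2) \<in> borel_measurable M" using \<xi>M by simp
  qed
  have S\<xi>F: "(\<lambda>\<omega>. 2 * ?S \<omega> * \<xi> k \<omega>) \<in> borel_measurable (F (t k))" using Sm \<xi>[OF km] by simp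
  have \<xi>2F: "(\<lambda>\<omega>. (\<xi> k \<omega>)^2) \<in> borel_measurable (F (t k))" using \<xi>[OF km] by simp
  have idm: "(\<lambda>x::real. x) \<in> borel_measurable borel" by simp
  note A = integrable_mult_increment[OF st S\<xi>F S\<xi> idm integrable_increment[OF st]]
    integral_mult_increment[OF st S\<xi>F S\<xi> idm integrable_increment[OF st]]
  have sq: "(\<lambda>x::real. x^2) \<in> borel_measurable borel" by simp
  note A2 = integrable_mult_increment[OF st \<xi>2F \<xi>2 sq integrable_increment2[OF st]]
    integral_mult_increment[OF st \<xi>2F \<xi>2 sq integrable_increment2[OF st]]
  have eq: "(elementary_sum t \<xi> (Suc k) \<omega>)^2
      = (?S \<omega>)^2 + ((2 * ?S \<omega> * \<xi> k \<omega>) * ?D \<omega> + (\<xi> k \<omega>)^2 * (?D \<omega>)^2)" for \<omega>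
    by (simp add: elementary_sum_def power2_eq_square algebra_simps)
  have "integrable M (\<lambda>\<omega>. (2 * ?S \<omega> * \<xi> k \<omega>) * ?D \<omega> + (\<xi> k \<omega>)^2 * (?D \<omega>)^2)"
    using A(1) A2(1) by (rule Bochner_Integration.integrable_add)
  then show ?case
    unfolding eq using S2 A A2 Suc.IH kle integral_increment[OF st] integral_increment2[OF st] by simp
qed

text \<open>
  The coefficients are replaced by zero as soon as the accumulated energy exceeds \<open>\<delta>\<close> or some partial
  sum exceeds \<open>\<epsilon>\<close>; both conditions are known at the left end of the interval, so the stopped
  coefficients are still adapted.  The first condition makes the stopped coefficients bounded with
  total energy at most \<open>\<delta>\<close>, so the isometry and Chebyshev's inequality apply to a single random variable;
  the second one makes the final stopped sum remember that the running maximum was large.\<close>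

lemma elementary_maximal_inequality:
  assumes \<xi>: "\<And>i. i < m \<Longrightarrow> \<xi> i \<in> borel_measurable (F (t i))"
    and \<epsilon>: "\<epsilon> > 0" and \<delta>: "\<delta> \<ge> 0"
  shows "prob {\<omega> \<in> space M. \<exists>k\<le>m. \<bar>elementary_sum t \<xi> k \<omega>\<bar> > \<epsilon>}
     \<le> prob {\<omega> \<in> space M. (\<Sum>i<m. (\<xi> i \<omega>)^2 * (t (Suc i) - t i)) > \<delta>} + \<delta> / \<epsilon>^2"
proof -
  define Q where "Q = (\<lambda>i \<omega>. \<Sum>j<i. (\<xi> j \<omega>)^2 * (t (Suc j) - t j))"
  define P where "P = (\<lambda>i \<omega>. Q (Suc i) \<omega> \<le> \<delta> \<and> (\<forall>k\<in>{..i}. \<bar>elementary_sum t \<xi> k \<omega>\<bar> \<le> \<epsilon>))"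
  define \<xi>' where "\<xi>' = (\<lambda>i \<omega>. if P i \<omega> then \<xi> i \<omega> else 0)"
  have Qm: "Q i \<in> borel_measurable (F (t l))" if "i \<le> Suc l" "i \<le> m" "l \<le> m" for i l
    unfolding Q_def
  proof (intro borel_measurable_sum borel_measurable_times borel_measurable_power borel_measurable_const)
    fix j assume "j \<in> {..<i}"
    then show "\<xi> j \<in> borel_measurable (F (t l))"
      by (intro F_measurable_mono[OF _ _ \<xi>]) (use that grid_nonneg[of j] grid_mono[of j l] in auto)
  qed
  have Qmono: "Q i \<omega> \<le> Q j \<omega>" if "i \<le> j" "j \<le> m" for i j \<omega>
    unfolding Q_def using that t_Suc
    by (intro sum_mono2 mult_nonneg_nonneg) (auto intro!: less_imp_le)
  have \<xi>'m: "\<xi>' i \<in> borel_measurable (F (t i))" if "i < m" for i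
  proof -
    have [measurable]: "Q (Suc i) \<in> borel_measurable (F (t i))"
      using that by (intro Qm) auto
    have [measurable]: "elementary_sum t \<xi> k \<in> borel_measurable (F (t i))" if "k \<in> {..i}" for k
      by (rule elementary_sum_adapted[OF \<xi>]) (use that \<open>i < m\<close> in auto)
    have [measurable]: "\<xi> i \<in> borel_measurable (F (t i))" using \<xi>[OF that] .
    show ?thesis unfolding \<xi>'_def P_def by measurable
  qed
  have sumbd: "(\<Sum>i<k. (\<xi>' i \<omega>)^2 * (t (Suc i) - t i)) \<le> \<delta>" if "k \<le> m" for k \<omega>
    using that
  proof (induction k)
    case (Suc k)
    show ?case
    proof (cases "P k \<omega>")
      case True
      have "(\<Sum>i<Suc k. (\<xi>' i \<omega>)^2 * (t (Suc i) - t i)) \<le> Q (Suc k) \<omega>"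
        unfolding Q_def
      proof (rule sum_mono)
        fix i assume "i \<in> {..<Suc k}"
        then have "0 \<le> t (Suc i) - t i" using t_Suc[of i] Suc.prems by auto
        then show "(\<xi>' i \<omega>)^2 * (t (Suc i) - t i) \<le> (\<xi> i \<omega>)^2 * (t (Suc i) - t i)"
          by (intro mult_right_mono) (auto simp: \<xi>'_def)
      qed
      then show ?thesis using True by (simp add: P_def)
    next
      case False
      then show ?thesis using Suc by (simp add: \<xi>'_def)
    qed
  qed (simp add: \<delta>)
  have bd: "\<bar>\<xi>' i \<omega>\<bar> \<le> sqrt (\<delta> / (t (Suc i) - t i))" if i: "i < m" for i \<omega>
  proof (rule real_le_rsqrt)
    have "(\<xi>' i \<omega>)^2 * (t (Suc i) - t i) \<le> (\<Sum>i<m. (\<xi>' i \<omega>)^2 * (t (Suc i) - t i))"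
      by (rule member_le_sum[where f="\<lambda>i. (\<xi>' i \<omega>)^2 * (t (Suc i) - t i)"])
        (use i t_Suc in \<open>auto simp: less_imp_le\<close>)
    also have "\<dots> \<le> \<delta>" by (rule sumbd) simp
    finally show "\<bar>\<xi>' i \<omega>\<bar>^2 \<le> \<delta> / (t (Suc i) - t i)"
      using t_Suc[OF i] by (simp add: field_simps)
  qed
  let ?N = "elementary_sum t \<xi>' m"
  have iso: "integrable M (\<lambda>\<omega>. (?N \<omega>)^2)"
    "(\<integral>\<omega>. (?N \<omega>)^2 \<partial>M) = (\<Sum>i<m. (\<integral>\<omega>. (\<xi>' i \<omega>)^2 \<partial>M) * (t (Suc i) - t i))"
    using elementary_isometry[of \<xi>' "\<lambda>i. sqrt (\<delta> / (t (Suc i) - t i))" m] \<xi>'m bd by auto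
  have \<xi>'M: "\<xi>' i \<in> borel_measurable M" if "i < m" for i
    by (rule F_measurable_M[OF _ \<xi>'m[OF that]]) (use grid_nonneg that in auto)
  have int\<xi>: "integrable M (\<lambda>\<omega>. (\<xi>' i \<omega>)^2)" if i: "i < m" for i
  proof (rule integrable_const_bound[of _ "(sqrt (\<delta> / (t (Suc i) - t i)))^2"])
    have "\<bar>\<xi>' i \<omega>\<bar>^2 \<le> (sqrt (\<delta> / (t (Suc i) - t i)))^2" for \<omega>
      by (rule power_mono[OF bd[OF i]]) simp
    then show "AE \<omega> in M. norm ((\<xi>' i \<omega>)^2) \<le> (sqrt (\<delta> / (t (Suc i) - t i)))^2" by simp
    show "(\<lambda>\<omega>. (\<xi>' i \<omega>)^2) \<in> borel_measurable M" using \<xi>'M[OF i] by simp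
  qed
  have "(\<integral>\<omega>. (?N \<omega>)^2 \<partial>M) = (\<integral>\<omega>. (\<Sum>i<m. (\<xi>' i \<omega>)^2 * (t (Suc i) - t i)) \<partial>M)"
    unfolding iso(2) using int\<xi> by (subst Bochner_Integration.integral_sum) auto
  also have "\<dots> \<le> (\<integral>\<omega>. \<delta> \<partial>M)"
    by (rule integral_mono) (use int\<xi> sumbd in auto)
  also have "\<dots> = \<delta>" by (simp add: prob_space)
  finally have EN: "(\<integral>\<omega>. (?N \<omega>)^2 \<partial>M) \<le> \<delta>" .
  have NM: "?N \<in> borel_measurable M"
    by (rule F_measurable_M[OF grid_nonneg[of m] elementary_sum_adapted[OF \<xi>'m]]) auto
  have "prob {\<omega> \<in> space M. \<bar>?N \<omega>\<bar> \<ge> \<epsilon>} \<le> (\<integral>\<omega>. (?N \<omega>)^2 \<partial>M) / \<epsilon>^2"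
    by (rule second_moment_method[OF NM iso(1) \<epsilon>])
  also have "\<dots> \<le> \<delta> / \<epsilon>^2" by (rule divide_right_mono[OF EN]) simp
  finally have cheb: "prob {\<omega> \<in> space M. \<bar>?N \<omega>\<bar> \<ge> \<epsilon>} \<le> \<delta> / \<epsilon>^2" .
  have QmM: "Q m \<in> borel_measurable M"
    by (rule F_measurable_M[OF grid_nonneg[of m] Qm[of m m]]) auto
  let ?A = "{\<omega> \<in> space M. Q m \<omega> > \<delta>}" and ?C = "{\<omega> \<in> space M. \<bar>?N \<omega>\<bar> \<ge> \<epsilon>}"
  have meas: "?A \<in> events" "?C \<in> events" using QmM NM by measurable
  have "{\<omega> \<in> space M. \<exists>k\<le>m. \<bar>elementary_sum t \<xi> k \<omega>\<bar> > \<epsilon>} \<subseteq> ?A \<union> ?C"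
  proof
    fix \<omega> assume "\<omega> \<in> {\<omega> \<in> space M. \<exists>k\<le>m. \<bar>elementary_sum t \<xi> k \<omega>\<bar> > \<epsilon>}"
    then have w: "\<omega> \<in> space M" and ex: "\<exists>k. k \<le> m \<and> \<bar>elementary_sum t \<xi> k \<omega>\<bar> > \<epsilon>" by auto
    define k where "k = (LEAST k. k \<le> m \<and> \<bar>elementary_sum t \<xi> k \<omega>\<bar> > \<epsilon>)"
    have k: "k \<le> m" "\<bar>elementary_sum t \<xi> k \<omega>\<bar> > \<epsilon>" using LeastI_ex[OF ex] unfolding k_def by auto
    have least: "\<bar>elementary_sum t \<xi> j \<omega>\<bar> \<le> \<epsilon>" if "j < k" for j
    proof -
      have "\<not> (j \<le> m \<and> \<bar>elementary_sum t \<xi> j \<omega>\<bar> > \<epsilon>)" using not_less_Least that unfolding k_def by blast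
      then show ?thesis using that k(1) by auto
    qed
    show "\<omega> \<in> ?A \<union> ?C"
    proof (cases "Q m \<omega> > \<delta>")
      case False
      have 1: "\<xi>' i \<omega> = \<xi> i \<omega>" if "i < k" for i
        using that False Qmono[of "Suc i" m \<omega>] least k(1) by (auto simp: \<xi>'_def P_def)
      have 2: "\<xi>' i \<omega> = 0" if "k \<le> i" for i
      proof -
        have "\<not> \<bar>elementary_sum t \<xi> k \<omega>\<bar> \<le> \<epsilon>" "k \<in> {..i}" using k(2) that by auto
        then have "\<not> P i \<omega>" unfolding P_def by blast
        then show ?thesis unfolding \<xi>'_def by simp
      qed
      have "?N \<omega> = (\<Sum>i<k. \<xi>' i \<omega> * (B (t (Suc i)) \<omega> - B (t i) \<omega>))"
        unfolding elementary_sum_def by (rule sum.mono_neutral_right) (use k 2 in auto)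
      also have "\<dots> = elementary_sum t \<xi> k \<omega>" unfolding elementary_sum_def by (rule sum.cong) (use 1 in auto)
      finally show ?thesis using w k(2) by simp
    qed (use w in auto)
  qed
  then have "prob {\<omega> \<in> space M. \<exists>k\<le>m. \<bar>elementary_sum t \<xi> k \<omega>\<bar> > \<epsilon>} \<le> prob (?A \<union> ?C)"
    by (rule finite_measure_mono) (use meas in auto)
  also have "\<dots> \<le> prob ?A + prob ?C" by (rule measure_Un_le[OF meas])
  finally show ?thesis using cheb unfolding Q_def by simp
qed

end
end


section \<open>Step processes\<close>

definition jointly_measurable :: "'a measure \<Rightarrow> (real \<Rightarrow> 'a \<Rightarrow> real) \<Rightarrow> bool" where
  "jointly_measurable M f \<longleftrightarrow>
     (\<lambda>(s, \<omega>). f s \<omega>) \<in> borel_measurable (restrict_space borel {0..} \<Otimes>\<^sub>M M)"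

definition energy :: "(real \<Rightarrow> 'a \<Rightarrow> real) \<Rightarrow> 'a \<Rightarrow> ennreal" where
  "energy f \<omega> = (\<integral>\<^sup>+ s\<in>{0..}. ennreal ((f s \<omega>)\<^sup>2) \<partial>lborel)"

abbreviation lborel_pos :: "real measure" where
  "lborel_pos \<equiv> restrict_space lborel {0..}"

lemma energy_restrict: "energy f \<omega> = (\<integral>\<^sup>+ s. ennreal ((f s \<omega>)\<^sup>2) \<partial>lborel_pos)"
  unfolding energy_def by (subst nn_integral_restrict_space) auto

lemma sets_lborel_pos: "sets lborel_pos = sets (restrict_space borel {0..})"
  by (rule sets_restrict_space_cong) simp

lemma energy_measurable:
  assumes "jointly_measurable M f"
  shows "energy f \<in> borel_measurable M"
proof -
  interpret N: sigma_finite_measure lborel_pos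
    by (rule sigma_finite_measure_restrict_space) (auto intro: sigma_finite_lborel)
  have "(\<lambda>(s, \<omega>). f s \<omega>) \<in> borel_measurable (lborel_pos \<Otimes>\<^sub>M M)"
    using assms unfolding jointly_measurable_def
    by (subst measurable_cong_sets[OF sets_pair_measure_cong[OF sets_lborel_pos refl] refl])
  then have "(\<lambda>(s, \<omega>). ennreal ((f s \<omega>)^2)) \<in> borel_measurable (lborel_pos \<Otimes>\<^sub>M M)"
    by (simp add: case_prod_beta')
  then have "(\<lambda>(\<omega>, s). ennreal ((f s \<omega>)^2)) \<in> borel_measurable (M \<Otimes>\<^sub>M lborel_pos)"
    by (subst measurable_pair_swap_iff) (simp add: case_prod_beta')
  then have "(\<lambda>\<omega>. \<integral>\<^sup>+ s. ennreal ((f s \<omega>)^2) \<partial>lborel_pos) \<in> borel_measurable M"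
    by (rule N.borel_measurable_nn_integral)
  then show ?thesis by (simp add: energy_restrict[abs_def])
qed

lemma measurable_path:
  assumes "jointly_measurable M f" "\<omega> \<in> space M"
  shows "(\<lambda>s. f s \<omega>) \<in> borel_measurable lborel_pos"
proof -
  have "(\<lambda>s. (\<lambda>(s, \<omega>). f s \<omega>) (s, \<omega>)) \<in> borel_measurable (restrict_space borel {0..})"
    using assms unfolding jointly_measurable_def
    by (intro measurable_compose[OF measurable_Pair2'])
  then show ?thesis by (simp add: measurable_cong_sets[OF sets_lborel_pos refl])
qed

lemma jointly_measurable_diff:
  "jointly_measurable M f \<Longrightarrow> jointly_measurable M g \<Longrightarrow> jointly_measurable M (\<lambda>s \<omega>. f s \<omega> - g s \<omega>)"
  unfolding jointly_measurable_def by (simp add: case_prod_beta')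

lemma jointly_measurable_add:
  "jointly_measurable M f \<Longrightarrow> jointly_measurable M g \<Longrightarrow> jointly_measurable M (\<lambda>s \<omega>. f s \<omega> + g s \<omega>)"
  unfolding jointly_measurable_def by (simp add: case_prod_beta')

lemma jointly_measurable_times:
  "jointly_measurable M f \<Longrightarrow> jointly_measurable M g \<Longrightarrow> jointly_measurable M (\<lambda>s \<omega>. f s \<omega> * g s \<omega>)"
  unfolding jointly_measurable_def by (simp add: case_prod_beta')

lemma jointly_measurable_time:
  assumes "g \<in> borel_measurable borel"
  shows "jointly_measurable M (\<lambda>s \<omega>. g s)"
  unfolding jointly_measurable_def case_prod_beta'
  by (rule measurable_compose[OF measurable_fst]) (rule measurable_restrict_space1[OF assms])

lemma jointly_measurable_restrict:
  "jointly_measurable M H \<Longrightarrow> A \<in> sets borel \<Longrightarrow> jointly_measurable M (\<lambda>s \<omega>. indicator A s * H s \<omega>)"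
  by (intro jointly_measurable_times jointly_measurable_time) simp_all

lemma jointly_measurable_state:
  "g \<in> borel_measurable M \<Longrightarrow> jointly_measurable M (\<lambda>s \<omega>. g \<omega>)"
  unfolding jointly_measurable_def case_prod_beta' by (rule measurable_compose[OF measurable_snd])

lemma energy_mono:
  assumes "\<And>s. 0 \<le> s \<Longrightarrow> \<bar>f s \<omega>\<bar> \<le> \<bar>g s \<omega>\<bar>"
  shows "energy f \<omega> \<le> energy g \<omega>"
  unfolding energy_restrict
  by (rule nn_integral_mono) (use assms in \<open>auto intro!: ennreal_leI simp: abs_le_square_iff space_restrict_space\<close>)

text \<open>The squared \<open>L\<^sup>2\<close> triangle inequality with the constant \<open>2\<close>; stating it for a pointwise bound on \<open>h\<close>
  lets it be used with restrictions of the integrands to different time intervals.\<close>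

lemma energy_triangle:
  assumes f: "jointly_measurable M f" and g: "jointly_measurable M g" and w: "\<omega> \<in> space M"
    and h: "\<And>s. 0 \<le> s \<Longrightarrow> \<bar>h s \<omega>\<bar> \<le> \<bar>f s \<omega>\<bar> + \<bar>g s \<omega>\<bar>"
  shows "energy h \<omega> \<le> 2 * energy f \<omega> + 2 * energy g \<omega>"
proof -
  have [measurable]: "(\<lambda>s. f s \<omega>) \<in> borel_measurable lborel_pos" "(\<lambda>s. g s \<omega>) \<in> borel_measurable lborel_pos"
    using measurable_path[OF f w] measurable_path[OF g w] .
  have "energy h \<omega> \<le> (\<integral>\<^sup>+ s. (2 * ennreal ((f s \<omega>)^2) + 2 * ennreal ((g s \<omega>)^2)) \<partial>lborel_pos)"
    unfolding energy_restrict
  proof (rule nn_integral_mono)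
    fix s assume "s \<in> space lborel_pos"
    then have "\<bar>h s \<omega>\<bar> \<le> \<bar>f s \<omega>\<bar> + \<bar>g s \<omega>\<bar>" using h by (simp add: space_restrict_space)
    then have "\<bar>h s \<omega>\<bar>^2 \<le> (\<bar>f s \<omega>\<bar> + \<bar>g s \<omega>\<bar>)^2" by (rule power_mono) simp
    also have "\<dots> \<le> 2 * (f s \<omega>)^2 + 2 * (g s \<omega>)^2"
      using zero_le_power2[of "\<bar>f s \<omega>\<bar> - \<bar>g s \<omega>\<bar>"]
      by (simp add: power2_sum power2_diff)
    finally have "ennreal ((h s \<omega>)^2) \<le> ennreal (2 * (f s \<omega>)^2 + 2 * (g s \<omega>)^2)"
      by (intro ennreal_leI) simp
    then show "ennreal ((h s \<omega>)^2) \<le> 2 * ennreal ((f s \<omega>)^2) + 2 * ennreal ((g s \<omega>)^2)"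
      by (simp add: ennreal_plus ennreal_mult)
  qed
  also have "\<dots> = 2 * energy f \<omega> + 2 * energy g \<omega>"
    unfolding energy_restrict by (subst nn_integral_add) (auto simp: nn_integral_cmult)
  finally show ?thesis .
qed

text \<open>A list of intervals \<open>(a, b]\<close> with coefficients.  Unlike processes that live on one common grid, such
  lists are closed under addition (concatenation) without any refinement; a common grid is chosen only
  once, in the maximal inequality.\<close>

type_synonym 'a step_process = "(real \<times> real \<times> ('a \<Rightarrow> real)) list"

fun step_value :: "'a step_process \<Rightarrow> real \<Rightarrow> 'a \<Rightarrow> real" where
  "step_value [] s \<omega> = 0"
| "step_value ((a, b, \<xi>) # L) s \<omega> = \<xi> \<omega> * indicator {a<..b} s + step_value L s \<omega>"

fun step_integral :: "(real \<Rightarrow> 'a \<Rightarrow> real) \<Rightarrow> 'a step_process \<Rightarrow> 'a \<Rightarrow> real" where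
  "step_integral B [] \<omega> = 0"
| "step_integral B ((a, b, \<xi>) # L) \<omega> = \<xi> \<omega> * (B b \<omega> - B a \<omega>) + step_integral B L \<omega>"

definition adapted_step :: "(real \<Rightarrow> 'a measure) \<Rightarrow> 'a step_process \<Rightarrow> bool" where
  "adapted_step F L \<longleftrightarrow> (\<forall>(a, b, \<xi>)\<in>set L. 0 \<le> a \<and> a \<le> b \<and> \<xi> \<in> borel_measurable (F a))"

text \<open>Restriction in time.  An interval that lies outside the window is shrunk to an empty one rather than
  removed, and its left end never decreases, so the coefficient stays adapted.\<close>

definition step_until :: "real \<Rightarrow> 'a step_process \<Rightarrow> 'a step_process" where
  "step_until t = map (\<lambda>(a, b, \<xi>). (a, max a (min b t), \<xi>))"

definition step_from :: "real \<Rightarrow> 'a step_process \<Rightarrow> 'a step_process" where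
  "step_from t = map (\<lambda>(a, b, \<xi>). (max a t, max b t, \<xi>))"

definition step_neg :: "'a step_process \<Rightarrow> 'a step_process" where
  "step_neg = map (\<lambda>(a, b, \<xi>). (a, b, \<lambda>\<omega>. - \<xi> \<omega>))"

lemma adapted_step_simps[simp]:
  "adapted_step F []"
  "adapted_step F ((a, b, \<xi>) # L) \<longleftrightarrow> 0 \<le> a \<and> a \<le> b \<and> \<xi> \<in> borel_measurable (F a) \<and> adapted_step F L"
  "adapted_step F (L @ L') \<longleftrightarrow> adapted_step F L \<and> adapted_step F L'"
  by (simp_all add: adapted_step_def ball_Un)

lemma step_ops_simps[simp]:
  "step_until t [] = []" "step_from t [] = []" "step_neg [] = []"
  "step_until t ((a, b, \<xi>) # L) = (a, max a (min b t), \<xi>) # step_until t L"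
  "step_from t ((a, b, \<xi>) # L) = (max a t, max b t, \<xi>) # step_from t L"
  "step_neg ((a, b, \<xi>) # L) = (a, b, \<lambda>\<omega>. - \<xi> \<omega>) # step_neg L"
  by (auto simp: step_until_def step_from_def step_neg_def)

lemma step_value_append[simp]: "step_value (L @ L') s \<omega> = step_value L s \<omega> + step_value L' s \<omega>"
  by (induction L s \<omega> rule: step_value.induct) auto

lemma step_integral_append[simp]:
  "step_integral B (L @ L') \<omega> = step_integral B L \<omega> + step_integral B L' \<omega>"
  by (induction B L \<omega> rule: step_integral.induct) auto

lemma step_value_neg[simp]: "step_value (step_neg L) s \<omega> = - step_value L s \<omega>"
  by (induction L s \<omega> rule: step_value.induct) auto

lemma step_integral_neg[simp]: "step_integral B (step_neg L) \<omega> = - step_integral B L \<omega>"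
  by (induction B L \<omega> rule: step_integral.induct) (auto simp: algebra_simps)

lemma step_value_until: "step_value (step_until t L) s \<omega> = indicator {..t} s * step_value L s \<omega>"
  by (induction L s \<omega> rule: step_value.induct) (auto simp: indicator_def)

lemma step_value_from: "step_value (step_from t L) s \<omega> = indicator {t<..} s * step_value L s \<omega>"
  by (induction L s \<omega> rule: step_value.induct) (auto simp: indicator_def)

lemma step_integral_until_from:
  assumes "adapted_step F L" "T \<le> t"
  shows "step_integral B (step_until t (step_from T L)) \<omega>
     = step_integral B (step_until t L) \<omega> - step_integral B (step_until T L) \<omega>"
  using assms(1)
proof (induction L)
  case (Cons x L)
  obtain a b \<xi> where x: "x = (a, b, \<xi>)" by (cases x)
  have "B (max (max a T) (min (max b T) t)) \<omega> - B (max a T) \<omega>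
      = B (max a (min b t)) \<omega> - B (max a (min b T)) \<omega>"
    using assms(2) Cons.prems by (auto simp: x max_def min_def)
  note eq = this
  show ?case using Cons unfolding x by (simp add: eq) (simp add: algebra_simps)
qed simp

lemma adapted_step_neg: "adapted_step F L \<Longrightarrow> adapted_step F (step_neg L)"
  by (induction L) auto

lemma adapted_step_until: "adapted_step F L \<Longrightarrow> adapted_step F (step_until t L)"
  by (induction L) auto

lemma step_integral_until_large:
  assumes "\<forall>(a, b, \<xi>)\<in>set L. a \<le> b \<and> b \<le> R"
  shows "step_integral B (step_until R L) \<omega> = step_integral B L \<omega>"
  using assms by (induction B L \<omega> rule: step_integral.induct) (auto simp: max_def min_def)

lemma sum_telescope_clipped:
  fixes f :: "nat \<Rightarrow> real"
  assumes "i0 \<le> i1"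
  shows "(\<Sum>i<k. if i0 \<le> i \<and> i < i1 then f (Suc i) - f i else 0) = f (max i0 (min i1 k)) - f i0"
proof (induction k)
  case (Suc k)
  show ?case
  proof (cases "i0 \<le> k \<and> k < i1")
    case True
    then have "max i0 (min i1 k) = k" "max i0 (min i1 (Suc k)) = Suc k" by auto
    then show ?thesis using Suc True by simp
  next
    case False
    then have "max i0 (min i1 (Suc k)) = max i0 (min i1 k)" using assms by auto
    then show ?thesis using Suc False by auto
  qed
qed (use assms in simp)

context ito_integrator
begin

lemma adapted_step_from: "adapted_step F L \<Longrightarrow> adapted_step F (step_from t L)"
proof (induction L)
  case (Cons x L)
  obtain a b \<xi> where x: "x = (a, b, \<xi>)" by (cases x)
  have "\<xi> \<in> borel_measurable (F (max a t))"
    by (rule F_measurable_mono[of a]) (use Cons.prems in \<open>auto simp: x\<close>)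
  then show ?case using Cons by (auto simp: x le_max_iff_disj)
qed simp

lemma jointly_measurable_step:
  "adapted_step F L \<Longrightarrow> jointly_measurable M (step_value L)"
proof (induction L)
  case Nil
  then show ?case using jointly_measurable_time[of "\<lambda>_. 0"] by simp
next
  case (Cons x L)
  obtain a b \<xi> where x: "x = (a, b, \<xi>)" by (cases x)
  have "\<xi> \<in> borel_measurable M" using Cons.prems F_measurable_M unfolding x by auto
  then have "jointly_measurable M (\<lambda>s \<omega>. \<xi> \<omega> * indicator {a<..b} s + step_value L s \<omega>)"
    using Cons by (intro jointly_measurable_add jointly_measurable_times jointly_measurable_state
        jointly_measurable_time) (auto simp: x)
  then show ?case unfolding x by simp
qed

lemma step_integral_measurable: "adapted_step F L \<Longrightarrow> step_integral B L \<in> borel_measurable M"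
proof (induction L)
  case (Cons x L)
  obtain a b \<xi> where x: "x = (a, b, \<xi>)" by (cases x)
  have "\<xi> \<in> borel_measurable M" "B a \<in> borel_measurable M" "B b \<in> borel_measurable M"
    using Cons.prems F_measurable_M B_measurable unfolding x by auto
  then show ?case using Cons unfolding x by simp
qed (simp add: step_integral.simps[abs_def])

text \<open>On a grid that contains all end points the integral is an elementary sum whose \<open>i\<close>-th coefficient is
  the value of the process at the right end of the \<open>i\<close>-th interval: paths are left-continuous step
  functions, constant on each \<open>(t i, t (Suc i)]\<close>.\<close>

lemma step_integral_grid:
  assumes t: "\<And>i j. i < j \<Longrightarrow> j \<le> m \<Longrightarrow> t i < t j" and k: "k \<le> m"
    and L: "adapted_step F L" "\<forall>(a, b, \<xi>)\<in>set L. a \<in> t ` {..m} \<and> b \<in> t ` {..m}"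
  shows "elementary_sum t (\<lambda>i. step_value L (t (Suc i))) k \<omega> = step_integral B (step_until (t k) L) \<omega>"
  using L
proof (induction L)
  case Nil
  then show ?case by (simp add: elementary_sum_def)
next
  case (Cons x L)
  obtain a b \<xi> where x: "x = (a, b, \<xi>)" by (cases x)
  obtain ia ib where a: "a = t ia" "ia \<le> m" and b: "b = t ib" "ib \<le> m"
    using Cons.prems(2) unfolding x by auto
  have lt_iff: "t i < t j \<longleftrightarrow> i < j" if "i \<le> m" "j \<le> m" for i j
    using t[of i j] t[of j i] that by (cases i j rule: linorder_cases) auto
  have le_iff: "t i \<le> t j \<longleftrightarrow> i \<le> j" if "i \<le> m" "j \<le> m" for i j
    using lt_iff[OF that(2,1)] by (simp add: not_less[symmetric])
  have ab: "ia \<le> ib" using Cons.prems(1) le_iff a b unfolding x by auto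
  have tmax: "max a (min b (t k)) = t (max ia (min ib k))"
    unfolding max_def min_def a b using le_iff a(2) b(2) k by auto
  have "elementary_sum t (\<lambda>i. step_value (x # L) (t (Suc i))) k \<omega>
     = (\<Sum>i<k. \<xi> \<omega> * (indicator {a<..b} (t (Suc i)) * (B (t (Suc i)) \<omega> - B (t i) \<omega>)))
       + elementary_sum t (\<lambda>i. step_value L (t (Suc i))) k \<omega>"
    unfolding elementary_sum_def x by (simp add: sum.distrib[symmetric] algebra_simps)
  also have "(\<Sum>i<k. \<xi> \<omega> * (indicator {a<..b} (t (Suc i)) * (B (t (Suc i)) \<omega> - B (t i) \<omega>)))
     = \<xi> \<omega> * (\<Sum>i<k. if ia \<le> i \<and> i < ib then B (t (Suc i)) \<omega> - B (t i) \<omega> else 0)"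
    unfolding sum_distrib_left
  proof (rule sum.cong[OF refl])
    fix i assume "i \<in> {..<k}"
    then have "t (Suc i) \<in> {a<..b} \<longleftrightarrow> ia \<le> i \<and> i < ib"
      using lt_iff[of ia "Suc i"] le_iff[of "Suc i" ib] a b k by auto
    then show "\<xi> \<omega> * (indicator {a<..b} (t (Suc i)) * (B (t (Suc i)) \<omega> - B (t i) \<omega>))
       = \<xi> \<omega> * (if ia \<le> i \<and> i < ib then B (t (Suc i)) \<omega> - B (t i) \<omega> else 0)"
      by (simp add: indicator_def)
  qed
  also have "\<dots> = \<xi> \<omega> * (B (max a (min b (t k))) \<omega> - B a \<omega>)"
    unfolding sum_telescope_clipped[OF ab, of "\<lambda>i. B (t i) \<omega>"] tmax[symmetric] a(1)[symmetric] ..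
  finally show ?case using Cons unfolding x by simp
qed

text \<open>Although the process is evaluated at the right end \<open>t (Suc i)\<close>, only coefficients of intervals that
  start no later than \<open>t i\<close> contribute.\<close>

lemma step_value_grid_measurable:
  assumes t: "\<And>i j. i < j \<Longrightarrow> j \<le> m \<Longrightarrow> t i < t j" and i: "i < m" and t0: "0 \<le> t 0"
    and L: "adapted_step F L" "\<forall>(a, b, \<xi>)\<in>set L. a \<in> t ` {..m}"
  shows "step_value L (t (Suc i)) \<in> borel_measurable (F (t i))"
  using L
proof (induction L)
  case Nil
  then show ?case by (simp add: step_value.simps[abs_def])
next
  case (Cons x L)
  obtain a b \<xi> where x: "x = (a, b, \<xi>)" by (cases x)
  obtain ia where a: "a = t ia" "ia \<le> m" using Cons.prems(2) unfolding x by auto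
  have "(\<lambda>\<omega>. \<xi> \<omega> * indicator {a<..b} (t (Suc i))) \<in> borel_measurable (F (t i))"
  proof (cases "a < t (Suc i)")
    case True
    then have "\<not> Suc i \<le> ia" using t[of "Suc i" ia] a by (cases "ia = Suc i") auto
    then have "a \<le> t i" using t[of ia i] i a by (cases "ia = i") auto
    then have "\<xi> \<in> borel_measurable (F (t i))"
      using Cons.prems(1) F_measurable_mono[of a "t i" \<xi>] unfolding x by auto
    then show ?thesis by simp
  qed simp
  then show ?case using Cons unfolding x by simp
qed

lemma step_value_const:
  assumes t: "\<And>i j. i < j \<Longrightarrow> j \<le> m \<Longrightarrow> t i < t j" and i: "i < m" and s: "t i < s" "s \<le> t (Suc i)"
    and L: "\<forall>(a, b, \<xi>)\<in>set L. a \<in> t ` {..m} \<and> b \<in> t ` {..m}"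
  shows "step_value L s \<omega> = step_value L (t (Suc i)) \<omega>"
  using L
proof (induction L)
  case (Cons x L)
  obtain a b \<xi> where x: "x = (a, b, \<xi>)" by (cases x)
  have le: "t j \<le> t k" if "j \<le> k" "k \<le> m" for j k using t[of j k] that by (cases "j = k") auto
  have lt: "u < s \<longleftrightarrow> u < t (Suc i)" if "u \<in> t ` {..m}" for u
  proof -
    from that obtain j where j: "u = t j" "j \<le> m" by (elim imageE) simp
    show ?thesis
    proof (cases "j \<le> i")
      case True
      then show ?thesis using le[of j i] i s unfolding j by auto
    next
      case False
      then show ?thesis using le[of "Suc i" j] j s by auto
    qed
  qed
  have "a < s \<longleftrightarrow> a < t (Suc i)" "b < s \<longleftrightarrow> b < t (Suc i)"
    using Cons.prems lt unfolding x by auto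
  then have "indicator {a<..b} s = (indicator {a<..b} (t (Suc i)) :: real)"
    by (auto simp: indicator_def not_less[symmetric])
  then show ?case using Cons unfolding x by simp
qed simp

lemma grid_energy_le:
  assumes t: "\<And>i j. i < j \<Longrightarrow> j \<le> m \<Longrightarrow> t i < t j" and t0: "0 \<le> t 0"
    and L: "\<forall>(a, b, \<xi>)\<in>set L. a \<in> t ` {..m} \<and> b \<in> t ` {..m}"
  shows "ennreal (\<Sum>i<m. (step_value L (t (Suc i)) \<omega>)^2 * (t (Suc i) - t i)) \<le> energy (step_value L) \<omega>"
proof -
  let ?c = "\<lambda>i. (step_value L (t (Suc i)) \<omega>)^2"
  have le: "t j \<le> t k" if "j \<le> k" "k \<le> m" for j k using t[of j k] that by (cases "j = k") auto
  have "ennreal (\<Sum>i<m. ?c i * (t (Suc i) - t i)) = (\<Sum>i<m. ennreal (?c i) * emeasure lborel {t i<..t (Suc i)})"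
    using t by (subst sum_ennreal[symmetric]) (auto simp: ennreal_mult less_imp_le intro!: sum.cong)
  also have "\<dots> = (\<integral>\<^sup>+ s. (\<Sum>i<m. ennreal (?c i) * indicator {t i<..t (Suc i)} s) \<partial>lborel)"
    by (subst nn_integral_sum) (auto simp: nn_integral_cmult_indicator)
  also have "\<dots> \<le> energy (step_value L) \<omega>"
    unfolding energy_def
  proof (rule nn_integral_mono)
    fix s :: real
    show "(\<Sum>i<m. ennreal (?c i) * indicator {t i<..t (Suc i)} s)
       \<le> ennreal ((step_value L s \<omega>)^2) * indicator {0..} s"
    proof (cases "\<exists>i<m. s \<in> {t i<..t (Suc i)}")
      case True
      then obtain i where i: "i < m" "t i < s" "s \<le> t (Suc i)" by auto
      have "indicator {t j<..t (Suc j)} s = (0::ennreal)" if jm: "j < m" and ji: "j \<noteq> i" for j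
      proof -
        consider "Suc j \<le> i" | "Suc i \<le> j" using ji by linarith
        then have "s \<notin> {t j<..t (Suc j)}"
          using le[of "Suc j" i] le[of "Suc i" j] i jm by cases auto
        then show ?thesis by simp
      qed
      then have "(\<Sum>j<m. ennreal (?c j) * indicator {t j<..t (Suc j)} s)
          = (\<Sum>j\<in>{i}. ennreal (?c j) * indicator {t j<..t (Suc j)} s)"
        using i by (intro sum.mono_neutral_right) auto
      also have "\<dots> = ennreal ((step_value L s \<omega>)^2)"
        using step_value_const[OF t i L] i by simp
      finally show ?thesis using i t0 le[of 0 i] by simp
    next
      case False
      then have "(\<Sum>i<m. ennreal (?c i) * indicator {t i<..t (Suc i)} s) = 0"
        by (intro sum.neutral) (auto simp: indicator_def)
      then show ?thesis by simp
    qed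
  qed
  finally show ?thesis .
qed

lemma step_maximal_inequality:
  assumes L: "adapted_step F L" and G: "finite G" "G \<subseteq> {0..}" and \<epsilon>: "\<epsilon> > 0" and \<delta>: "\<delta> \<ge> 0"
  shows "prob {\<omega> \<in> space M. \<exists>u\<in>G. \<bar>step_integral B (step_until u L) \<omega>\<bar> > \<epsilon>}
     \<le> prob {\<omega> \<in> space M. energy (step_value L) \<omega> > ennreal \<delta>} + \<delta> / \<epsilon>^2"
proof -
  define S where "S = insert 0 (G \<union> (\<Union>(a, b, \<xi>)\<in>set L. {a, b}))"
  have S: "finite S" "0 \<in> S" "\<And>u. u \<in> S \<Longrightarrow> 0 \<le> u"
  proof -
    show "finite S" "0 \<in> S" using G unfolding S_def by auto
    fix u assume "u \<in> S"
    then consider "u = 0" | "u \<in> G" | a b \<xi> where "(a, b, \<xi>) \<in> set L" "u = a \<or> u = b"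
      unfolding S_def by auto
    then show "0 \<le> u"
    proof cases
      case 3
      then have "0 \<le> a" "a \<le> b" using L unfolding adapted_step_def by auto
      with 3 show ?thesis by auto
    qed (use G in auto)
  qed
  define xs where "xs = sorted_list_of_set S"
  define m where "m = length xs - 1"
  define t where "t = (\<lambda>i. xs ! i)"
  have setxs: "set xs = S" unfolding xs_def using S by simp
  have pos: "length xs > 0" using setxs S by (cases xs) auto
  have srt: "sorted xs" "distinct xs" unfolding xs_def by simp_all
  have t: "t i < t j" if "i < j" "j \<le> m" for i j
  proof -
    have j: "j < length xs" using that pos by (auto simp: m_def)
    have "xs ! i \<le> xs ! j" by (rule sorted_nth_mono[OF srt(1)]) (use that j in auto)
    moreover have "xs ! i \<noteq> xs ! j" using nth_eq_iff_index_eq[OF srt(2), of i j] that j by auto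
    ultimately show ?thesis unfolding t_def by linarith
  qed
  have img: "t ` {..m} = S"
  proof -
    have "Suc m = length xs" using pos by (simp add: m_def)
    then have "{..m} = {..<length xs}" by (simp flip: lessThan_Suc_atMost)
    then show ?thesis unfolding t_def setxs[symmetric] by (simp add: nth_image lessThan_atLeast0)
  qed
  have t0: "0 \<le> t 0" by (rule S(3)) (use img in auto)
  have LS: "\<forall>(a, b, \<xi>)\<in>set L. a \<in> t ` {..m} \<and> b \<in> t ` {..m}"
    unfolding img S_def by force
  then have LS': "\<forall>(a, b, \<xi>)\<in>set L. a \<in> t ` {..m}" by auto
  have tS: "\<And>i. i < m \<Longrightarrow> t i < t (Suc i)" using t by simp
  define \<xi> where "\<xi> = (\<lambda>i. step_value L (t (Suc i)))"
  have \<xi>: "\<xi> i \<in> borel_measurable (F (t i))" if "i < m" for i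
    unfolding \<xi>_def using step_value_grid_measurable[OF t that t0 L LS'] .
  have em: "energy (step_value L) \<in> borel_measurable M"
    by (rule energy_measurable[OF jointly_measurable_step[OF L]])
  have sub: "{\<omega> \<in> space M. \<exists>u\<in>G. \<bar>step_integral B (step_until u L) \<omega>\<bar> > \<epsilon>}
      \<subseteq> {\<omega> \<in> space M. \<exists>k\<le>m. \<bar>elementary_sum t \<xi> k \<omega>\<bar> > \<epsilon>}"
  proof safe
    fix \<omega> u assume u: "u \<in> G" and big: "\<bar>step_integral B (step_until u L) \<omega>\<bar> > \<epsilon>"
    have "u \<in> t ` {..m}" unfolding img S_def using u by auto
    then obtain k where k: "k \<le> m" "u = t k" by auto
    have "\<bar>elementary_sum t \<xi> k \<omega>\<bar> > \<epsilon>"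
      using big step_integral_grid[OF t k(1) L LS, of \<omega>] unfolding \<xi>_def k(2) by simp
    with k(1) show "\<exists>k\<le>m. \<bar>elementary_sum t \<xi> k \<omega>\<bar> > \<epsilon>" by blast
  qed
  have meas: "{\<omega> \<in> space M. \<exists>k\<le>m. \<bar>elementary_sum t \<xi> k \<omega>\<bar> > \<epsilon>} \<in> events"
  proof -
    have [measurable]: "elementary_sum t \<xi> k \<in> borel_measurable M" if "k \<in> {..m}" for k
      by (rule F_measurable_M[OF grid_nonneg[OF t0 tS, of m] elementary_sum_adapted[OF t0 tS \<xi>]])
        (use that in auto)
    have "{\<omega> \<in> space M. \<exists>k\<in>{..m}. \<bar>elementary_sum t \<xi> k \<omega>\<bar> > \<epsilon>} \<in> events" by measurable
    then show ?thesis by (simp add: Bex_def)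
  qed
  have "prob {\<omega> \<in> space M. \<exists>u\<in>G. \<bar>step_integral B (step_until u L) \<omega>\<bar> > \<epsilon>}
      \<le> prob {\<omega> \<in> space M. \<exists>k\<le>m. \<bar>elementary_sum t \<xi> k \<omega>\<bar> > \<epsilon>}"
    by (rule finite_measure_mono[OF sub meas])
  also have "\<dots> \<le> prob {\<omega> \<in> space M. (\<Sum>i<m. (\<xi> i \<omega>)^2 * (t (Suc i) - t i)) > \<delta>} + \<delta> / \<epsilon>^2"
    by (rule elementary_maximal_inequality[OF t0 tS \<xi> \<epsilon> \<delta>])
  also have "prob {\<omega> \<in> space M. (\<Sum>i<m. (\<xi> i \<omega>)^2 * (t (Suc i) - t i)) > \<delta>}
      \<le> prob {\<omega> \<in> space M. energy (step_value L) \<omega> > ennreal \<delta>}"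
  proof (rule finite_measure_mono)
    show "{\<omega> \<in> space M. energy (step_value L) \<omega> > ennreal \<delta>} \<in> events" using em by measurable
    show "{\<omega> \<in> space M. (\<Sum>i<m. (\<xi> i \<omega>)^2 * (t (Suc i) - t i)) > \<delta>}
      \<subseteq> {\<omega> \<in> space M. energy (step_value L) \<omega> > ennreal \<delta>}"
    proof safe
      fix \<omega> assume "(\<Sum>i<m. (\<xi> i \<omega>)^2 * (t (Suc i) - t i)) > \<delta>"
      then have "ennreal \<delta> < ennreal (\<Sum>i<m. (\<xi> i \<omega>)^2 * (t (Suc i) - t i))"
        using \<delta> by (intro ennreal_lessI) auto
      also have "\<dots> \<le> energy (step_value L) \<omega>"
        unfolding \<xi>_def by (rule grid_energy_le[OF t t0 LS])
      finally show "ennreal \<delta> < energy (step_value L) \<omega>" .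
    qed
  qed
  finally show ?thesis by simp
qed

end


section \<open>Convergence in probability\<close>

context prob_space
begin

lemma conv_zero_dominated:
  assumes U: "conv_zero_in_prob M U" "\<And>n. U n \<in> borel_measurable M"
    and V: "conv_zero_in_prob M V" "\<And>n. V n \<in> borel_measurable M"
    and le: "\<And>n \<omega>. \<omega> \<in> space M \<Longrightarrow> X n \<omega> \<le> 2 * U n \<omega> + 2 * V n \<omega>"
  shows "conv_zero_in_prob M X"
  unfolding conv_zero_in_prob_def
proof (intro allI impI)
  fix \<epsilon> :: real assume \<epsilon>: "0 < \<epsilon>"
  let ?U = "\<lambda>n. {\<omega> \<in> space M. U n \<omega> > ennreal (\<epsilon>/4)}" and ?V = "\<lambda>n. {\<omega> \<in> space M. V n \<omega> > ennreal (\<epsilon>/4)}"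
  have meas: "?U n \<in> events" "?V n \<in> events" for n using U(2)[of n] V(2)[of n] by measurable
  have "(\<lambda>n. prob (?U n) + prob (?V n)) \<longlonglongrightarrow> 0 + 0"
    by (rule tendsto_add) (use U(1) V(1) \<epsilon> in \<open>auto simp: conv_zero_in_prob_def\<close>)
  then have lim: "(\<lambda>n. prob (?U n) + prob (?V n)) \<longlonglongrightarrow> 0" by simp
  have "prob {\<omega> \<in> space M. X n \<omega> > ennreal \<epsilon>} \<le> prob (?U n) + prob (?V n)" for n
  proof -
    have "{\<omega> \<in> space M. X n \<omega> > ennreal \<epsilon>} \<subseteq> ?U n \<union> ?V n"
    proof (rule subsetI, rule ccontr)
      fix \<omega> assume w: "\<omega> \<in> {\<omega> \<in> space M. X n \<omega> > ennreal \<epsilon>}" and "\<omega> \<notin> ?U n \<union> ?V n"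
      then have "U n \<omega> \<le> ennreal (\<epsilon>/4)" "V n \<omega> \<le> ennreal (\<epsilon>/4)" by (auto simp: not_less)
      then have "2 * U n \<omega> + 2 * V n \<omega> \<le> 2 * ennreal (\<epsilon>/4) + 2 * ennreal (\<epsilon>/4)"
        by (intro add_mono mult_left_mono) auto
      also have "2 * ennreal (\<epsilon>/4) = ennreal (\<epsilon>/2)"
        using \<epsilon> ennreal_mult[of 2 "\<epsilon>/4"] by simp
      also have "ennreal (\<epsilon>/2) + ennreal (\<epsilon>/2) = ennreal \<epsilon>"
        using \<epsilon> by (simp add: ennreal_plus[symmetric] del: ennreal_plus)
      finally show False using w le[of \<omega> n] by (auto dest: order.trans simp: not_less[symmetric])
    qed
    then have "prob {\<omega> \<in> space M. X n \<omega> > ennreal \<epsilon>} \<le> prob (?U n \<union> ?V n)"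
      by (rule finite_measure_mono) (use meas in auto)
    also have "\<dots> \<le> prob (?U n) + prob (?V n)" by (rule measure_Un_le[OF meas])
    finally show ?thesis .
  qed
  then show "(\<lambda>n. prob {\<omega> \<in> space M. X n \<omega> > ennreal \<epsilon>}) \<longlonglongrightarrow> 0"
    by (intro tendsto_sandwich[OF _ _ tendsto_const lim]) (auto simp: always_eventually)
qed

lemma conv_zero_triangle:
  fixes X Y Z :: "nat \<Rightarrow> 'a \<Rightarrow> real"
  assumes XY: "conv_zero_in_prob M (\<lambda>n \<omega>. ennreal \<bar>X n \<omega> - Y n \<omega>\<bar>)"
    and YZ: "conv_zero_in_prob M (\<lambda>n \<omega>. ennreal \<bar>Y n \<omega> - Z n \<omega>\<bar>)"
    and m: "\<And>n. X n \<in> borel_measurable M" "\<And>n. Y n \<in> borel_measurable M" "\<And>n. Z n \<in> borel_measurable M"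
  shows "conv_zero_in_prob M (\<lambda>n \<omega>. ennreal \<bar>X n \<omega> - Z n \<omega>\<bar>)"
proof (rule conv_zero_dominated[OF XY _ YZ])
  show "(\<lambda>\<omega>. ennreal \<bar>X n \<omega> - Y n \<omega>\<bar>) \<in> borel_measurable M"
    "(\<lambda>\<omega>. ennreal \<bar>Y n \<omega> - Z n \<omega>\<bar>) \<in> borel_measurable M" for n
    using m(1)[of n] m(2)[of n] m(3)[of n] by simp_all
  fix n \<omega>
  have "\<bar>X n \<omega> - Z n \<omega>\<bar> \<le> 2 * \<bar>X n \<omega> - Y n \<omega>\<bar> + 2 * \<bar>Y n \<omega> - Z n \<omega>\<bar>" by (auto simp: abs_if)
  then have "ennreal \<bar>X n \<omega> - Z n \<omega>\<bar> \<le> ennreal (2 * \<bar>X n \<omega> - Y n \<omega>\<bar> + 2 * \<bar>Y n \<omega> - Z n \<omega>\<bar>)"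
    by (rule ennreal_leI)
  then show "ennreal \<bar>X n \<omega> - Z n \<omega>\<bar> \<le> 2 * ennreal \<bar>X n \<omega> - Y n \<omega>\<bar> + 2 * ennreal \<bar>Y n \<omega> - Z n \<omega>\<bar>"
    by (simp add: ennreal_plus ennreal_mult)
qed

text \<open>Dominated convergence for the indicators of the exceptional events.\<close>

lemma conv_zero_AE:
  assumes U: "\<And>n. U n \<in> borel_measurable M" and lim: "AE \<omega> in M. (\<lambda>n. U n \<omega>) \<longlonglongrightarrow> 0"
  shows "conv_zero_in_prob M U"
  unfolding conv_zero_in_prob_def
proof (intro allI impI)
  fix \<epsilon> :: real assume \<epsilon>: "0 < \<epsilon>"
  let ?E = "\<lambda>n. {\<omega> \<in> space M. U n \<omega> > ennreal \<epsilon>}"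
  have meas: "?E n \<in> events" for n using U[of n] by measurable
  have "(\<lambda>n. \<integral>\<omega>. indicator (?E n) \<omega> \<partial>M) \<longlonglongrightarrow> (\<integral>\<omega>. (0::real) \<partial>M)"
  proof (rule integral_dominated_convergence[where w="\<lambda>_. 1"])
    show "AE \<omega> in M. (\<lambda>n. indicator (?E n) \<omega> :: real) \<longlonglongrightarrow> 0"
      using lim
    proof eventually_elim
      case (elim \<omega>)
      then have "eventually (\<lambda>n. U n \<omega> < ennreal \<epsilon>) sequentially"
        by (rule order_tendstoD) (use \<epsilon> in simp)
      then have "eventually (\<lambda>n. indicator (?E n) \<omega> = (0::real)) sequentially"
        by (rule eventually_mono) (auto simp: indicator_def)
      then show ?case by (rule tendsto_eventually)
    qed
  qed (use meas in auto)
  then show "(\<lambda>n. prob (?E n)) \<longlonglongrightarrow> 0" using meas by simp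
qed

lemma conv_zero_sum:
  assumes "finite G" "\<And>t. t \<in> G \<Longrightarrow> conv_zero_in_prob M (U t)" "\<epsilon> > 0"
  shows "(\<lambda>n. \<Sum>t\<in>G. prob {\<omega> \<in> space M. U t n \<omega> > ennreal \<epsilon>}) \<longlonglongrightarrow> 0"
  using tendsto_sum[of G "\<lambda>t n. prob {\<omega> \<in> space M. U t n \<omega> > ennreal \<epsilon>}" "\<lambda>_. 0" sequentially] assms
  by (auto simp: conv_zero_in_prob_def)

text \<open>Continuity from below: a bound that is uniform over finite subsets extends to a countable set.\<close>

lemma prob_ex_countable_le:
  assumes D: "countable D" and meas: "\<And>t. t \<in> D \<Longrightarrow> {\<omega> \<in> space M. P t \<omega>} \<in> events"
    and le: "\<And>G. finite G \<Longrightarrow> G \<subseteq> D \<Longrightarrow> prob {\<omega> \<in> space M. \<exists>t\<in>G. P t \<omega>} \<le> c"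
  shows "prob {\<omega> \<in> space M. \<exists>t\<in>D. P t \<omega>} \<le> c"
proof (cases "D = {}")
  case True
  then show ?thesis using le[of "{}"] by simp
next
  case False
  let ?d = "from_nat_into D"
  have d: "?d i \<in> D" for i using False by (rule from_nat_into)
  have rng: "range ?d = D" using D False by (rule range_from_nat_into[rotated])
  define E where "E = (\<lambda>n. {\<omega> \<in> space M. \<exists>t\<in>?d ` {..n}. P t \<omega>})"
  have "E n = (\<Union>t\<in>?d ` {..n}. {\<omega> \<in> space M. P t \<omega>})" for n unfolding E_def by auto
  then have Em: "range E \<subseteq> events" using meas d by auto
  have inc: "incseq E" unfolding E_def by (intro incseq_SucI) (auto simp: atMost_Suc)
  have "(\<lambda>n. prob (E n)) \<longlonglongrightarrow> prob (\<Union>n. E n)"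
    by (rule finite_Lim_measure_incseq[OF Em inc])
  moreover have "prob (E n) \<le> c" for n unfolding E_def by (rule le) (use d in auto)
  ultimately have "prob (\<Union>n. E n) \<le> c" by (intro LIMSEQ_le_const2) auto
  moreover have "(\<Union>n. E n) = {\<omega> \<in> space M. \<exists>t\<in>D. P t \<omega>}"
    unfolding E_def by (subst (2) rng[symmetric]) auto
  ultimately show ?thesis by simp
qed

lemma AE_not_all_of_prob_tendsto_0:
  assumes meas: "\<And>k::nat. E k \<in> events" and lim: "(\<lambda>k. prob (E k)) \<longlonglongrightarrow> 0"
  shows "AE \<omega> in M. \<exists>k. \<omega> \<notin> E k"
proof -
  have N: "(\<Inter>k. E k) \<in> events" using meas by auto
  have "prob (\<Inter>k. E k) \<le> prob (E k)" for k by (rule finite_measure_mono) (use meas in auto)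
  then have "prob (\<Inter>k. E k) \<le> 0" using lim by (intro LIMSEQ_le_const) auto
  then have "prob (\<Inter>k. E k) = 0" by (simp add: measure_le_0_iff)
  then have "(\<Inter>k. E k) \<in> null_sets M" using N by (simp add: null_sets_def emeasure_eq_measure)
  then have "AE \<omega> in M. \<omega> \<notin> (\<Inter>k. E k)" by (rule AE_not_in)
  then show ?thesis by eventually_elim auto
qed

lemma AE_eq_0_of_conv_zero_const:
  assumes "conv_zero_in_prob M (\<lambda>n \<omega>. ennreal \<bar>X \<omega>\<bar>)" and X: "X \<in> borel_measurable M"
  shows "AE \<omega> in M. X \<omega> = (0::real)"
proof -
  have "AE \<omega> in M. \<forall>n::nat. \<bar>X \<omega>\<bar> \<le> 1 / Suc n"
    unfolding AE_all_countable
  proof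
    fix n :: nat
    have e: "0 < 1 / real (Suc n)" by simp
    have "(\<lambda>_::nat. prob {\<omega> \<in> space M. ennreal \<bar>X \<omega>\<bar> > ennreal (1 / Suc n)}) \<longlonglongrightarrow> 0"
      using assms(1) e unfolding conv_zero_in_prob_def by blast
    then have "prob {\<omega> \<in> space M. ennreal \<bar>X \<omega>\<bar> > ennreal (1 / Suc n)} = 0"
      by (simp add: LIMSEQ_const_iff)
    moreover have "{\<omega> \<in> space M. ennreal \<bar>X \<omega>\<bar> > ennreal (1 / Suc n)} \<in> events"
      using X by measurable
    ultimately have "{\<omega> \<in> space M. ennreal \<bar>X \<omega>\<bar> > ennreal (1 / Suc n)} \<in> null_sets M"
      by (simp add: null_sets_def emeasure_eq_measure)
    from AE_not_in[OF this] AE_space show "AE \<omega> in M. \<bar>X \<omega>\<bar> \<le> 1 / Suc n"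
      by eventually_elim (auto simp: ennreal_less_iff not_less)
  qed
  then show ?thesis
  proof eventually_elim
    case (elim \<omega>)
    have "(\<lambda>n. 1 / real (Suc n)) \<longlonglongrightarrow> 0" using LIMSEQ_inverse_real_of_nat by (simp add: inverse_eq_divide)
    then have "\<bar>X \<omega>\<bar> \<le> 0" by (rule LIMSEQ_le_const) (use elim in auto)
    then show ?case by simp
  qed
qed

end

lemma tendsto_0_of_le_add_small:
  fixes f :: "nat \<Rightarrow> real"
  assumes f: "\<And>n. 0 \<le> f n" and c: "0 < c"
    and le: "\<And>\<delta> n. 0 < \<delta> \<Longrightarrow> f n \<le> g \<delta> n + c * \<delta>" and g: "\<And>\<delta>. 0 < \<delta> \<Longrightarrow> g \<delta> \<longlonglongrightarrow> 0"
  shows "f \<longlonglongrightarrow> 0"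
proof (rule LIMSEQ_I)
  fix r :: real assume r: "0 < r"
  define \<delta> where "\<delta> = r / (2 * c)"
  have \<delta>: "0 < \<delta>" "c * \<delta> = r / 2" using r c by (simp_all add: \<delta>_def)
  from LIMSEQ_D[OF g[OF \<delta>(1)], of "r/2"] r
  obtain N where N: "\<And>n. n \<ge> N \<Longrightarrow> \<bar>g \<delta> n\<bar> < r / 2" by auto
  have "norm (f n - 0) < r" if "N \<le> n" for n
    using N[OF that] le[OF \<delta>(1), of n] f[of n] \<delta>(2) by simp
  then show "\<exists>N. \<forall>n\<ge>N. norm (f n - 0) < r" by blast
qed

text \<open>
  Dyadic times serve as the countable dense set of times because finitely many of them always lie on
  one uniform grid, as needed for the Euler scheme.\<close>

definition dyadics :: "real set" where
  "dyadics = {real j / 2 ^ n | j n. True}"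

lemma countable_dyadics: "countable dyadics"
proof -
  have "dyadics = (\<lambda>(j, n). real j / 2 ^ n) ` (UNIV :: (nat \<times> nat) set)"
    unfolding dyadics_def by auto
  then show ?thesis by (metis countable_image countableI_type)
qed

lemma dyadics_nonneg: "d \<in> dyadics \<Longrightarrow> 0 \<le> d"
  unfolding dyadics_def by auto

lemma of_nat_dyadic: "real n \<in> dyadics"
  unfolding dyadics_def by (intro CollectI exI[of _ n] exI[of _ 0]) simp

lemma dyadics_dense:
  assumes "0 \<le> x" "x < y"
  shows "\<exists>d\<in>dyadics. x < d \<and> d < y"
proof -
  obtain n where n: "(1/2)^n < y - x" using real_arch_pow_inv[of "y - x" "1/2"] assms by auto
  define j where "j = nat \<lfloor>x * 2^n\<rfloor> + 1"
  have fl: "real (nat \<lfloor>x * 2^n\<rfloor>) = of_int \<lfloor>x * 2^n\<rfloor>" using assms by simp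
  have 1: "x * 2^n < real j" unfolding j_def of_nat_add fl by linarith
  have 2: "real j \<le> x * 2^n + 1" unfolding j_def of_nat_add fl by linarith
  have "x < real j / 2^n" using 1 by (simp add: field_simps)
  moreover have "real j / 2^n \<le> x + (1/2)^n"
    using divide_right_mono[OF 2, of "2^n"] by (simp add: add_divide_distrib power_one_over)
  ultimately show ?thesis using n unfolding dyadics_def by (intro bexI[of _ "real j / 2^n"]) auto
qed

lemma continuous_closed_from_dyadics:
  fixes f :: "real \<Rightarrow> 'b::metric_space"
  assumes cont: "continuous_on {0..} f" and S: "closed S" and a: "0 \<le> a"
    and dy: "\<And>d. d \<in> dyadics \<Longrightarrow> a \<le> d \<Longrightarrow> f d \<in> S" and t: "a \<le> t"
  shows "f t \<in> S"
proof -
  have "\<exists>d. d \<in> dyadics \<and> t < d \<and> d < t + 1 / real (Suc n)" for n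
    using dyadics_dense[of t "t + 1 / real (Suc n)"] a t by auto
  then have "\<exists>r. \<forall>n. r n \<in> dyadics \<and> t < r n \<and> r n < t + 1 / real (Suc n)"
    by (intro choice allI)
  then obtain r where r': "\<forall>n. r n \<in> dyadics \<and> t < r n \<and> r n < t + 1 / real (Suc n)" by (elim exE)
  then have r: "\<And>n. r n \<in> dyadics" "\<And>n. t < r n" "\<And>n. r n < t + 1 / real (Suc n)" by auto
  have "(\<lambda>n. 1 / real (Suc n)) \<longlonglongrightarrow> 0" using LIMSEQ_inverse_real_of_nat by (simp add: inverse_eq_divide)
  then have "(\<lambda>n. t + 1 / real (Suc n)) \<longlonglongrightarrow> t + 0" by (intro tendsto_intros)
  then have up: "(\<lambda>n. t + 1 / real (Suc n)) \<longlonglongrightarrow> t" by simp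
  have "\<forall>n. t \<le> r n" "\<forall>n. r n \<le> t + 1 / real (Suc n)" using r' less_imp_le by blast+
  then have lim: "r \<longlonglongrightarrow> t"
    by (intro tendsto_sandwich[OF always_eventually always_eventually tendsto_const up])
  have "(\<lambda>n. f (r n)) \<longlonglongrightarrow> f t"
  proof (rule continuous_on_tendsto_compose[OF cont lim])
    show "t \<in> {0..}" using a t by simp
    have "0 \<le> r n" for n using r(2)[of n] a t by linarith
    then show "\<forall>\<^sub>F n in sequentially. r n \<in> {0..}" by (simp add: always_eventually)
  qed
  note limf = this
  have mem: "f (r n) \<in> S" for n by (rule dy[OF r(1)]) (use r(2)[of n] t in linarith)
  show ?thesis by (rule closed_sequentially[OF S mem limf])
qed

section \<open>Ito integrals\<close>

definition step_of_simple :: "'a simple_process \<Rightarrow> 'a step_process" where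
  "step_of_simple = (\<lambda>(k, \<tau>, \<xi>). map (\<lambda>i. (\<tau> i, \<tau> (Suc i), \<xi> i)) [0..<k])"

lemma step_value_of_simple: "step_value (step_of_simple S) s \<omega> = simple_value S s \<omega>"
proof -
  obtain k \<tau> \<xi> where S: "S = (k, \<tau>, \<xi>)" by (cases S)
  show ?thesis unfolding S step_of_simple_def simple_value_def
    by (induction k) (simp_all del: sum_mult_indicator)
qed

lemma step_integral_of_simple: "step_integral B (step_of_simple S) \<omega> = simple_integral B S \<omega>"
proof -
  obtain k \<tau> \<xi> where S: "S = (k, \<tau>, \<xi>)" by (cases S)
  show ?thesis unfolding S step_of_simple_def simple_integral_def by (induction k) auto
qed

lemma adapted_step_of_simple:
  assumes "simple_predictable M F S"
  shows "adapted_step F (step_of_simple S)"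
proof -
  obtain k \<tau> \<xi> where S: "S = (k, \<tau>, \<xi>)" by (cases S)
  have *: "0 \<le> \<tau> 0" "strict_mono \<tau>" "\<forall>i<k. \<xi> i \<in> borel_measurable (F (\<tau> i))"
    using assms unfolding S simple_predictable_def by auto
  have "\<tau> i \<le> \<tau> (Suc i)" "0 \<le> \<tau> i" for i
    using * strict_mono_mono[OF *(2), THEN monoD, of 0 i] strict_mono_mono[OF *(2), THEN monoD, of i "Suc i"] by auto
  then show ?thesis unfolding S step_of_simple_def adapted_step_def using * by auto
qed

lemma step_end_bounded: "\<exists>R\<ge>0. \<forall>(a, b, \<xi>)\<in>set (L :: 'a step_process). b \<le> R"
proof (induction L)
  case (Cons x L)
  obtain a b \<xi> where x: "x = (a, b, \<xi>)" by (cases x)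
  from Cons obtain R where "R \<ge> 0" "\<forall>(a, b, \<xi>)\<in>set L. b \<le> R" by auto
  then show ?case unfolding x by (intro exI[of _ "max R b"]) force
qed auto

lemma ito_integrand_jointly_measurable: "ito_integrand M F H \<Longrightarrow> jointly_measurable M H"
  unfolding ito_integrand_def jointly_measurable_def by simp

lemma ito_integrand_energy: "ito_integrand M F H \<Longrightarrow> AE \<omega> in M. energy H \<omega> < \<infinity>"
  unfolding ito_integrand_def energy_def by simp

lemma energy_tail_tendsto_0:
  assumes H: "jointly_measurable M H" "\<omega> \<in> space M" and fin: "energy H \<omega> < \<infinity>"
  shows "(\<lambda>k. energy (\<lambda>s \<omega>. indicator {real k<..} s * H s \<omega>) \<omega>) \<longlonglongrightarrow> 0"
proof -
  have [measurable]: "(\<lambda>s. H s \<omega>) \<in> borel_measurable lborel_pos" by (rule measurable_path[OF H])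
  have ind[measurable]: "(\<lambda>s. indicator {real k<..} s :: real) \<in> borel_measurable lborel_pos" for k
    by (rule measurable_restrict_space1) simp
  have "(\<lambda>k. \<integral>\<^sup>+ s. ennreal ((indicator {real k<..} s * H s \<omega>)\<^sup>2) \<partial>lborel_pos) \<longlonglongrightarrow> (\<integral>\<^sup>+ s. 0 \<partial>lborel_pos)"
  proof (rule nn_integral_dominated_convergence[where w="\<lambda>s. ennreal ((H s \<omega>)\<^sup>2)"])
    show "(\<integral>\<^sup>+ s. ennreal ((H s \<omega>)\<^sup>2) \<partial>lborel_pos) < \<infinity>" using fin by (simp add: energy_restrict)
    show "AE s in lborel_pos. ennreal ((indicator {real k<..} s * H s \<omega>)\<^sup>2) \<le> ennreal ((H s \<omega>)\<^sup>2)" for k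
      by (intro AE_I2 ennreal_leI) (auto simp: indicator_def)
    show "AE s in lborel_pos. (\<lambda>k. ennreal ((indicator {real k<..} s * H s \<omega>)\<^sup>2)) \<longlonglongrightarrow> 0"
    proof (rule AE_I2)
      fix s :: real
      obtain K :: nat where K: "s \<le> real K" using real_arch_simple by blast
      have "eventually (\<lambda>k. ennreal ((indicator {real k<..} s * H s \<omega>)\<^sup>2) = 0) sequentially"
        using eventually_ge_at_top[of K] by eventually_elim (use K in \<open>auto simp: indicator_def\<close>)
      then show "(\<lambda>k. ennreal ((indicator {real k<..} s * H s \<omega>)\<^sup>2)) \<longlonglongrightarrow> 0" by (rule tendsto_eventually)
    qed
  qed measurable
  then show ?thesis by (simp add: energy_restrict)
qed

context ito_integrator
begin

text \<open>The maximal inequality at a single time: processes whose energy is small in probability have an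
  integral that is small in probability.\<close>

lemma step_integral_conv_zero:
  assumes L: "\<And>n. adapted_step F (L n)" and e: "conv_zero_in_prob M (\<lambda>n. energy (step_value (L n)))"
  shows "conv_zero_in_prob M (\<lambda>n \<omega>. ennreal \<bar>step_integral B (L n) \<omega>\<bar>)"
  unfolding conv_zero_in_prob_def
proof (intro allI impI)
  fix \<epsilon> :: real assume \<epsilon>: "0 < \<epsilon>"
  have le: "prob {\<omega> \<in> space M. ennreal \<bar>step_integral B (L n) \<omega>\<bar> > ennreal \<epsilon>}
      \<le> prob {\<omega> \<in> space M. energy (step_value (L n)) \<omega> > ennreal \<delta>} + \<delta> / \<epsilon>^2" if \<delta>: "\<delta> > 0" for n \<delta>
  proof -
    obtain R where R: "R \<ge> 0" "\<forall>(a, b, \<xi>)\<in>set (L n). b \<le> R" using step_end_bounded by blast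
    have "\<forall>(a, b, \<xi>)\<in>set (L n). a \<le> b \<and> b \<le> R" using R(2) L[of n] unfolding adapted_step_def by auto
    note eq = step_integral_until_large[OF this]
    have "prob {\<omega> \<in> space M. ennreal \<bar>step_integral B (L n) \<omega>\<bar> > ennreal \<epsilon>}
       = prob {\<omega> \<in> space M. \<exists>u\<in>{R}. \<bar>step_integral B (step_until u (L n)) \<omega>\<bar> > \<epsilon>}"
      using \<epsilon> by (simp add: eq ennreal_less_iff)
    also have "\<dots> \<le> prob {\<omega> \<in> space M. energy (step_value (L n)) \<omega> > ennreal \<delta>} + \<delta> / \<epsilon>^2"
      by (rule step_maximal_inequality[OF L]) (use R \<epsilon> \<delta> in auto)
    finally show ?thesis .
  qed
  show "(\<lambda>n. prob {\<omega> \<in> space M. ennreal \<bar>step_integral B (L n) \<omega>\<bar> > ennreal \<epsilon>}) \<longlonglongrightarrow> 0"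
  proof (rule tendsto_0_of_le_add_small[where c="1 / \<epsilon>^2"])
    show "(\<lambda>n. prob {\<omega> \<in> space M. energy (step_value (L n)) \<omega> > ennreal \<delta>}) \<longlonglongrightarrow> 0" if "0 < \<delta>" for \<delta>
      using e that unfolding conv_zero_in_prob_def by blast
  qed (use le \<epsilon> in simp_all)
qed

lemma ito_approximation:
  assumes "has_ito_integral M F B H I"
  obtains L where "\<And>n. adapted_step F (L n)"
    "conv_zero_in_prob M (\<lambda>n. energy (\<lambda>s \<omega>. step_value (L n) s \<omega> - H s \<omega>))"
    "conv_zero_in_prob M (\<lambda>n \<omega>. ennreal \<bar>step_integral B (L n) \<omega> - I \<omega>\<bar>)"
proof -
  from assms obtain S where S: "\<And>n. simple_predictable M F (S n)"
    "conv_zero_in_prob M (\<lambda>n \<omega>. \<integral>\<^sup>+ s\<in>{0..}. ennreal ((simple_value (S n) s \<omega> - H s \<omega>)\<^sup>2) \<partial>lborel)"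
    "conv_zero_in_prob M (\<lambda>n \<omega>. ennreal \<bar>simple_integral B (S n) \<omega> - I \<omega>\<bar>)"
    unfolding has_ito_integral_def by blast
  show ?thesis
  proof (rule that[of "\<lambda>n. step_of_simple (S n)"])
    show "adapted_step F (step_of_simple (S n))" for n by (rule adapted_step_of_simple[OF S(1)])
    show "conv_zero_in_prob M (\<lambda>n. energy (\<lambda>s \<omega>. step_value (step_of_simple (S n)) s \<omega> - H s \<omega>))"
      using S(2) unfolding energy_def[abs_def] step_value_of_simple .
    show "conv_zero_in_prob M (\<lambda>n \<omega>. ennreal \<bar>step_integral B (step_of_simple (S n)) \<omega> - I \<omega>\<bar>)"
      using S(3) unfolding step_integral_of_simple .
  qed
qed

lemma energy_diff_measurable:
  "adapted_step F L \<Longrightarrow> jointly_measurable M H \<Longrightarrow>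
    energy (\<lambda>s \<omega>. step_value L s \<omega> - H s \<omega>) \<in> borel_measurable M"
  by (intro energy_measurable jointly_measurable_diff jointly_measurable_step)

text \<open>The integral does not depend on the approximating sequence: the difference of two approximating
  sequences has vanishing energy.\<close>

lemma ito_integral_limit:
  assumes I: "has_ito_integral M F B H I" and L: "\<And>n. adapted_step F (L n)"
    and e: "conv_zero_in_prob M (\<lambda>n. energy (\<lambda>s \<omega>. step_value (L n) s \<omega> - H s \<omega>))"
  shows "conv_zero_in_prob M (\<lambda>n \<omega>. ennreal \<bar>step_integral B (L n) \<omega> - I \<omega>\<bar>)"
proof -
  have H: "jointly_measurable M H" and Im: "I \<in> borel_measurable M"
    using I ito_integrand_jointly_measurable unfolding has_ito_integral_def by auto
  obtain K where K: "\<And>n. adapted_step F (K n)"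
    "conv_zero_in_prob M (\<lambda>n. energy (\<lambda>s \<omega>. step_value (K n) s \<omega> - H s \<omega>))"
    "conv_zero_in_prob M (\<lambda>n \<omega>. ennreal \<bar>step_integral B (K n) \<omega> - I \<omega>\<bar>)"
    using ito_approximation[OF I] by blast
  define D where "D = (\<lambda>n. L n @ step_neg (K n))"
  have D: "adapted_step F (D n)" for n unfolding D_def using L K adapted_step_neg by auto
  have "conv_zero_in_prob M (\<lambda>n. energy (step_value (D n)))"
  proof (rule conv_zero_dominated[OF e _ K(2)])
    show "energy (\<lambda>s \<omega>. step_value (L n) s \<omega> - H s \<omega>) \<in> borel_measurable M"
      "energy (\<lambda>s \<omega>. step_value (K n) s \<omega> - H s \<omega>) \<in> borel_measurable M" for n
      using energy_diff_measurable L K H by auto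
    fix n \<omega> assume "\<omega> \<in> space M"
    then show "energy (step_value (D n)) \<omega> \<le> 2 * energy (\<lambda>s \<omega>. step_value (L n) s \<omega> - H s \<omega>) \<omega>
        + 2 * energy (\<lambda>s \<omega>. step_value (K n) s \<omega> - H s \<omega>) \<omega>"
      by (intro energy_triangle[where M=M] jointly_measurable_diff jointly_measurable_step L K H) (auto simp: D_def)
  qed
  from step_integral_conv_zero[OF D this]
  have "conv_zero_in_prob M (\<lambda>n \<omega>. ennreal \<bar>step_integral B (L n) \<omega> - step_integral B (K n) \<omega>\<bar>)"
    unfolding D_def by simp
  then show ?thesis
    by (rule conv_zero_triangle[OF _ K(3)]) (intro step_integral_measurable L K(1) Im)+
qed

lemma ito_integral_unique:
  assumes I: "has_ito_integral M F B H I" and J: "has_ito_integral M F B H J"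
  shows "AE \<omega> in M. I \<omega> = J \<omega>"
proof -
  have Im: "I \<in> borel_measurable M" and Jm: "J \<in> borel_measurable M"
    using I J unfolding has_ito_integral_def by auto
  obtain K where K: "\<And>n. adapted_step F (K n)"
    "conv_zero_in_prob M (\<lambda>n. energy (\<lambda>s \<omega>. step_value (K n) s \<omega> - H s \<omega>))"
    "conv_zero_in_prob M (\<lambda>n \<omega>. ennreal \<bar>step_integral B (K n) \<omega> - I \<omega>\<bar>)"
    using ito_approximation[OF I] by blast
  have "conv_zero_in_prob M (\<lambda>n \<omega>. ennreal \<bar>I \<omega> - step_integral B (K n) \<omega>\<bar>)"
    using K(3) by (simp only: abs_minus_commute)
  then have "conv_zero_in_prob M (\<lambda>n::nat. \<lambda>\<omega>. ennreal \<bar>I \<omega> - J \<omega>\<bar>)"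
    by (rule conv_zero_triangle[OF _ ito_integral_limit[OF J K(1,2)]]) (intro step_integral_measurable K(1) Im Jm)+
  then have "AE \<omega> in M. I \<omega> - J \<omega> = 0"
    by (rule AE_eq_0_of_conv_zero_const) (use Im Jm in simp)
  then show ?thesis by simp
qed

text \<open>One sequence approximating the integrand on \<open>[0, R]\<close> computes the integrals up to all times \<open>t \<le> R\<close>
  simultaneously.  This is what makes statements about several times at once possible.\<close>

lemma ito_integral_until_limit:
  assumes Y: "has_ito_integral M F B (\<lambda>s \<omega>. indicator {0..t} s * H s \<omega>) I"
    and L: "\<And>n. adapted_step F (L n)" and tR: "t \<le> R" and H: "jointly_measurable M H"
    and e: "conv_zero_in_prob M (\<lambda>n. energy (\<lambda>s \<omega>. step_value (L n) s \<omega> - indicator {0..R} s * H s \<omega>))"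
  shows "conv_zero_in_prob M (\<lambda>n \<omega>. ennreal \<bar>step_integral B (step_until t (L n)) \<omega> - I \<omega>\<bar>)"
proof (rule ito_integral_limit[OF Y])
  show "adapted_step F (step_until t (L n))" for n by (rule adapted_step_until[OF L])
  have JH: "jointly_measurable M (\<lambda>s \<omega>. indicator {0..r} s * H s \<omega>)" for r
    by (rule jointly_measurable_restrict[OF H]) simp
  have m: "energy (\<lambda>s \<omega>. step_value (L n) s \<omega> - indicator {0..R} s * H s \<omega>) \<in> borel_measurable M" for n
    using energy_diff_measurable[OF L JH] .
  show "conv_zero_in_prob M (\<lambda>n. energy (\<lambda>s \<omega>. step_value (step_until t (L n)) s \<omega> - indicator {0..t} s * H s \<omega>))"
  proof (rule conv_zero_dominated[OF e m e m])
    fix n \<omega>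
    let ?e = "energy (\<lambda>s \<omega>. step_value (L n) s \<omega> - indicator {0..R} s * H s \<omega>) \<omega>"
    have "energy (\<lambda>s \<omega>. step_value (step_until t (L n)) s \<omega> - indicator {0..t} s * H s \<omega>) \<omega> \<le> ?e"
      by (rule energy_mono) (use tR in \<open>auto simp: step_value_until indicator_def\<close>)
    also have "?e \<le> 2 * ?e + 2 * ?e"
    proof -
      have "?e = 1 * ?e" by simp
      also have "\<dots> \<le> 2 * ?e" by (rule mult_right_mono) auto
      also have "\<dots> \<le> 2 * ?e + 2 * ?e" by (rule add_increasing2) auto
      finally show ?thesis .
    qed
    finally show "energy (\<lambda>s \<omega>. step_value (step_until t (L n)) s \<omega> - indicator {0..t} s * H s \<omega>) \<omega> \<le> 2 * ?e + 2 * ?e" .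
  qed
qed


text \<open>The inequality for step processes, carried over to the limit.  The loss of constants comes from
  splitting \<open>\<epsilon>\<close> into \<open>\<epsilon>/2 + \<epsilon>/4 + \<epsilon>/4\<close> (the approximating integrals, and the errors at \<open>t\<close> and \<open>T\<close>) and
  from the triangle inequality for the energy, which costs a factor \<open>4\<close>.\<close>

lemma ito_maximal_inequality_finite:
  assumes Y: "\<And>t. 0 \<le> t \<Longrightarrow> has_ito_integral M F B (\<lambda>s \<omega>. indicator {0..t} s * H s \<omega>) (Y t)"
    and H: "jointly_measurable M H" and T: "0 \<le> T" and G: "finite G" "G \<subseteq> {T..}"
    and \<epsilon>: "\<epsilon> > 0" and \<delta>: "\<delta> > 0"
  shows "prob {\<omega> \<in> space M. \<exists>t\<in>G. \<bar>Y t \<omega> - Y T \<omega>\<bar> > \<epsilon>}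
     \<le> prob {\<omega> \<in> space M. energy (\<lambda>s \<omega>. indicator {T<..} s * H s \<omega>) \<omega> > ennreal \<delta>} + 16 * \<delta> / \<epsilon>^2"
proof -
  define R where "R = Max (insert T G)"
  have R: "t \<le> R" if "t \<in> insert T G" for t unfolding R_def using G that by (intro Max_ge) auto
  have R0: "0 \<le> R" using R[of T] T by simp
  have JH: "jointly_measurable M (\<lambda>s \<omega>. indicator {0..r} s * H s \<omega>)"
    "jointly_measurable M (\<lambda>s \<omega>. indicator {r<..} s * H s \<omega>)" for r
    by (rule jointly_measurable_restrict[OF H], simp)+
  obtain L where L: "\<And>n. adapted_step F (L n)"
    "conv_zero_in_prob M (\<lambda>n. energy (\<lambda>s \<omega>. step_value (L n) s \<omega> - indicator {0..R} s * H s \<omega>))"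
    using ito_approximation[OF Y[OF R0]] by blast
  let ?J = "\<lambda>n t. step_integral B (step_until t (L n))"
  let ?e = "\<lambda>n. energy (\<lambda>s \<omega>. step_value (L n) s \<omega> - indicator {0..R} s * H s \<omega>)"
  let ?h = "energy (\<lambda>s \<omega>. indicator {T<..} s * H s \<omega>)"
  let ?D = "\<lambda>n t. {\<omega> \<in> space M. ennreal \<bar>?J n t \<omega> - Y t \<omega>\<bar> > ennreal (\<epsilon>/4)}"
  let ?P = "prob {\<omega> \<in> space M. ?h \<omega> > ennreal \<delta>}"
  have tnn: "0 \<le> t" if "t \<in> insert T G" for t using that G T by auto
  have conv: "conv_zero_in_prob M (\<lambda>n \<omega>. ennreal \<bar>?J n t \<omega> - Y t \<omega>\<bar>)" if t: "t \<in> insert T G" for t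
    by (rule ito_integral_until_limit[OF Y L(1) R[OF t] H L(2)]) (use tnn[OF t] in auto)
  have em: "?e n \<in> borel_measurable M" for n by (rule energy_diff_measurable[OF L(1) JH(1)])
  have hm: "?h \<in> borel_measurable M" by (rule energy_measurable[OF JH(2)])
  have Ym: "Y t \<in> borel_measurable M" if "0 \<le> t" for t using Y[OF that] unfolding has_ito_integral_def by auto
  have Jm: "?J n t \<in> borel_measurable M" for n t
    by (rule step_integral_measurable[OF adapted_step_until[OF L(1)]])
  have Dm: "?D n t \<in> events" if "t \<in> insert T G" for n t
    using Ym[OF tnn[OF that]] Jm[of t n] by measurable
  define br where "br = (\<lambda>n. prob {\<omega> \<in> space M. ?e n \<omega> > ennreal \<delta>} + (\<Sum>t\<in>insert T G. prob (?D n t)))"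
  have br: "br \<longlonglongrightarrow> 0 + 0"
    unfolding br_def
  proof (rule tendsto_add)
    show "(\<lambda>n. prob {\<omega> \<in> space M. ?e n \<omega> > ennreal \<delta>}) \<longlonglongrightarrow> 0"
      using L(2) \<delta> unfolding conv_zero_in_prob_def by blast
    show "(\<lambda>n. \<Sum>t\<in>insert T G. prob (?D n t)) \<longlonglongrightarrow> 0"
      by (rule conv_zero_sum) (use G conv \<epsilon> in auto)
  qed
  have main: "prob {\<omega> \<in> space M. \<exists>t\<in>G. \<bar>Y t \<omega> - Y T \<omega>\<bar> > \<epsilon>} \<le> ?P + 16 * \<delta> / \<epsilon>^2 + br n" for n
  proof -
    let ?L = "step_from T (L n)"
    let ?A = "{\<omega> \<in> space M. \<exists>t\<in>G. \<bar>step_integral B (step_until t ?L) \<omega>\<bar> > \<epsilon>/2}"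
    let ?X = "{\<omega> \<in> space M. energy (step_value ?L) \<omega> > ennreal (4 * \<delta>)}"
    let ?E = "{\<omega> \<in> space M. ?e n \<omega> > ennreal \<delta>}" and ?H = "{\<omega> \<in> space M. ?h \<omega> > ennreal \<delta>}"
    have aL: "adapted_step F ?L" by (rule adapted_step_from[OF L(1)])
    have EH: "?E \<in> events" "?H \<in> events" using em[of n] hm by measurable
    have "prob ?A \<le> prob ?X + 4 * \<delta> / (\<epsilon>/2)^2"
      by (rule step_maximal_inequality[OF aL G(1)]) (use G T \<epsilon> \<delta> in auto)
    also have "prob ?X \<le> prob (?E \<union> ?H)"
    proof (rule finite_measure_mono)
      show "?X \<subseteq> ?E \<union> ?H"
      proof (rule subsetI, rule ccontr)
        fix \<omega> assume w: "\<omega> \<in> ?X" and "\<omega> \<notin> ?E \<union> ?H"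
        then have "?e n \<omega> \<le> ennreal \<delta>" "?h \<omega> \<le> ennreal \<delta>" by (auto simp: not_less)
        then have "2 * ?e n \<omega> + 2 * ?h \<omega> \<le> 2 * ennreal \<delta> + 2 * ennreal \<delta>"
          by (intro add_mono mult_left_mono) auto
        also have "2 * ennreal \<delta> = ennreal (2 * \<delta>)" using \<delta> ennreal_mult[of 2 \<delta>] by simp
        also have "ennreal (2 * \<delta>) + ennreal (2 * \<delta>) = ennreal (4 * \<delta>)"
          using \<delta> by (simp add: ennreal_plus[symmetric] del: ennreal_plus)
        finally have 1: "2 * ?e n \<omega> + 2 * ?h \<omega> \<le> ennreal (4 * \<delta>)" .
        have "energy (step_value ?L) \<omega> \<le> 2 * ?e n \<omega> + 2 * ?h \<omega>"
        proof (rule energy_triangle[where M=M])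
          show "jointly_measurable M (\<lambda>s \<omega>. step_value (L n) s \<omega> - indicator {0..R} s * H s \<omega>)"
            by (intro jointly_measurable_diff jointly_measurable_step L JH)
          show "jointly_measurable M (\<lambda>s \<omega>. indicator {T<..} s * H s \<omega>)" by (rule JH)
          show "\<omega> \<in> space M" using w by simp
          fix s :: real assume "0 \<le> s"
          then show "\<bar>step_value ?L s \<omega>\<bar> \<le> \<bar>step_value (L n) s \<omega> - indicator {0..R} s * H s \<omega>\<bar> + \<bar>indicator {T<..} s * H s \<omega>\<bar>"
            by (auto simp: step_value_from indicator_def)
        qed
        with 1 w show False by (auto simp: not_less[symmetric])
      qed
    qed (use EH in auto)
    also have "prob (?E \<union> ?H) \<le> prob ?E + prob ?H" by (rule measure_Un_le[OF EH])
    also have "4 * \<delta> / (\<epsilon>/2)^2 = 16 * \<delta> / \<epsilon>^2" by (simp add: power_divide)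
    finally have A: "prob ?A \<le> prob ?E + prob ?H + 16 * \<delta> / \<epsilon>^2" by simp
    have Am: "?A \<in> events"
    proof -
      have [measurable]: "step_integral B (step_until t ?L) \<in> borel_measurable M" for t
        by (rule step_integral_measurable[OF adapted_step_until[OF aL]])
      show ?thesis using G(1) by measurable
    qed
    have Um: "(\<Union>t\<in>insert T G. ?D n t) \<in> events" using G(1) Dm by (intro sets.finite_UN) auto
    have "{\<omega> \<in> space M. \<exists>t\<in>G. \<bar>Y t \<omega> - Y T \<omega>\<bar> > \<epsilon>} \<subseteq> ?A \<union> (\<Union>t\<in>insert T G. ?D n t)"
    proof (rule subsetI, rule ccontr)
      fix \<omega> assume "\<omega> \<in> {\<omega> \<in> space M. \<exists>t\<in>G. \<bar>Y t \<omega> - Y T \<omega>\<bar> > \<epsilon>}"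
      then obtain t where w: "\<omega> \<in> space M" and t: "t \<in> G" "\<bar>Y t \<omega> - Y T \<omega>\<bar> > \<epsilon>" by auto
      assume no: "\<omega> \<notin> ?A \<union> (\<Union>t\<in>insert T G. ?D n t)"
      have "\<omega> \<notin> ?D n t" "\<omega> \<notin> ?D n T" using no t(1) by auto
      then have 1: "\<bar>?J n t \<omega> - Y t \<omega>\<bar> \<le> \<epsilon>/4" "\<bar>?J n T \<omega> - Y T \<omega>\<bar> \<le> \<epsilon>/4"
        using w \<epsilon> by (auto simp: ennreal_less_iff not_less)
      have "T \<le> t" using t(1) G by auto
      then have "step_integral B (step_until t ?L) \<omega> = ?J n t \<omega> - ?J n T \<omega>"
        by (rule step_integral_until_from[OF L(1)])
      moreover have "\<bar>step_integral B (step_until t ?L) \<omega>\<bar> \<le> \<epsilon>/2" using no w t(1) by (auto simp: not_less)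
      ultimately show False using 1 t(2) by linarith
    qed
    then have "prob {\<omega> \<in> space M. \<exists>t\<in>G. \<bar>Y t \<omega> - Y T \<omega>\<bar> > \<epsilon>} \<le> prob (?A \<union> (\<Union>t\<in>insert T G. ?D n t))"
      by (rule finite_measure_mono) (use Am Um in auto)
    also have "\<dots> \<le> prob ?A + prob (\<Union>t\<in>insert T G. ?D n t)" by (rule measure_Un_le[OF Am Um])
    also have "prob (\<Union>t\<in>insert T G. ?D n t) \<le> (\<Sum>t\<in>insert T G. prob (?D n t))"
      by (rule measure_UNION_le) (use G Dm in auto)
    finally show ?thesis using A unfolding br_def by linarith
  qed
  have "(\<lambda>n. ?P + 16 * \<delta> / \<epsilon>^2 + br n) \<longlonglongrightarrow> ?P + 16 * \<delta> / \<epsilon>^2 + (0 + 0)"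
    by (intro tendsto_add tendsto_const br)
  then show ?thesis using main LIMSEQ_le_const[of _ _ "prob {\<omega> \<in> space M. \<exists>t\<in>G. \<bar>Y t \<omega> - Y T \<omega>\<bar> > \<epsilon>}"] by auto
qed

text \<open>By the maximal inequality the oscillation of the path after time \<open>k\<close> tends to zero in probability;
  as the events \<open>?E \<epsilon> k\<close> have probabilities tending to zero, almost every \<open>\<omega>\<close> avoids one of them for each
  \<open>\<epsilon>\<close>, which is the Cauchy criterion.\<close>

lemma ito_integral_path_convergent:
  assumes Y: "\<And>t. 0 \<le> t \<Longrightarrow> has_ito_integral M F B (\<lambda>s \<omega>. indicator {0..t} s * H s \<omega>) (Y t)"
    and H: "jointly_measurable M H" and fin: "AE \<omega> in M. energy H \<omega> < \<infinity>"
    and cont: "AE \<omega> in M. continuous_on {0..} (\<lambda>t. Y t \<omega>)"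
  shows "AE \<omega> in M. \<exists>l. ((\<lambda>t. Y t \<omega>) \<longlongrightarrow> l) at_top"
proof -
  let ?h = "\<lambda>k. energy (\<lambda>s \<omega>. indicator {real k<..} s * H s \<omega>)"
  let ?E = "\<lambda>\<epsilon> k. {\<omega> \<in> space M. \<exists>t\<in>dyadics \<inter> {real k..}. \<bar>Y t \<omega> - Y (real k) \<omega>\<bar> > \<epsilon>}"
  have hm: "?h k \<in> borel_measurable M" for k
    by (intro energy_measurable jointly_measurable_restrict H) simp
  have Ym: "Y t \<in> borel_measurable M" if "0 \<le> t" for t using Y[OF that] unfolding has_ito_integral_def by auto
  have "AE \<omega> in M. (\<lambda>k. ?h k \<omega>) \<longlonglongrightarrow> 0"
    using fin AE_space by eventually_elim (rule energy_tail_tendsto_0[OF H])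
  then have tail: "conv_zero_in_prob M ?h" by (rule conv_zero_AE[OF hm])
  have evm: "{\<omega> \<in> space M. \<bar>Y t \<omega> - Y (real k) \<omega>\<bar> > \<epsilon>} \<in> events" if "0 \<le> t" for t k \<epsilon>
    using Ym[OF that] Ym[of "real k"] by measurable
  have Em: "?E \<epsilon> k \<in> events" for \<epsilon> k
    by (rule sets.sets_Collect_countable_Ex') (use countable_dyadics evm dyadics_nonneg in auto)
  have Ele: "prob (?E \<epsilon> k) \<le> prob {\<omega> \<in> space M. ?h k \<omega> > ennreal \<delta>} + 16 * \<delta> / \<epsilon>^2"
    if "\<epsilon> > 0" "\<delta> > 0" for \<epsilon> \<delta> k
    by (rule prob_ex_countable_le)
      (use countable_dyadics evm dyadics_nonneg ito_maximal_inequality_finite[OF Y H] that in auto)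
  have Elim: "(\<lambda>k. prob (?E \<epsilon> k)) \<longlonglongrightarrow> 0" if \<epsilon>: "\<epsilon> > 0" for \<epsilon>
  proof (rule tendsto_0_of_le_add_small[where c="16 / \<epsilon>^2"])
    show "(\<lambda>k. prob {\<omega> \<in> space M. ?h k \<omega> > ennreal \<delta>}) \<longlonglongrightarrow> 0" if "0 < \<delta>" for \<delta>
      using tail that unfolding conv_zero_in_prob_def by blast
    show "prob (?E \<epsilon> k) \<le> prob {\<omega> \<in> space M. ?h k \<omega> > ennreal \<delta>} + 16 / \<epsilon>^2 * \<delta>" if "0 < \<delta>" for k \<delta>
      using Ele[OF \<epsilon> that, of k] by simp
  qed (use \<epsilon> in simp_all)
  have "AE \<omega> in M. \<forall>j::nat. \<exists>k. \<omega> \<notin> ?E (1 / Suc j) k"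
    unfolding AE_all_countable by (intro allI AE_not_all_of_prob_tendsto_0 Em Elim) simp
  with cont AE_space show ?thesis
  proof eventually_elim
    case (elim \<omega>)
    let ?y = "\<lambda>t. Y t \<omega>"
    have osc: "\<exists>k::nat. \<forall>t\<ge>real k. \<bar>?y t - ?y (real k)\<bar> \<le> \<epsilon>" if \<epsilon>: "\<epsilon> > 0" for \<epsilon>
    proof -
      obtain j where j: "1 / real (Suc j) < \<epsilon>" using \<epsilon> nat_approx_posE by blast
      obtain k where k: "\<omega> \<notin> ?E (1 / Suc j) k" using elim(3) by blast
      have "?y t \<in> cball (?y (real k)) \<epsilon>" if "real k \<le> t" for t
      proof (rule continuous_closed_from_dyadics[OF elim(1) closed_cball _ _ that])
        fix d assume "d \<in> dyadics" "real k \<le> d"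
        then have "\<bar>?y d - ?y (real k)\<bar> \<le> 1 / Suc j" using k elim(2) by (auto simp: not_less)
        then show "?y d \<in> cball (?y (real k)) \<epsilon>" using j by (simp add: dist_real_def abs_minus_commute)
      qed simp
      then show ?thesis by (intro exI[of _ k]) (auto simp: dist_real_def abs_minus_commute)
    qed
    have "Cauchy (\<lambda>n. ?y (real n))"
    proof (rule CauchyI)
      fix e :: real assume e: "0 < e"
      obtain k where k: "\<forall>t\<ge>real k. \<bar>?y t - ?y (real k)\<bar> \<le> e/3" using osc[of "e/3"] e by auto
      show "\<exists>K. \<forall>m\<ge>K. \<forall>n\<ge>K. norm (?y (real m) - ?y (real n)) < e"
      proof (intro exI[of _ k] allI impI)
        fix m n assume "k \<le> m" "k \<le> n"
        then have "\<bar>?y (real m) - ?y (real k)\<bar> \<le> e/3" "\<bar>?y (real n) - ?y (real k)\<bar> \<le> e/3" using k by auto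
        then show "norm (?y (real m) - ?y (real n)) < e" using e unfolding real_norm_def by linarith
      qed
    qed
    then obtain l where l: "(\<lambda>n. ?y (real n)) \<longlonglongrightarrow> l" using Cauchy_convergent convergent_def by blast
    have "(?y \<longlongrightarrow> l) at_top"
    proof (rule tendstoI)
      fix e :: real assume e: "0 < e"
      obtain k where k: "\<forall>t\<ge>real k. \<bar>?y t - ?y (real k)\<bar> \<le> e/3" using osc[of "e/3"] e by auto
      have "\<bar>l - ?y (real k)\<bar> \<le> e/3"
      proof (rule LIMSEQ_le_const2)
        show "(\<lambda>n. \<bar>?y (real n) - ?y (real k)\<bar>) \<longlonglongrightarrow> \<bar>l - ?y (real k)\<bar>" by (intro tendsto_intros l)
        show "\<exists>N. \<forall>n\<ge>N. \<bar>?y (real n) - ?y (real k)\<bar> \<le> e/3" using k by (intro exI[of _ k]) auto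
      qed
      show "\<forall>\<^sub>F t in at_top. dist (?y t) l < e"
        using eventually_ge_at_top[of "real k"]
      proof eventually_elim
        case (elim t)
        then have "\<bar>?y t - ?y (real k)\<bar> \<le> e/3" using k by auto
        with \<open>\<bar>l - ?y (real k)\<bar> \<le> e/3\<close> show ?case using e unfolding dist_real_def by linarith
      qed
    qed
    then show ?case by blast
  qed
qed

text \<open>A diagonal sequence: the \<open>k\<close>-th process approximates the integrand on \<open>[0, k]\<close> up to \<open>1 / (k + 1)\<close>, and
  the energy beyond \<open>k\<close> vanishes in the limit.\<close>

lemma has_ito_integral_at_infinity:
  assumes Y: "\<And>t. 0 \<le> t \<Longrightarrow> has_ito_integral M F B (\<lambda>s \<omega>. indicator {0..t} s * H s \<omega>) (Y t)"
    and H: "jointly_measurable M H" and fin: "AE \<omega> in M. energy H \<omega> < \<infinity>"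
    and lim: "AE \<omega> in M. (\<lambda>n. Y (real n) \<omega>) \<longlonglongrightarrow> I \<omega>" and Im: "I \<in> borel_measurable M"
  shows "has_ito_integral M F B H I"
  unfolding has_ito_integral_def
proof (intro conjI Im)
  have "(\<lambda>(s, \<omega>). H s \<omega>) \<in> borel_measurable (restrict_space borel {0..} \<Otimes>\<^sub>M M)"
    using H unfolding jointly_measurable_def .
  moreover have "H s \<in> borel_measurable (F s)" if s: "0 \<le> s" for s
  proof -
    have "\<forall>u\<ge>0. (\<lambda>\<omega>. indicator {0..s} u * H u \<omega>) \<in> borel_measurable (F u)"
      using Y[OF s] unfolding has_ito_integral_def ito_integrand_def by (elim conjE)
    then have "(\<lambda>\<omega>. indicator {0..s} s * H s \<omega>) \<in> borel_measurable (F s)" using s by blast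
    then show ?thesis using s by simp
  qed
  ultimately show "ito_integrand M F H" using fin unfolding ito_integrand_def energy_def by simp
  let ?Hk = "\<lambda>k s \<omega>. indicator {0..real k} s * H s \<omega>"
  let ?tail = "\<lambda>k. energy (\<lambda>s \<omega>. indicator {real k<..} s * H s \<omega>)"
  have JH: "jointly_measurable M (?Hk k)" for k
    by (rule jointly_measurable_restrict[OF H]) simp
  have tm: "?tail k \<in> borel_measurable M" for k
    by (intro energy_measurable jointly_measurable_restrict H) simp
  have Ym: "Y t \<in> borel_measurable M" if "0 \<le> t" for t using Y[OF that] unfolding has_ito_integral_def by auto
  let ?r = "\<lambda>k. 1 / real (Suc k)"
  have rlim: "?r \<longlonglongrightarrow> 0" using LIMSEQ_inverse_real_of_nat by (simp add: inverse_eq_divide)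
  have "\<exists>S. simple_predictable M F S
      \<and> prob {\<omega> \<in> space M. energy (\<lambda>s \<omega>. simple_value S s \<omega> - ?Hk k s \<omega>) \<omega> > ennreal (?r k)} < ?r k
      \<and> prob {\<omega> \<in> space M. ennreal \<bar>simple_integral B S \<omega> - Y (real k) \<omega>\<bar> > ennreal (?r k)} < ?r k" for k
  proof -
    from Y[of "real k"] obtain S where S: "\<And>n. simple_predictable M F (S n)"
      "conv_zero_in_prob M (\<lambda>n. energy (\<lambda>s \<omega>. simple_value (S n) s \<omega> - ?Hk k s \<omega>))"
      "conv_zero_in_prob M (\<lambda>n \<omega>. ennreal \<bar>simple_integral B (S n) \<omega> - Y (real k) \<omega>\<bar>)"
      unfolding has_ito_integral_def energy_def[abs_def] by auto
    have rk: "0 < ?r k" by simp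
    have c1: "(\<lambda>n. prob {\<omega> \<in> space M. energy (\<lambda>s \<omega>. simple_value (S n) s \<omega> - ?Hk k s \<omega>) \<omega> > ennreal (?r k)}) \<longlonglongrightarrow> 0"
      using S(2) rk unfolding conv_zero_in_prob_def by blast
    have c2: "(\<lambda>n. prob {\<omega> \<in> space M. ennreal \<bar>simple_integral B (S n) \<omega> - Y (real k) \<omega>\<bar> > ennreal (?r k)}) \<longlonglongrightarrow> 0"
      using S(3) rk unfolding conv_zero_in_prob_def by blast
    from eventually_conj[OF order_tendstoD(2)[OF c1 rk] order_tendstoD(2)[OF c2 rk]]
    obtain n where "prob {\<omega> \<in> space M. energy (\<lambda>s \<omega>. simple_value (S n) s \<omega> - ?Hk k s \<omega>) \<omega> > ennreal (?r k)} < ?r k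
      \<and> prob {\<omega> \<in> space M. ennreal \<bar>simple_integral B (S n) \<omega> - Y (real k) \<omega>\<bar> > ennreal (?r k)} < ?r k"
      by (auto dest!: eventually_happens)
    then show ?thesis using S(1)[of n] by (intro exI[of _ "S n"]) (elim conjE, intro conjI)
  qed
  then have "\<forall>k. \<exists>S. simple_predictable M F S
      \<and> prob {\<omega> \<in> space M. energy (\<lambda>s \<omega>. simple_value S s \<omega> - ?Hk k s \<omega>) \<omega> > ennreal (?r k)} < ?r k
      \<and> prob {\<omega> \<in> space M. ennreal \<bar>simple_integral B S \<omega> - Y (real k) \<omega>\<bar> > ennreal (?r k)} < ?r k"
    by (rule allI)
  from choice[OF this] obtain S where S': "\<forall>k. simple_predictable M F (S k)
      \<and> prob {\<omega> \<in> space M. energy (\<lambda>s \<omega>. simple_value (S k) s \<omega> - ?Hk k s \<omega>) \<omega> > ennreal (?r k)} < ?r k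
      \<and> prob {\<omega> \<in> space M. ennreal \<bar>simple_integral B (S k) \<omega> - Y (real k) \<omega>\<bar> > ennreal (?r k)} < ?r k"
    by (elim exE)
  then have S: "\<And>k. simple_predictable M F (S k)"
    "\<And>k. prob {\<omega> \<in> space M. energy (\<lambda>s \<omega>. simple_value (S k) s \<omega> - ?Hk k s \<omega>) \<omega> > ennreal (?r k)} < ?r k"
    "\<And>k. prob {\<omega> \<in> space M. ennreal \<bar>simple_integral B (S k) \<omega> - Y (real k) \<omega>\<bar> > ennreal (?r k)} < ?r k"
    by auto
  have diag: "conv_zero_in_prob M U"
    if Um: "\<And>k. U k \<in> borel_measurable M" and le: "\<And>k. prob {\<omega> \<in> space M. U k \<omega> > ennreal (?r k)} < ?r k" for U
    unfolding conv_zero_in_prob_def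
  proof (intro allI impI)
    fix \<epsilon> :: real assume \<epsilon>: "0 < \<epsilon>"
    have ev: "\<forall>\<^sub>F k in sequentially. prob {\<omega> \<in> space M. U k \<omega> > ennreal \<epsilon>} \<le> ?r k"
      using order_tendstoD(2)[OF rlim \<epsilon>]
    proof eventually_elim
      case (elim k)
      have m: "{\<omega> \<in> space M. U k \<omega> > ennreal (?r k)} \<in> events" using Um[of k] by measurable
      have "ennreal (?r k) \<le> ennreal \<epsilon>" using elim by (intro ennreal_leI) simp
      then have "{\<omega> \<in> space M. U k \<omega> > ennreal \<epsilon>} \<subseteq> {\<omega> \<in> space M. U k \<omega> > ennreal (?r k)}"
        by (auto intro: le_less_trans)
      from finite_measure_mono[OF this m] le[of k] show ?case by linarith
    qed
    show "(\<lambda>k. prob {\<omega> \<in> space M. U k \<omega> > ennreal \<epsilon>}) \<longlonglongrightarrow> 0"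
      by (rule tendsto_sandwich[OF _ ev tendsto_const rlim]) (simp add: always_eventually)
  qed
  have aS: "adapted_step F (step_of_simple (S k))" for k by (rule adapted_step_of_simple[OF S(1)])
  have JS: "jointly_measurable M (simple_value (S k))" for k
    using jointly_measurable_step[OF aS[of k]] unfolding step_value_of_simple[abs_def] .
  have em: "energy (\<lambda>s \<omega>. simple_value (S k) s \<omega> - ?Hk k s \<omega>) \<in> borel_measurable M" for k
    by (intro energy_measurable jointly_measurable_diff JS JH)
  have im: "simple_integral B (S k) \<in> borel_measurable M" for k
    using step_integral_measurable[OF aS[of k]] unfolding step_integral_of_simple[abs_def] .
  have "AE \<omega> in M. (\<lambda>k. ?tail k \<omega>) \<longlonglongrightarrow> 0"
    using fin AE_space by eventually_elim (rule energy_tail_tendsto_0[OF H])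
  then have tail: "conv_zero_in_prob M ?tail" by (rule conv_zero_AE[OF tm])
  have c1: "conv_zero_in_prob M (\<lambda>k. energy (\<lambda>s \<omega>. simple_value (S k) s \<omega> - H s \<omega>))"
  proof (rule conv_zero_dominated[OF diag[OF em S(2)] em tail tm])
    fix k \<omega> assume w: "\<omega> \<in> space M"
    show "energy (\<lambda>s \<omega>. simple_value (S k) s \<omega> - H s \<omega>) \<omega>
       \<le> 2 * energy (\<lambda>s \<omega>. simple_value (S k) s \<omega> - ?Hk k s \<omega>) \<omega> + 2 * ?tail k \<omega>"
      by (rule energy_triangle[OF _ _ w]; (intro jointly_measurable_diff JS JH jointly_measurable_restrict H)?)
        (auto simp: indicator_def)
  qed
  have ym: "(\<lambda>\<omega>. ennreal \<bar>simple_integral B (S k) \<omega> - Y (real k) \<omega>\<bar>) \<in> borel_measurable M" for k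
    using im[of k] Ym[of "real k"] by simp
  have zm: "(\<lambda>\<omega>. ennreal \<bar>Y (real k) \<omega> - I \<omega>\<bar>) \<in> borel_measurable M" for k
    using Im Ym[of "real k"] by simp
  have "AE \<omega> in M. (\<lambda>k. ennreal \<bar>Y (real k) \<omega> - I \<omega>\<bar>) \<longlonglongrightarrow> 0"
    using lim
  proof eventually_elim
    case (elim \<omega>)
    then have "(\<lambda>k. \<bar>Y (real k) \<omega> - I \<omega>\<bar>) \<longlonglongrightarrow> \<bar>I \<omega> - I \<omega>\<bar>" by (intro tendsto_intros)
    then have "(\<lambda>k. ennreal \<bar>Y (real k) \<omega> - I \<omega>\<bar>) \<longlonglongrightarrow> ennreal 0" by (intro tendsto_ennrealI) simp
    then show ?case by simp
  qed
  then have yc: "conv_zero_in_prob M (\<lambda>k \<omega>. ennreal \<bar>Y (real k) \<omega> - I \<omega>\<bar>)" by (rule conv_zero_AE[OF zm])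
  have c2: "conv_zero_in_prob M (\<lambda>k \<omega>. ennreal \<bar>simple_integral B (S k) \<omega> - I \<omega>\<bar>)"
    by (rule conv_zero_triangle[OF diag[OF ym S(3)] yc]) (intro im Ym Im of_nat_0_le_iff)+
  show "\<exists>S. (\<forall>n. simple_predictable M F (S n)) \<and>
        conv_zero_in_prob M (\<lambda>n \<omega>. \<integral>\<^sup>+ s\<in>{0..}. ennreal ((simple_value (S n) s \<omega> - H s \<omega>)\<^sup>2) \<partial>lborel) \<and>
        conv_zero_in_prob M (\<lambda>n \<omega>. ennreal \<bar>simple_integral B (S n) \<omega> - I \<omega>\<bar>)"
    by (rule exI[of _ S]) (use S(1) c1 c2 in \<open>simp add: energy_def[abs_def]\<close>)
qed

theorem ito_integral_process_tendsto:
  assumes Y: "ito_integral_process M F B H Y" and fin: "AE \<omega> in M. energy H \<omega> < \<infinity>"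
    and H: "jointly_measurable M H"
  shows "\<exists>I. has_ito_integral M F B H I"
    and "has_ito_integral M F B H I \<Longrightarrow> AE \<omega> in M. ((\<lambda>t. Y t \<omega>) \<longlongrightarrow> I \<omega>) at_top"
proof -
  have Yt: "\<And>t. 0 \<le> t \<Longrightarrow> has_ito_integral M F B (\<lambda>s \<omega>. indicator {0..t} s * H s \<omega>) (Y t)"
    and cont: "AE \<omega> in M. continuous_on {0..} (\<lambda>t. Y t \<omega>)"
    using Y unfolding ito_integral_process_def by auto
  have Ym: "Y t \<in> borel_measurable M" if "0 \<le> t" for t using Yt[OF that] unfolding has_ito_integral_def by auto
  define J where "J = (\<lambda>\<omega>. lim (\<lambda>n. Y (real n) \<omega>))"
  have Jm: "J \<in> borel_measurable M" unfolding J_def by (rule borel_measurable_lim_metric) (use Ym in simp)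
  have "AE \<omega> in M. \<exists>l. ((\<lambda>t. Y t \<omega>) \<longlongrightarrow> l) at_top"
    by (rule ito_integral_path_convergent[OF Yt H fin cont])
  then have lim: "AE \<omega> in M. ((\<lambda>t. Y t \<omega>) \<longlongrightarrow> J \<omega>) at_top"
  proof eventually_elim
    case (elim \<omega>)
    then obtain l where l: "((\<lambda>t. Y t \<omega>) \<longlongrightarrow> l) at_top" by blast
    then have "(\<lambda>n. Y (real n) \<omega>) \<longlonglongrightarrow> l" by (rule filterlim_compose) (rule filterlim_real_sequentially)
    then have "J \<omega> = l" unfolding J_def by (rule limI)
    with l show ?case by simp
  qed
  then have limn: "AE \<omega> in M. (\<lambda>n. Y (real n) \<omega>) \<longlonglongrightarrow> J \<omega>"
    by eventually_elim (rule filterlim_compose, assumption, rule filterlim_real_sequentially)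
  have J: "has_ito_integral M F B H J"
    by (rule has_ito_integral_at_infinity[OF Yt H fin limn Jm])
  then show "\<exists>I. has_ito_integral M F B H I" by blast
  assume "has_ito_integral M F B H I"
  from ito_integral_unique[OF this J] lim
  show "AE \<omega> in M. ((\<lambda>t. Y t \<omega>) \<longlongrightarrow> I \<omega>) at_top" by eventually_elim simp
qed

end


section \<open>Growth of Brownian paths\<close>

lemma std_normal_tail_pos: "0 < measure (density lborel std_normal_density) {1..}"
proof -
  let ?N = "density lborel std_normal_density"
  interpret N: prob_space ?N by (rule prob_space_normal_density) simp
  have "0 < ennreal (std_normal_density 2)" using normal_density_pos[of 1 0 2] by simp
  also have "\<dots> = (\<integral>\<^sup>+ x. ennreal (std_normal_density 2) * indicator {1..2::real} x \<partial>lborel)"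
    by (simp add: nn_integral_cmult_indicator)
  also have "\<dots> \<le> (\<integral>\<^sup>+ x. ennreal (std_normal_density x) * indicator {1..} x \<partial>lborel)"
  proof (rule nn_integral_mono)
    fix x :: real
    have "std_normal_density 2 \<le> std_normal_density x" if "1 \<le> x" "x \<le> 2"
    proof -
      have "x^2 \<le> 2^2" by (rule power_mono) (use that in auto)
      then show ?thesis unfolding std_normal_density_def by (intro mult_left_mono) auto
    qed
    then show "ennreal (std_normal_density 2) * indicator {1..2::real} x \<le> ennreal (std_normal_density x) * indicator {1..} x"
      by (auto simp: indicator_def intro: ennreal_leI)
  qed
  also have "\<dots> = emeasure ?N {1..}" by (subst emeasure_density) auto
  finally show ?thesis by (simp add: N.emeasure_eq_measure)
qed

text \<open>The length \<open>4 t\<^sup>2\<close> of the interval after \<open>t\<close> makes the standard deviation of the increment \<open>2 t\<close>, twice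
  the bound \<open>t\<close> that sublinear growth gives for the absolute value of the path at time \<open>t\<close>.\<close>

fun sparse_times :: "nat \<Rightarrow> nat" where
  "sparse_times 0 = 1"
| "sparse_times (Suc k) = sparse_times k + 4 * (sparse_times k)^2"

lemma sparse_times_pos: "0 < sparse_times k"
  by (induction k) auto

lemma sparse_times_ge: "k \<le> sparse_times k"
proof (induction k)
  case (Suc k)
  have "0 < (sparse_times k)^2" using sparse_times_pos[of k] by simp
  then show ?case using Suc unfolding sparse_times.simps by linarith
qed simp

declare sparse_times.simps(2)[simp del]

lemma nn_integral_exp_decay_finite:
  fixes c :: real
  assumes "0 < c"
  shows "(\<integral>\<^sup>+ s\<in>{0..}. ennreal (exp (- c * s)) \<partial>lborel) < \<infinity>"
proof -
  interpret prob_space "density lborel (exponential_density c)"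
    by (rule prob_space_exponential_density[OF assms])
  have "(\<integral>\<^sup>+ s. ennreal (exponential_density c s) \<partial>lborel) = 1"
    using emeasure_space_1 by (simp add: emeasure_density)
  have "(\<integral>\<^sup>+ s\<in>{0..}. ennreal (exp (- c * s)) \<partial>lborel)
      = (\<integral>\<^sup>+ s. ennreal (1 / c) * ennreal (exponential_density c s) \<partial>lborel)"
    by (rule nn_integral_cong)
      (use assms in \<open>auto simp: exponential_density_def indicator_def ennreal_mult'[symmetric] mult.commute\<close>)
  also have "\<dots> = ennreal (1 / c) * (\<integral>\<^sup>+ s. ennreal (exponential_density c s) \<partial>lborel)"
    by (rule nn_integral_cmult) simp
  also have "\<dots> < \<infinity>" using \<open>(\<integral>\<^sup>+ s. ennreal (exponential_density c s) \<partial>lborel) = 1\<close> by simp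
  finally show ?thesis .
qed

lemma ex_dyadic_interval:
  fixes t :: real
  assumes "1 \<le> t"
  shows "\<exists>k. 2 ^ k \<le> t \<and> t < 2 ^ Suc k"
proof -
  have ex: "\<exists>n. t < 2 ^ n" using real_arch_pow[of 2 t] by simp
  define n where "n = (LEAST n. t < 2 ^ n)"
  have n: "t < 2 ^ n" unfolding n_def by (rule LeastI_ex[OF ex])
  then obtain k where k: "n = Suc k" using assms by (cases n) auto
  have "\<not> t < 2 ^ k" using not_less_Least[of k "\<lambda>n. t < 2 ^ n"] k unfolding n_def by auto
  then show ?thesis using n k by (intro exI[of _ k]) auto
qed

context ito_integrator
begin

text \<open>The integral of the constant \<open>1\<close> over \<open>(0, b]\<close>, with \<open>\<delta> = b\<close>.\<close>

lemma increment_maximal_inequality: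
  assumes b: "0 < b" and \<epsilon>: "0 < \<epsilon>"
  shows "prob {\<omega> \<in> space M. \<exists>u\<in>dyadics \<inter> {0..b}. \<bar>B u \<omega> - B 0 \<omega>\<bar> > \<epsilon>} \<le> b / \<epsilon>^2"
proof (rule prob_ex_countable_le)
  show "countable (dyadics \<inter> {0..b})" using countable_dyadics by auto
  show "{\<omega> \<in> space M. \<bar>B u \<omega> - B 0 \<omega>\<bar> > \<epsilon>} \<in> events" if "u \<in> dyadics \<inter> {0..b}" for u
    using B_measurable[of u] B_measurable[of 0] that by auto
  fix G assume G: "finite G" "G \<subseteq> dyadics \<inter> {0..b}"
  let ?L = "[(0, b, \<lambda>_. 1)] :: 'a step_process"
  have L: "adapted_step F ?L" using b by simp
  have eq: "step_integral B (step_until u ?L) \<omega> = B u \<omega> - B 0 \<omega>" if "u \<in> G" for u \<omega>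
    using G that by (auto simp: max_def min_def)
  have en: "energy (step_value ?L) \<omega> = ennreal b" for \<omega>
  proof -
    have "energy (step_value ?L) \<omega> = (\<integral>\<^sup>+ s. indicator {0<..b} s \<partial>lborel)"
      unfolding energy_def by (rule nn_integral_cong) (auto simp: indicator_def)
    then show ?thesis using b by simp
  qed
  have "prob {\<omega> \<in> space M. \<exists>u\<in>G. \<bar>step_integral B (step_until u ?L) \<omega>\<bar> > \<epsilon>}
     \<le> prob {\<omega> \<in> space M. energy (step_value ?L) \<omega> > ennreal b} + b / \<epsilon>^2"
    by (rule step_maximal_inequality[OF L G(1)]) (use G \<epsilon> b in auto)
  moreover have "{\<omega> \<in> space M. \<exists>u\<in>G. \<bar>step_integral B (step_until u ?L) \<omega>\<bar> > \<epsilon>}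
     = {\<omega> \<in> space M. \<exists>u\<in>G. \<bar>B u \<omega> - B 0 \<omega>\<bar> > \<epsilon>}"
    using eq by auto
  moreover have "{\<omega> \<in> space M. energy (step_value ?L) \<omega> > ennreal b} = {}" unfolding en by simp
  ultimately show "prob {\<omega> \<in> space M. \<exists>u\<in>G. \<bar>B u \<omega> - B 0 \<omega>\<bar> > \<epsilon>} \<le> b / \<epsilon>^2"
    by (simp only: measure_empty)
qed

text \<open>The maximal inequality on \<open>[0, 2^k]\<close> at level \<open>\<eta> 2^k / 2\<close> gives summable probabilities; the first
  Borel--Cantelli lemma applies, and \<open>2^k \<le> t < 2^(k + 1)\<close> turns the level into a multiple of \<open>t\<close>.\<close>

lemma sublinear_growth:
  assumes cont: "AE \<omega> in M. continuous_on {0..} (\<lambda>t. B t \<omega>)" and B0: "AE \<omega> in M. B 0 \<omega> = 0"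
    and \<eta>: "0 < \<eta>"
  shows "AE \<omega> in M. \<forall>\<^sub>F t in at_top. \<bar>B t \<omega>\<bar> \<le> \<eta> * t"
proof -
  let ?E = "\<lambda>k. {\<omega> \<in> space M. \<exists>u\<in>dyadics \<inter> {0..2^k}. \<bar>B u \<omega> - B 0 \<omega>\<bar> > \<eta> * 2^k / 2}"
  have Em: "?E k \<in> events" for k
    by (rule sets.sets_Collect_countable_Ex') (use countable_dyadics B_measurable in auto)
  have le: "prob (?E k) \<le> 4 / \<eta>^2 * (1/2)^k" for k
  proof -
    have "prob (?E k) \<le> 2^k / (\<eta> * 2^k / 2)^2"
      by (rule increment_maximal_inequality) (use \<eta> in auto)
    also have "\<dots> = 4 / \<eta>^2 * (1/2)^k"
      using \<eta> by (simp add: power_divide power_mult_distrib power2_eq_square field_simps)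
    finally show ?thesis .
  qed
  have "summable (\<lambda>k. prob (?E k))"
  proof (rule summable_comparison_test')
    show "summable (\<lambda>k. 4 / \<eta>^2 * (1/2)^k)" by (intro summable_mult summable_geometric) simp
    show "norm (prob (?E k)) \<le> 4 / \<eta>^2 * (1/2)^k" if "0 \<le> k" for k using le[of k] by simp
  qed
  then have "AE \<omega> in M. eventually (\<lambda>k. \<omega> \<in> space M - ?E k) sequentially"
    by (intro borel_cantelli_AE1 Em) (simp add: emeasure_eq_measure)
  with cont B0 show ?thesis
  proof eventually_elim
    case (elim \<omega>)
    from elim(3) obtain K where K: "\<And>k. K \<le> k \<Longrightarrow> \<omega> \<in> space M - ?E k"
      unfolding eventually_sequentially by blast
    show ?case
      using eventually_ge_at_top[of "2 ^ K"]
    proof eventually_elim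
      case t: (elim t)
      have "1 \<le> (2::real) ^ K" by simp
      then have t1: "1 \<le> t" using t by linarith
      from ex_dyadic_interval[OF this] obtain k where k: "2 ^ k \<le> t" "t < 2 ^ Suc k" by auto
      have "(2::real) ^ K < 2 ^ Suc k" using t k by linarith
      then have "K < Suc k" by (simp del: power_Suc)
      then have w: "\<omega> \<in> space M - ?E (Suc k)" by (intro K) simp
      \<comment> \<open>the path is stopped at \<open>2^Suc k\<close> so that the bound holds at all dyadic times\<close>
      have "(\<lambda>t. B (min t (2^Suc k)) \<omega>) t \<in> cball 0 (\<eta> * 2^Suc k / 2)"
      proof (rule continuous_closed_from_dyadics[where a=0 and t=t and f="\<lambda>t. B (min t (2^Suc k)) \<omega>"])
        show "continuous_on {0..} (\<lambda>t. B (min t (2^Suc k)) \<omega>)"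
          by (rule continuous_on_compose2[OF elim(1)]) (auto intro!: continuous_intros)
        fix d :: real assume d: "d \<in> dyadics" "0 \<le> d"
        have "(2::real)^Suc k \<in> dyadics" using of_nat_dyadic[of "2^Suc k"] by simp
        then have "min d (2^Suc k) \<in> dyadics \<inter> {0..2^Suc k}" using d by (auto simp: min_def simp del: power_Suc)
        then have "\<bar>B (min d (2^Suc k)) \<omega> - B 0 \<omega>\<bar> \<le> \<eta> * 2^Suc k / 2"
          using w by (auto simp del: power_Suc simp: not_less)
        then show "B (min d (2^Suc k)) \<omega> \<in> cball 0 (\<eta> * 2^Suc k / 2)"
          using elim(2) by (simp del: power_Suc)
      qed (use t1 in auto)
      moreover have "min t (2^Suc k) = t" using k by simp
      ultimately have "\<bar>B t \<omega>\<bar> \<le> \<eta> * 2^Suc k / 2" by (simp del: power_Suc)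
      also have "\<dots> = \<eta> * 2^k" by simp
      also have "\<dots> \<le> \<eta> * t" using k \<eta> by (intro mult_left_mono) auto
      finally show ?case .
    qed
  qed
qed

lemma prob_increment_ge_std:
  assumes st: "0 \<le> s" "s < t"
  shows "prob {\<omega> \<in> space M. B t \<omega> - B s \<omega> \<ge> sqrt (t - s)} = measure (density lborel std_normal_density) {1..}"
proof -
  have \<sigma>: "0 < sqrt (t - s)" using st by simp
  let ?X = "\<lambda>\<omega>. (B t \<omega> - B s \<omega> - 0) / sqrt (t - s)"
  have D: "distributed M lborel ?X std_normal_density"
    using increment_normal[OF st] normal_standard_normal_convert[OF \<sigma>, of "\<lambda>\<omega>. B t \<omega> - B s \<omega>" 0] by simp
  have "measure (density lborel std_normal_density) {1..} = measure (distr M lborel ?X) {1..}"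
    using distributed_distr_eq_density[OF D] by simp
  also have "\<dots> = prob (?X -` {1..} \<inter> space M)"
    by (rule measure_distr) (use distributed_measurable[OF D] in auto)
  also have "?X -` {1..} \<inter> space M = {\<omega> \<in> space M. B t \<omega> - B s \<omega> \<ge> sqrt (t - s)}"
    using \<sigma> by (auto simp: field_simps)
  finally show ?thesis by simp
qed

text \<open>
  The increments over the intervals between the sparse times are independent, and each of them exceeds
  its standard deviation with the same positive probability \<open>c\<close>.  Hence this happens infinitely often,
  and each time the increment outweighs the preceding value of the path.\<close>

lemma unbounded_above:
  assumes cont: "AE \<omega> in M. continuous_on {0..} (\<lambda>t. B t \<omega>)" and B0: "AE \<omega> in M. B 0 \<omega> = 0"
  shows "AE \<omega> in M. \<forall>K::nat. \<exists>n::nat. real K \<le> B (real n) \<omega>"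
proof -
  define c where "c = measure (density lborel std_normal_density) {1..}"
  let ?t = "\<lambda>k. real (sparse_times k)"
  let ?X = "\<lambda>k \<omega>. B (?t (Suc k)) \<omega> - B (?t k) \<omega>"
  let ?s = "\<lambda>k. 2 * ?t k"
  have tlt: "?t k < ?t (Suc k)" for k using sparse_times_pos[of k] by (simp add: sparse_times.simps(2))
  have sq: "sqrt (?t (Suc k) - ?t k) = ?s k" for k
    by (rule real_sqrt_unique) (simp_all add: power_mult_distrib sparse_times.simps(2))
  have pX: "prob {\<omega> \<in> space M. ?X k \<omega> \<ge> ?s k} = c" for k
    using prob_increment_ge_std[OF _ tlt[of k]] unfolding c_def sq by simp
  have Bm: "B (?t k) \<in> borel_measurable M" for k by (rule B_measurable) simp
  have Xm: "?X k \<in> borel_measurable M" for k by (rule borel_measurable_diff[OF Bm Bm])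
  let ?E = "\<lambda>j m. {\<omega> \<in> space M. \<forall>i<m. ?X (j + i) \<omega> < ?s (j + i)}"
  have tmono: "?t i \<le> ?t j" if "i \<le> j" for i j
    by (rule lift_Suc_mono_le[OF _ that]) (use tlt less_imp_le in blast)
  have EF: "?E j m \<in> sets (F (?t (j + m)))" for j m
  proof -
    have "space (F (?t (j + m))) = space M" by (rule space_F) simp
    moreover have "{\<omega> \<in> space (F (?t (j + m))). \<forall>i\<in>{..<m}. ?X (j + i) \<omega> < ?s (j + i)} \<in> sets (F (?t (j + m)))"
    proof (rule sets.sets_Collect_finite_All)
      fix i assume i: "i \<in> {..<m}"
      have BF: "B (?t k) \<in> borel_measurable (F (?t (j + m)))" if "k \<le> j + m" for k
        by (rule F_measurable_mono[OF _ tmono[OF that] B_adapted]) simp_all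
      have "?X (j + i) \<in> borel_measurable (F (?t (j + m)))"
        by (rule borel_measurable_diff) (rule BF, use i in simp)+
      then have "(?X (j + i)) -` {..<?s (j + i)} \<inter> space (F (?t (j + m))) \<in> sets (F (?t (j + m)))"
        by (rule measurable_sets) simp
      then show "{\<omega> \<in> space (F (?t (j + m))). ?X (j + i) \<omega> < ?s (j + i)} \<in> sets (F (?t (j + m)))"
        by (simp add: vimage_def Int_def conj_commute)
    qed simp
    ultimately show ?thesis by (simp only: Ball_def lessThan_iff)
  qed
  have Eev: "?E j m \<in> events" for j m
    by (rule subsetD[OF _ EF]) (use F_sub[of "?t (j + m)"] in \<open>simp add: subalgebra_def\<close>)
  have pE: "prob (?E j m) = (1 - c) ^ m" for j m
  proof (induction m)
    case 0
    then show ?case by (simp add: prob_space)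
  next
    case (Suc m)
    let ?k = "j + m"
    have *: "{\<omega> \<in> space M. ?X ?k \<omega> < ?s ?k} = (?X ?k) -` {..<?s ?k} \<inter> space M" by auto
    have ev: "{\<omega> \<in> space M. ?X ?k \<omega> \<ge> ?s ?k} \<in> events" using Xm[of ?k] by measurable
    let ?D = "{\<omega> \<in> space M. ?X ?k \<omega> < ?s ?k}"
    have 1: "?E j (Suc m) = ?E j m \<inter> ?D"
      unfolding less_Suc_eq by blast
    have D: "?D \<in> sigma_sets (space M) {?X ?k -` A \<inter> space M | A. A \<in> sets borel}"
      by (rule sigma_sets.Basic, rule CollectI, rule exI[of _ "{..<?s ?k}"], rule conjI[OF *]) simp
    have 2: "prob (?E j m \<inter> ?D) = prob (?E j m) * prob ?D"
      by (rule indep_setD[OF increment_indep[OF _ tlt[of ?k]] EF D]) simp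
    have 3: "?D = space M - {\<omega> \<in> space M. ?X ?k \<omega> \<ge> ?s ?k}"
      unfolding not_le[symmetric] by blast
    have 4: "prob ?D = 1 - c" unfolding 3 prob_compl[OF ev] pX ..
    show ?case unfolding 1 2 4 Suc by simp
  qed
  have c: "0 < c" "c \<le> 1" using std_normal_tail_pos pX[of 0] prob_le_1 unfolding c_def by metis+
  have "AE \<omega> in M. \<forall>j. \<exists>m. \<omega> \<notin> ?E j m"
    unfolding AE_all_countable
  proof (intro allI AE_not_all_of_prob_tendsto_0 Eev)
    fix j show "(\<lambda>m. prob (?E j m)) \<longlonglongrightarrow> 0"
      unfolding pE by (rule LIMSEQ_realpow_zero) (use c in auto)
  qed
  with sublinear_growth[OF cont B0 zero_less_one] AE_space show ?thesis
  proof eventually_elim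
    case (elim \<omega>)
    from elim(1) obtain T where T: "\<And>t. T \<le> t \<Longrightarrow> \<bar>B t \<omega>\<bar> \<le> t"
      unfolding eventually_at_top_linorder by auto
    show ?case
    proof
      fix K :: nat
      define j where "j = max K (nat \<lceil>T\<rceil>)"
      obtain m where "\<omega> \<notin> ?E j m" using elim(3) by blast
      then obtain i where i: "?X (j + i) \<omega> \<ge> ?s (j + i)" using elim(2) by (auto simp: not_less)
      let ?k = "j + i"
      have kj: "real j \<le> ?t ?k" using sparse_times_ge[of ?k] by linarith
      have "T \<le> real j" unfolding j_def by linarith
      then have "\<bar>B (?t ?k) \<omega>\<bar> \<le> ?t ?k" using kj by (intro T) linarith
      then have "?t ?k \<le> B (?t (Suc ?k)) \<omega>" using i by linarith
      moreover have "real K \<le> real j" unfolding j_def by simp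
      ultimately have "real K \<le> B (?t (Suc ?k)) \<omega>" using kj by linarith
      then show "\<exists>n. real K \<le> B (real n) \<omega>" by blast
    qed
  qed
qed

text \<open>Half of the drift survives: eventually \<open>\<bar>B s\<bar> \<le> \<bar>a\<bar> s / 2\<close>, so the integrand is at most
  \<open>exp (- \<bar>l a\<bar> s / 2)\<close>.  Before that time the energy is finite by assumption.\<close>

lemma exponential_energy_finite:
  assumes cont: "AE \<omega> in M. continuous_on {0..} (\<lambda>t. B t \<omega>)" and B0: "AE \<omega> in M. B 0 \<omega> = 0"
    and la: "l * a < 0"
    and H: "\<And>s \<omega>. 0 \<le> s \<Longrightarrow> \<omega> \<in> space M \<Longrightarrow> H s \<omega> = exp (l * (a * s + B s \<omega>))"
    and JH: "jointly_measurable M H"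
    and fin: "\<And>n::nat. AE \<omega> in M. energy (\<lambda>s \<omega>. indicator {0..real n} s * H s \<omega>) \<omega> < \<infinity>"
  shows "AE \<omega> in M. energy H \<omega> < \<infinity>"
proof -
  let ?c = "\<bar>l * a\<bar>"
  have c: "0 < ?c" using la by simp
  have a0: "0 < \<bar>a\<bar> / 2" using la by auto
  have "AE \<omega> in M. \<forall>n::nat. energy (\<lambda>s \<omega>. indicator {0..real n} s * H s \<omega>) \<omega> < \<infinity>"
    unfolding AE_all_countable using fin by blast
  with sublinear_growth[OF cont B0 a0] AE_space show ?thesis
  proof eventually_elim
    case (elim \<omega>)
    from elim(1) obtain T where T: "\<And>t. T \<le> t \<Longrightarrow> \<bar>B t \<omega>\<bar> \<le> \<bar>a\<bar> / 2 * t"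
      unfolding eventually_at_top_linorder by auto
    define n where "n = nat \<lceil>T\<rceil>"
    have n: "T \<le> real n" unfolding n_def by linarith
    let ?g = "\<lambda>s (\<omega>::'a). exp (- ?c / 2 * s)"
    have "energy H \<omega> \<le> 2 * energy (\<lambda>s \<omega>. indicator {0..real n} s * H s \<omega>) \<omega> + 2 * energy ?g \<omega>"
    proof (rule energy_triangle[where M=M])
      show "jointly_measurable M (\<lambda>s \<omega>. indicator {0..real n} s * H s \<omega>)"
        by (rule jointly_measurable_restrict[OF JH]) simp
      show "jointly_measurable M ?g" by (rule jointly_measurable_time) simp
      fix s :: real assume s: "0 \<le> s"
      show "\<bar>H s \<omega>\<bar> \<le> \<bar>indicator {0..real n} s * H s \<omega>\<bar> + \<bar>?g s \<omega>\<bar>"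
      proof (cases "s \<le> real n")
        case False
        then have "\<bar>B s \<omega>\<bar> \<le> \<bar>a\<bar> / 2 * s" using n by (intro T) linarith
        then have "\<bar>l\<bar> * \<bar>B s \<omega>\<bar> \<le> \<bar>l\<bar> * (\<bar>a\<bar> / 2 * s)" by (rule mult_left_mono) simp
        moreover have "l * B s \<omega> \<le> \<bar>l\<bar> * \<bar>B s \<omega>\<bar>" by (metis abs_ge_self abs_mult)
        moreover have "\<bar>l\<bar> * (\<bar>a\<bar> / 2 * s) = ?c / 2 * s" by (simp add: abs_mult)
        ultimately have "l * B s \<omega> \<le> ?c / 2 * s" by linarith
        moreover have "l * (a * s) = - ?c * s" using la by simp
        ultimately have "l * (a * s + B s \<omega>) \<le> - ?c / 2 * s" by (simp add: algebra_simps)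
        then show ?thesis using H[OF s elim(2)] False by (simp add: indicator_def)
      qed (use s in simp)
    qed (rule elim(2))
    moreover have "energy ?g \<omega> = (\<integral>\<^sup>+ s\<in>{0..}. ennreal (exp (- ?c * s)) \<partial>lborel)"
      unfolding energy_def by (simp add: power2_eq_square mult_exp_exp mult.commute)
    moreover have "(\<integral>\<^sup>+ s\<in>{0..}. ennreal (exp (- ?c * s)) \<partial>lborel) < \<infinity>"
      by (rule nn_integral_exp_decay_finite[OF c])
    ultimately show ?case
      using elim(3)[rule_format, of n] by (auto simp: ennreal_mult_less_top elim: le_less_trans)
  qed
qed

end


section \<open>A superharmonic function on the half plane\<close>

text \<open>The function \<open>g = (1 + x\<^sup>2 + u\<^sup>2)\<^bsup>-1/2\<^esup>\<close> with \<open>u = exp (p z) / p\<close>: the Plummer potential of \<open>\<real>\<^sup>3\<close>, with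
  \<open>u\<close> the distance from the axis.  Unlike the Newton potential \<open>1 / r\<close> it is smooth and bounded, so its
  Taylor remainders can be bounded uniformly; like it, it vanishes exactly at infinity.\<close>

definition plummer :: "real \<Rightarrow> real \<Rightarrow> real \<Rightarrow> real" where
  "plummer p x z = 1 / sqrt (1 + x\<^sup>2 + (exp (p * z) / p)\<^sup>2)"

lemma plummer_pos: "0 < plummer p x z"
proof -
  have "0 < 1 + x\<^sup>2 + (exp (p * z) / p)\<^sup>2" by (intro add_pos_nonneg) auto
  then show ?thesis unfolding plummer_def by simp
qed

lemma plummer_square: "(plummer p x z)^2 * (1 + x\<^sup>2 + (exp (p * z) / p)\<^sup>2) = 1"
proof -
  have "0 < 1 + x\<^sup>2 + (exp (p * z) / p)\<^sup>2" by (intro add_pos_nonneg) auto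
  then show ?thesis unfolding plummer_def by (simp add: power_divide)
qed

lemma
  shows plummer_le_1: "plummer p x z \<le> 1"
    and plummer_x_le_1: "\<bar>x\<bar> * plummer p x z \<le> 1"
    and plummer_height_le_1: "p > 0 \<Longrightarrow> exp (p * z) / p * plummer p x z \<le> 1"
proof -
  let ?g = "plummer p x z"
  have sq: "?g^2 + (x * ?g)^2 + (exp (p * z) / p * ?g)^2 = 1"
    using plummer_square[of p x z] by (simp only: power_mult_distrib) (simp add: algebra_simps)
  note g0 = plummer_pos[of p x z, THEN less_imp_le]
  have "?g^2 \<le> 1^2" using sq zero_le_power2[of "x * ?g"] zero_le_power2[of "exp (p * z) / p * ?g"]
    unfolding one_power2 by linarith
  then show "?g \<le> 1" by (rule power2_le_imp_le) simp
  have "(\<bar>x\<bar> * ?g)^2 \<le> 1^2"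
    using sq zero_le_power2[of ?g] zero_le_power2[of "exp (p * z) / p * ?g"]
    unfolding power_mult_distrib power2_abs one_power2 by linarith
  then show "\<bar>x\<bar> * ?g \<le> 1" by (rule power2_le_imp_le) simp
  have "(exp (p * z) / p * ?g)^2 \<le> 1^2" using sq zero_le_power2[of ?g] zero_le_power2[of "x * ?g"]
    unfolding one_power2 by linarith
  then show "exp (p * z) / p * ?g \<le> 1" by (rule power2_le_imp_le) simp
qed

lemma plummer_le_exp: "p > 0 \<Longrightarrow> plummer p x z \<le> p * exp (- p * z)"
  using plummer_height_le_1[of p z x] by (simp add: exp_minus field_simps)

lemma inverse_sqrt_deriv:
  assumes f: "(f has_real_derivative f') (at t)" and pos: "0 < f t"
  shows "((\<lambda>t. 1 / sqrt (f t)) has_real_derivative - f' / 2 * (1 / sqrt (f t))^3) (at t)"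
proof -
  let ?s = "sqrt (f t)"
  have s: "?s \<noteq> 0" using pos by simp
  have 1: "((\<lambda>t. sqrt (f t)) has_real_derivative f' * (inverse ?s / 2)) (at t)"
    using DERIV_chain2[OF DERIV_real_sqrt[OF pos] f] by (simp add: mult.commute)
  have "((\<lambda>t. inverse (sqrt (f t))) has_real_derivative - (inverse ?s * (f' * (inverse ?s / 2)) * inverse ?s)) (at t)"
    by (rule DERIV_inverse'[OF 1 s])
  moreover have "- (r * (f' * (r / 2)) * r) = - f' / 2 * r^3" for r :: real
    by (simp add: power3_eq_cube)
  ultimately show ?thesis unfolding inverse_eq_divide[symmetric] by (simp only:)
qed

lemma height_sq_deriv:
  assumes "p > 0"
  shows "((\<lambda>z. (exp (p * z) / p)\<^sup>2) has_real_derivative 2 * p * (exp (p * z) / p)\<^sup>2) (at z)"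
proof -
  have "((\<lambda>z. exp (p * z) / p) has_real_derivative exp (p * z)) (at z)"
    using assms by (auto intro!: derivative_eq_intros)
  from DERIV_power[OF this, of 2] show ?thesis
    by (rule DERIV_cong) (use assms in \<open>simp add: power2_eq_square\<close>)
qed

lemma plummer_deriv_x: "((\<lambda>x. plummer p x z) has_real_derivative - x * (plummer p x z)^3) (at x)"
proof -
  have "((\<lambda>x. 1 + x\<^sup>2 + (exp (p * z) / p)\<^sup>2) has_real_derivative 2 * x) (at x)"
    by (auto intro!: derivative_eq_intros)
  moreover have "0 < 1 + x\<^sup>2 + (exp (p * z) / p)\<^sup>2" by (intro add_pos_nonneg) auto
  ultimately have "((\<lambda>x. 1 / sqrt (1 + x\<^sup>2 + (exp (p * z) / p)\<^sup>2)) has_real_derivative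
      - (2 * x) / 2 * (1 / sqrt (1 + x\<^sup>2 + (exp (p * z) / p)\<^sup>2))^3) (at x)"
    by (rule inverse_sqrt_deriv)
  then show ?thesis unfolding plummer_def by (rule DERIV_cong) simp
qed

lemma plummer_deriv_z:
  assumes p: "p > 0"
  shows "((\<lambda>z. plummer p x z) has_real_derivative - p * (exp (p * z) / p)\<^sup>2 * (plummer p x z)^3) (at z)"
proof -
  have "((\<lambda>z. 1 + x\<^sup>2 + (exp (p * z) / p)\<^sup>2) has_real_derivative 2 * p * (exp (p * z) / p)\<^sup>2) (at z)"
    using DERIV_add[OF DERIV_const height_sq_deriv[OF p], of "1 + x\<^sup>2" z] by simp
  moreover have "0 < 1 + x\<^sup>2 + (exp (p * z) / p)\<^sup>2" by (intro add_pos_nonneg) auto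
  ultimately have "((\<lambda>z. 1 / sqrt (1 + x\<^sup>2 + (exp (p * z) / p)\<^sup>2)) has_real_derivative
      - (2 * p * (exp (p * z) / p)\<^sup>2) / 2 * (1 / sqrt (1 + x\<^sup>2 + (exp (p * z) / p)\<^sup>2))^3) (at z)"
    by (rule inverse_sqrt_deriv)
  then show ?thesis unfolding plummer_def by (rule DERIV_cong) simp
qed

lemma
  assumes "(f has_real_derivative D) (at t)"
  shows deriv_square: "((\<lambda>t. (f t)^2) has_real_derivative 2 * f t * D) (at t)"
    and deriv_cube: "((\<lambda>t. (f t)^3) has_real_derivative 3 * (f t)^2 * D) (at t)"
    and deriv_pow5: "((\<lambda>t. (f t)^5) has_real_derivative 5 * (f t)^4 * D) (at t)"
  by (rule DERIV_cong[OF DERIV_power[OF assms]], simp)+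

lemma taylor3_upper:
  fixes f :: "real \<Rightarrow> real"
  assumes d1: "\<And>t. (f has_real_derivative df t) (at t)"
    and d2: "\<And>t. (df has_real_derivative ddf t) (at t)"
    and d3: "\<And>t. (ddf has_real_derivative dddf t) (at t)"
    and bd: "\<And>t. \<bar>dddf t\<bar> \<le> K"
  shows "f (a + d) \<le> f a + df a * d + ddf a * d^2 / 2 + K / 6 * \<bar>d\<bar>^3"
proof (cases "d = 0")
  case False
  define diff where "diff = (\<lambda>n::nat. if n = 0 then f else if n = 1 then df else if n = 2 then ddf else dddf)"
  have dd: "(diff m has_real_derivative diff (Suc m) t) (at t)" if "m < 3" for m t
  proof -
    consider "m = 0" | "m = 1" | "m = 2" using \<open>m < 3\<close> by linarith
    then show ?thesis by cases (use d1 d2 d3 in \<open>auto simp: diff_def\<close>)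
  qed
  have "\<exists>t. (if a + d < a then a + d < t \<and> t < a else a < t \<and> t < a + d) \<and>
      f (a + d) = (\<Sum>m<3. diff m a / fact m * (a + d - a) ^ m) + diff 3 t / fact 3 * (a + d - a) ^ 3"
    by (rule Taylor[where a="min a (a + d)" and b="max a (a + d)"])
      (use dd False in \<open>auto simp: diff_def\<close>)
  then obtain t where "f (a + d) = (\<Sum>m<3. diff m a / fact m * (a + d - a) ^ m) + diff 3 t / fact 3 * (a + d - a) ^ 3"
    by blast
  then have eq: "f (a + d) = f a + df a * d + ddf a * d^2 / 2 + dddf t / 6 * d^3"
    by (simp add: diff_def numeral_3_eq_3 fact_numeral power2_eq_square)
  have "dddf t / 6 * d^3 \<le> \<bar>dddf t / 6 * d^3\<bar>" by simp
  also have "\<dots> = \<bar>dddf t\<bar> / 6 * \<bar>d\<bar>^3" by (simp add: abs_mult power_abs)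
  also have "\<dots> \<le> K / 6 * \<bar>d\<bar>^3" by (intro mult_right_mono divide_right_mono bd) auto
  finally show ?thesis unfolding eq by linarith
qed simp

lemma abs_product_le:
  fixes a b c d :: real
  assumes "\<bar>a\<bar> \<le> c" "\<bar>b\<bar> \<le> d"
  shows "\<bar>a * b\<bar> \<le> c * d"
  unfolding abs_mult by (rule mult_mono) (use assms in auto)

lemma abs_scaled_le:
  fixes c m y K :: real
  assumes "y = c * m" "\<bar>m\<bar> \<le> K" "0 \<le> c"
  shows "\<bar>y\<bar> \<le> K * c"
  using mult_left_mono[OF assms(2,3)] assms by (simp add: abs_mult mult.commute)

text \<open>
  The second derivatives of \<open>g\<close> in \<open>z\<close> and in \<open>x\<close>.  Since \<open>\<partial>g/\<partial>x = - x g\<^sup>3\<close> and \<open>\<partial>g/\<partial>z = - p u\<^sup>2 g\<^sup>3\<close>, every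
  derivative is a polynomial in \<open>x\<close>, \<open>u\<^sup>2\<close> and \<open>g\<close>.  After each derivative in \<open>x\<close> is multiplied by the
  coefficient \<open>exp (p z) = p u\<close> of the noise, it is a polynomial in \<open>g\<close>, \<open>x g\<close> and \<open>u g\<close>, all of which
  have absolute value at most \<open>1\<close>; the constants in the bounds below are the sums of the absolute
  values of the coefficients.\<close>

definition plummer_zz :: "real \<Rightarrow> real \<Rightarrow> real \<Rightarrow> real" where
  "plummer_zz p x z = (let A = (exp (p * z) / p)\<^sup>2; g = plummer p x z in
     (- 2 * p\<^sup>2 * A * g^3 + 3 * p\<^sup>2 * A\<^sup>2 * g^5))"

definition plummer_xx :: "real \<Rightarrow> real \<Rightarrow> real \<Rightarrow> real" where
  "plummer_xx p x z = (let g = plummer p x z in (- (g^3) + 3 * x\<^sup>2 * g^5))"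

lemma unit_monomial_le:
  fixes g x u :: real
  assumes "\<bar>g\<bar> \<le> 1" "\<bar>x * g\<bar> \<le> 1" "\<bar>u * g\<bar> \<le> 1"
  shows "\<bar>g^i * (x * g)^j * (u * g)^k\<bar> \<le> 1"
proof -
  have "\<bar>g^i\<bar> \<le> 1" "\<bar>(x * g)^j\<bar> \<le> 1" "\<bar>(u * g)^k\<bar> \<le> 1"
    unfolding power_abs using assms by (simp_all add: power_le_one)
  then have "\<bar>g^i * (x * g)^j\<bar> \<le> 1 * 1" by (intro abs_product_le)
  then have "\<bar>g^i * (x * g)^j * (u * g)^k\<bar> \<le> (1 * 1) * 1" by (rule abs_product_le) fact
  then show ?thesis by simp
qed

context
  fixes p :: real
  assumes p: "p > 0"
begin

lemma plummer_unit: "\<bar>plummer p x z\<bar> \<le> 1" "\<bar>x * plummer p x z\<bar> \<le> 1"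
  "\<bar>exp (p * z) / p * plummer p x z\<bar> \<le> 1"
  using plummer_le_1[of p x z] plummer_x_le_1[of x p z] plummer_height_le_1[OF p, of z x]
    plummer_pos[of p x z] p by (auto simp: abs_mult)

lemma plummer_monomial_le:
  "\<bar>plummer p x z ^ i * (x * plummer p x z)^j * (exp (p * z) / p * plummer p x z)^k\<bar> \<le> 1"
  by (rule unit_monomial_le) (rule plummer_unit)+

lemma plummer_z_bounded: "\<bar>- p * (exp (p * z) / p)\<^sup>2 * (plummer p x z)^3\<bar> \<le> p"
proof -
  let ?g = "plummer p x z" and ?u = "exp (p * z) / p"
  have "\<bar>- p * ?u\<^sup>2 * ?g^3\<bar> = p * \<bar>?g^1 * (x * ?g)^0 * (?u * ?g)^2\<bar>"
    using p by (simp add: abs_mult power_mult_distrib power2_eq_square power3_eq_cube)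
  also have "\<dots> \<le> p * 1" by (rule mult_left_mono[OF plummer_monomial_le]) (use p in simp)
  finally show ?thesis by simp
qed

lemma plummer_zz_bounded: "\<bar>plummer_zz p x z\<bar> \<le> 5 * p\<^sup>2"
proof -
  let ?g = "plummer p x z" and ?u = "exp (p * z) / p"
  have "plummer_zz p x z = p\<^sup>2 * (- 2 * (?g^1 * (x * ?g)^0 * (?u * ?g)^2) + 3 * (?g^1 * (x * ?g)^0 * (?u * ?g)^4))"
    unfolding plummer_zz_def Let_def power_mult_distrib by algebra
  moreover have "\<bar>- 2 * (?g^1 * (x * ?g)^0 * (?u * ?g)^2) + 3 * (?g^1 * (x * ?g)^0 * (?u * ?g)^4)\<bar> \<le> 5"
    using plummer_monomial_le[of x z 1 0 2] plummer_monomial_le[of x z 1 0 4] by linarith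
  ultimately show ?thesis by (rule abs_scaled_le) simp
qed

lemma plummer_x_scaled_bounded: "\<bar>- x * (plummer p x z)^3 * exp (p * z)\<bar> \<le> p"
proof -
  let ?g = "plummer p x z" and ?u = "exp (p * z) / p"
  have "\<bar>- x * ?g^3 * exp (p * z)\<bar> = p * \<bar>?g^1 * (x * ?g)^1 * (?u * ?g)^1\<bar>"
    using p by (simp add: abs_mult power3_eq_cube)
  also have "\<dots> \<le> p * 1" by (rule mult_left_mono[OF plummer_monomial_le]) (use p in simp)
  finally show ?thesis by simp
qed

lemma plummer_xx_scaled_bounded: "\<bar>plummer_xx p x z * (exp (p * z))\<^sup>2\<bar> \<le> 4 * p\<^sup>2"
proof -
  let ?g = "plummer p x z" and ?u = "exp (p * z) / p"
  have e: "exp (p * z) = p * ?u" using p by simp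
  have "plummer_xx p x z * (exp (p * z))\<^sup>2 = p\<^sup>2 * (- (?g^1 * (x * ?g)^0 * (?u * ?g)^2) + 3 * (?g^1 * (x * ?g)^2 * (?u * ?g)^2))"
    unfolding plummer_xx_def Let_def power_mult_distrib by (subst e) algebra
  moreover have "\<bar>- (?g^1 * (x * ?g)^0 * (?u * ?g)^2) + 3 * (?g^1 * (x * ?g)^2 * (?u * ?g)^2)\<bar> \<le> 4"
    using plummer_monomial_le[of x z 1 0 2] plummer_monomial_le[of x z 1 2 2] by linarith
  ultimately show ?thesis by (rule abs_scaled_le) simp
qed

text \<open>The left-hand side equals \<open>- 3 p\<^sup>2 u\<^sup>2 g\<^sup>5\<close>, that is, \<open>p\<^sup>2 u\<^sup>2\<close> times the Laplacian \<open>- 3 g\<^sup>5\<close> of the Plummer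
  potential.\<close>

lemma plummer_superharmonic: "plummer_xx p x z * (exp (p * z))\<^sup>2 + plummer_zz p x z \<le> 0"
proof -
  let ?g = "plummer p x z" and ?u = "exp (p * z) / p"
  have e: "exp (p * z) = p * ?u" using p by simp
  have sq: "?g^2 * (1 + x\<^sup>2 + ?u\<^sup>2) = 1" by (rule plummer_square)
  have "plummer_xx p x z * (exp (p * z))\<^sup>2 + plummer_zz p x z = - 3 * p\<^sup>2 * ?u\<^sup>2 * ?g^5"
    unfolding plummer_xx_def plummer_zz_def Let_def using sq by (subst e) algebra
  moreover have "0 \<le> 3 * p\<^sup>2 * ?u\<^sup>2 * ?g^5" using plummer_pos[of p x z] by simp
  ultimately show ?thesis by linarith
qed

lemma plummer_taylor_z:
  "plummer p x (z + v) \<le> plummer p x z - p * (exp (p * z) / p)\<^sup>2 * (plummer p x z)^3 * v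
     + plummer_zz p x z * v^2 / 2 + 37 * p^3 / 6 * \<bar>v\<bar>^3"
proof -
  let ?A = "\<lambda>z. (exp (p * z) / p)\<^sup>2" and ?g = "\<lambda>z. plummer p x z"
  note D = plummer_deriv_z[OF p, of x] height_sq_deriv[OF p]
  have "?g (z + v) \<le> ?g z + (- p * ?A z * (?g z)^3) * v + (- 2 * p\<^sup>2 * ?A z * (?g z)^3 + 3 * p\<^sup>2 * (?A z)\<^sup>2 * (?g z)^5) * v^2 / 2
      + (37 * p^3) / 6 * \<bar>v\<bar>^3"
  proof (rule taylor3_upper[where dddf="\<lambda>z. - 4 * p^3 * ?A z * (?g z)^3 + 18 * p^3 * (?A z)\<^sup>2 * (?g z)^5 - 15 * p^3 * (?A z)^3 * (?g z)^7"])
    fix t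
    show "(?g has_real_derivative - p * ?A t * (?g t)^3) (at t)" by (rule D)
    have "((\<lambda>t. - p * ?A t * (?g t)^3) has_real_derivative
        (- p * (2 * p * ?A t)) * (?g t)^3 + (3 * (?g t)^2 * (- p * ?A t * (?g t)^3)) * (- p * ?A t)) (at t)"
      by (rule DERIV_mult[OF DERIV_cmult[OF D(2)] deriv_cube[OF D(1)]])
    then show "((\<lambda>t. - p * ?A t * (?g t)^3) has_real_derivative
        - 2 * p\<^sup>2 * ?A t * (?g t)^3 + 3 * p\<^sup>2 * (?A t)\<^sup>2 * (?g t)^5) (at t)"
      by (rule DERIV_cong) algebra
    have "((\<lambda>t. - 2 * p\<^sup>2 * ?A t * (?g t)^3 + 3 * p\<^sup>2 * (?A t)\<^sup>2 * (?g t)^5) has_real_derivative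
        ((- 2 * p\<^sup>2 * (2 * p * ?A t)) * (?g t)^3 + (3 * (?g t)^2 * (- p * ?A t * (?g t)^3)) * (- 2 * p\<^sup>2 * ?A t))
       + ((3 * p\<^sup>2 * (2 * ?A t * (2 * p * ?A t))) * (?g t)^5 + (5 * (?g t)^4 * (- p * ?A t * (?g t)^3)) * (3 * p\<^sup>2 * (?A t)\<^sup>2))) (at t)"
      by (intro DERIV_add DERIV_mult DERIV_cmult D deriv_cube[OF D(1)] deriv_pow5[OF D(1)]
          deriv_square[OF D(2)])
    then show "((\<lambda>t. - 2 * p\<^sup>2 * ?A t * (?g t)^3 + 3 * p\<^sup>2 * (?A t)\<^sup>2 * (?g t)^5) has_real_derivative
        - 4 * p^3 * ?A t * (?g t)^3 + 18 * p^3 * (?A t)\<^sup>2 * (?g t)^5 - 15 * p^3 * (?A t)^3 * (?g t)^7) (at t)"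
      by (rule DERIV_cong) algebra
    let ?u = "exp (p * t) / p" and ?h = "?g t"
    have "- 4 * p^3 * ?A t * (?g t)^3 + 18 * p^3 * (?A t)\<^sup>2 * (?g t)^5 - 15 * p^3 * (?A t)^3 * (?g t)^7
      = p^3 * (- 4 * (?h^1 * (x * ?h)^0 * (?u * ?h)^2) + 18 * (?h^1 * (x * ?h)^0 * (?u * ?h)^4) - 15 * (?h^1 * (x * ?h)^0 * (?u * ?h)^6))"
      by algebra
    moreover have "\<bar>- 4 * (?h^1 * (x * ?h)^0 * (?u * ?h)^2) + 18 * (?h^1 * (x * ?h)^0 * (?u * ?h)^4) - 15 * (?h^1 * (x * ?h)^0 * (?u * ?h)^6)\<bar> \<le> 37"
      using plummer_monomial_le[of x t 1 0 2] plummer_monomial_le[of x t 1 0 4] plummer_monomial_le[of x t 1 0 6]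
      by linarith
    ultimately show "\<bar>- 4 * p^3 * ?A t * (?g t)^3 + 18 * p^3 * (?A t)\<^sup>2 * (?g t)^5 - 15 * p^3 * (?A t)^3 * (?g t)^7\<bar> \<le> 37 * p^3"
      by (rule abs_scaled_le) (use p in simp)
  qed
  then show ?thesis unfolding plummer_zz_def Let_def by simp
qed

lemma plummer_deriv_xx: "((\<lambda>x. - x * (plummer p x z)^3) has_real_derivative plummer_xx p x z) (at x)"
proof -
  note D = plummer_deriv_x[of p z]
  have "((\<lambda>x. - x * (plummer p x z)^3) has_real_derivative
      (- 1) * (plummer p x z)^3 + (3 * (plummer p x z)^2 * (- x * (plummer p x z)^3)) * (- x)) (at x)"
    by (rule DERIV_mult[OF DERIV_minus[OF DERIV_ident] deriv_cube[OF D]])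
  then show ?thesis unfolding plummer_xx_def Let_def by (rule DERIV_cong) algebra
qed

lemma plummer_taylor_x:
  "plummer p (x + exp (p * z) * b) z \<le> plummer p x z - x * (plummer p x z)^3 * exp (p * z) * b
     + plummer_xx p x z * (exp (p * z))\<^sup>2 * b^2 / 2 + 4 * p^3 * \<bar>b\<bar>^3"
proof -
  let ?g = "\<lambda>x. plummer p x z" and ?c = "exp (p * z)"
  note D = plummer_deriv_x[of p z]
  have "?g (x + ?c * b) \<le> ?g x + (- x * (?g x)^3) * (?c * b) + plummer_xx p x z * (?c * b)^2 / 2
      + (24 * p^3 / ?c^3) / 6 * \<bar>?c * b\<bar>^3"
  proof (rule taylor3_upper[where dddf="\<lambda>x. 9 * x * (?g x)^5 - 15 * x^3 * (?g x)^7"])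
    fix t
    show "(?g has_real_derivative - t * (?g t)^3) (at t)" by (rule D)
    show "((\<lambda>x. - x * (?g x)^3) has_real_derivative plummer_xx p t z) (at t)" by (rule plummer_deriv_xx)
    have "((\<lambda>x. - ((?g x)^3) + 3 * x\<^sup>2 * (?g x)^5) has_real_derivative
       - (3 * (?g t)^2 * (- t * (?g t)^3)) + ((3 * (2 * t)) * (?g t)^5 + (5 * (?g t)^4 * (- t * (?g t)^3)) * (3 * t\<^sup>2))) (at t)"
      by (intro DERIV_add DERIV_minus DERIV_mult DERIV_cmult deriv_cube[OF D]
          deriv_pow5[OF D] deriv_square[OF DERIV_ident, simplified])
    then show "((\<lambda>x. plummer_xx p x z) has_real_derivative 9 * t * (?g t)^5 - 15 * t^3 * (?g t)^7) (at t)"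
      unfolding plummer_xx_def Let_def by (rule DERIV_cong) algebra
    let ?u = "?c / p" and ?h = "?g t"
    have e: "?c = p * ?u" using p by simp
    have "(9 * t * ?h^5 - 15 * t^3 * ?h^7) * ?c^3
      = p^3 * (9 * (?h^1 * (t * ?h)^1 * (?u * ?h)^3) - 15 * (?h^1 * (t * ?h)^3 * (?u * ?h)^3))"
      by (subst e) algebra
    moreover have "\<bar>9 * (?h^1 * (t * ?h)^1 * (?u * ?h)^3) - 15 * (?h^1 * (t * ?h)^3 * (?u * ?h)^3)\<bar> \<le> 24"
      using plummer_monomial_le[of t z 1 1 3] plummer_monomial_le[of t z 1 3 3] by linarith
    ultimately have "\<bar>(9 * t * ?h^5 - 15 * t^3 * ?h^7) * ?c^3\<bar> \<le> 24 * p^3"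
      by (rule abs_scaled_le) (use p in simp)
    then show "\<bar>9 * t * ?h^5 - 15 * t^3 * ?h^7\<bar> \<le> 24 * p^3 / ?c^3"
      by (simp add: abs_mult pos_le_divide_eq)
  qed
  also have "(24 * p^3 / ?c^3) / 6 * \<bar>?c * b\<bar>^3 = 4 * p^3 * \<bar>b\<bar>^3"
    by (simp add: abs_mult power_mult_distrib)
  also have "(?c * b)^2 = ?c^2 * b^2" by (rule power_mult_distrib)
  finally show ?thesis by (simp add: algebra_simps)
qed

lemma plummer_zz_lipschitz:
  "plummer_zz p (x + exp (p * z) * b) z \<le> plummer_zz p x z + 21 * p^3 * \<bar>b\<bar>"
proof -
  let ?g = "\<lambda>x. plummer p x z" and ?c = "exp (p * z)" and ?A = "(exp (p * z) / p)\<^sup>2"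
  note D = plummer_deriv_x[of p z]
  have "norm (plummer_zz p (x + ?c * b) z - plummer_zz p x z) \<le> (21 * p^3 / ?c) * norm (x + ?c * b - x)"
  proof (rule field_differentiable_bound[where S=UNIV])
    fix t :: real
    have "((\<lambda>x. - 2 * p\<^sup>2 * ?A * (?g x)^3 + 3 * p\<^sup>2 * ?A\<^sup>2 * (?g x)^5) has_real_derivative
       (- 2 * p\<^sup>2 * ?A) * (3 * (?g t)^2 * (- t * (?g t)^3)) + (3 * p\<^sup>2 * ?A\<^sup>2) * (5 * (?g t)^4 * (- t * (?g t)^3))) (at t)"
      by (intro DERIV_add DERIV_cmult deriv_cube[OF D] deriv_pow5[OF D])
    then have "((\<lambda>x. plummer_zz p x z) has_real_derivative 6 * p\<^sup>2 * ?A * t * (?g t)^5 - 15 * p\<^sup>2 * ?A\<^sup>2 * t * (?g t)^7) (at t)"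
      unfolding plummer_zz_def Let_def by (rule DERIV_cong) algebra
    then show "((\<lambda>x. plummer_zz p x z) has_field_derivative 6 * p\<^sup>2 * ?A * t * (?g t)^5 - 15 * p\<^sup>2 * ?A\<^sup>2 * t * (?g t)^7) (at t within UNIV)"
      by simp
    let ?u = "?c / p" and ?h = "?g t"
    have e: "p * ?u = ?c" using p by simp
    have "(6 * p\<^sup>2 * ?A * t * ?h^5 - 15 * p\<^sup>2 * ?A\<^sup>2 * t * ?h^7) * (p * ?u)
      = p^3 * (6 * (?h^1 * (t * ?h)^1 * (?u * ?h)^3) - 15 * (?h^1 * (t * ?h)^1 * (?u * ?h)^5))"
      by algebra
    note this[unfolded e]
    moreover have "\<bar>6 * (?h^1 * (t * ?h)^1 * (?u * ?h)^3) - 15 * (?h^1 * (t * ?h)^1 * (?u * ?h)^5)\<bar> \<le> 21"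
      using plummer_monomial_le[of t z 1 1 3] plummer_monomial_le[of t z 1 1 5] by linarith
    ultimately have "\<bar>(6 * p\<^sup>2 * ?A * t * ?h^5 - 15 * p\<^sup>2 * ?A\<^sup>2 * t * ?h^7) * ?c\<bar> \<le> 21 * p^3"
      by (rule abs_scaled_le) (use p in simp)
    then show "norm (6 * p\<^sup>2 * ?A * t * ?h^5 - 15 * p\<^sup>2 * ?A\<^sup>2 * t * ?h^7) \<le> 21 * p^3 / ?c"
      by (simp add: abs_mult pos_le_divide_eq)
  qed auto
  also have "(21 * p^3 / ?c) * norm (x + ?c * b - x) = 21 * p^3 * \<bar>b\<bar>" by (simp add: abs_mult)
  finally show ?thesis by simp
qed

lemma plummer_lipschitz: "\<bar>plummer p x z - plummer p y z\<bar> \<le> \<bar>x - y\<bar>"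
proof -
  have "norm (plummer p x z - plummer p y z) \<le> 1 * norm (x - y)"
  proof (rule field_differentiable_bound[where S=UNIV])
    fix t :: real
    show "((\<lambda>x. plummer p x z) has_field_derivative - t * (plummer p t z)^3) (at t within UNIV)"
      using plummer_deriv_x[of p z t] by simp
    have "\<bar>plummer p t z ^ 2 * (t * plummer p t z)^1 * (exp (p * z) / p * plummer p t z)^0\<bar> \<le> 1"
      by (rule plummer_monomial_le)
    then show "norm (- t * (plummer p t z)^3) \<le> 1"
      by (simp add: power2_eq_square power3_eq_cube mult_ac)
  qed auto
  then show ?thesis by simp
qed

end

lemma continuous_plummer: "continuous_on UNIV (\<lambda>(x, z). plummer p x z)"
proof -
  have "1 + (fst v)\<^sup>2 + (exp (p * snd v) / p)\<^sup>2 \<noteq> 0" for v :: "real \<times> real"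
    by (smt (verit) zero_le_power2)
  then show ?thesis unfolding plummer_def case_prod_beta' divide_inverse
    by (intro continuous_intros) auto
qed

lemma borel_measurable_plummer[measurable (raw)]:
  assumes "f \<in> borel_measurable N" "g \<in> borel_measurable N"
  shows "(\<lambda>\<omega>. plummer p (f \<omega>) (g \<omega>)) \<in> borel_measurable N"
  unfolding plummer_def using assms by measurable


section \<open>One step of the Euler scheme\<close>

text \<open>These two bounds reduce odd absolute moments to even moments; the parameter \<open>r\<close> is later chosen as
  the standard deviation, which gives the correct order in \<open>h\<close>.\<close>

lemma abs_cube_le:
  fixes y r :: real
  assumes "0 < r"
  shows "\<bar>y\<bar>^3 \<le> (r * y^2 + y^4 / r) / 2"
proof -
  have "0 \<le> y^2 * (r - \<bar>y\<bar>)^2" by simp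
  also have "\<dots> = y^2 * (r^2 - 2 * r * \<bar>y\<bar> + \<bar>y\<bar>^2)" by (simp add: power2_diff mult_ac)
  also have "\<dots> = r^2 * y^2 + y^4 - 2 * r * \<bar>y\<bar>^3"
    by (simp add: power2_eq_square power3_eq_cube power4_eq_xxxx algebra_simps)
  finally show ?thesis using assms by (simp add: field_simps power2_eq_square)
qed

lemma abs_le_quadratic:
  fixes y r :: real
  assumes "0 < r"
  shows "\<bar>y\<bar> \<le> (r + y^2 / r) / 2"
proof -
  have "0 \<le> (r - \<bar>y\<bar>)^2" by simp
  then have "2 * r * \<bar>y\<bar> \<le> r^2 + y^2" by (simp add: power2_diff)
  then show ?thesis using assms by (simp add: field_simps power2_eq_square)
qed

context ito_integrator
begin

lemma
  assumes st: "0 \<le> s" "s < t"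
  shows integrable_increment_abs: "integrable M (\<lambda>\<omega>. \<bar>B t \<omega> - B s \<omega>\<bar>)"
    and integral_increment_abs_le: "(\<integral>\<omega>. \<bar>B t \<omega> - B s \<omega>\<bar> \<partial>M) \<le> sqrt (t - s)"
    and integrable_increment_abs3: "integrable M (\<lambda>\<omega>. \<bar>B t \<omega> - B s \<omega>\<bar>^3)"
    and integral_increment_abs3_le: "(\<integral>\<omega>. \<bar>B t \<omega> - B s \<omega>\<bar>^3 \<partial>M) \<le> 2 * ((t - s) * sqrt (t - s))"
proof -
  let ?D = "\<lambda>\<omega>. B t \<omega> - B s \<omega>" and ?r = "sqrt (t - s)"
  have r: "0 < ?r" using st by simp
  have rr: "?r * ?r = t - s" using st by simp
  have m: "?D \<in> borel_measurable M" using B_measurable st by (intro borel_measurable_diff) auto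
  have i1: "integrable M (\<lambda>\<omega>. (?r + (?D \<omega>)^2 / ?r) / 2)"
    using integrable_increment2[OF st] by simp
  have i3: "integrable M (\<lambda>\<omega>. (?r * (?D \<omega>)^2 + (?D \<omega>)^4 / ?r) / 2)"
    using integrable_increment2[OF st] integrable_increment4[OF st] by simp
  show 1: "integrable M (\<lambda>\<omega>. \<bar>?D \<omega>\<bar>)" using integrable_increment[OF st] by simp
  show 3: "integrable M (\<lambda>\<omega>. \<bar>?D \<omega>\<bar>^3)"
  proof (rule Bochner_Integration.integrable_bound[OF i3])
    show "(\<lambda>\<omega>. \<bar>?D \<omega>\<bar>^3) \<in> borel_measurable M" using m by simp
    show "AE \<omega> in M. norm (\<bar>?D \<omega>\<bar>^3) \<le> norm ((?r * (?D \<omega>)^2 + (?D \<omega>)^4 / ?r) / 2)"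
    proof (rule AE_I2)
      fix \<omega>
      show "norm (\<bar>?D \<omega>\<bar>^3) \<le> norm ((?r * (?D \<omega>)^2 + (?D \<omega>)^4 / ?r) / 2)"
        using abs_cube_le[OF r, of "?D \<omega>"] unfolding real_norm_def by (simp add: order_trans[OF _ abs_ge_self])
    qed
  qed
  have "(\<integral>\<omega>. \<bar>?D \<omega>\<bar> \<partial>M) \<le> (\<integral>\<omega>. (?r + (?D \<omega>)^2 / ?r) / 2 \<partial>M)"
    by (rule integral_mono[OF 1 i1]) (rule abs_le_quadratic[OF r])
  also have "\<dots> = (?r + (t - s) / ?r) / 2"
    using integrable_increment2[OF st] integral_increment2[OF st] by (simp add: prob_space)
  also have "\<dots> = ?r" using r rr by (simp add: field_simps)
  finally show "(\<integral>\<omega>. \<bar>?D \<omega>\<bar> \<partial>M) \<le> ?r" .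
  have "(\<integral>\<omega>. \<bar>?D \<omega>\<bar>^3 \<partial>M) \<le> (\<integral>\<omega>. (?r * (?D \<omega>)^2 + (?D \<omega>)^4 / ?r) / 2 \<partial>M)"
    by (rule integral_mono[OF 3 i3]) (rule abs_cube_le[OF r])
  also have "\<dots> = (?r * (t - s) + 3 * (t - s)^2 / ?r) / 2"
    using integrable_increment2[OF st] integral_increment2[OF st]
      integrable_increment4[OF st] integral_increment4[OF st] by simp
  also have "(t - s)^2 / ?r = (t - s) * ?r"
    using r rr by (simp add: power2_eq_square field_simps)
  then have "(?r * (t - s) + 3 * (t - s)^2 / ?r) / 2 = 2 * ((t - s) * ?r)" by simp
  finally show "(\<integral>\<omega>. \<bar>?D \<omega>\<bar>^3 \<partial>M) \<le> 2 * ((t - s) * ?r)" .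
qed

lemma
  assumes st: "0 \<le> s" "s < t" and \<phi>: "\<phi> \<in> borel_measurable (F s)"
    and bd: "\<And>\<omega>. \<omega> \<in> space M \<Longrightarrow> \<bar>\<phi> \<omega>\<bar> \<le> (K::real)"
  shows integrable_bounded_adapted: "integrable M \<phi>"
    and integrable_bounded_increment: "integrable M (\<lambda>\<omega>. \<phi> \<omega> * (B t \<omega> - B s \<omega>))"
    and integral_bounded_increment: "(\<integral>\<omega>. \<phi> \<omega> * (B t \<omega> - B s \<omega>) \<partial>M) = 0"
    and integrable_bounded_increment2: "integrable M (\<lambda>\<omega>. \<phi> \<omega> * (B t \<omega> - B s \<omega>)^2)"
    and integral_bounded_increment2: "(\<integral>\<omega>. \<phi> \<omega> * (B t \<omega> - B s \<omega>)^2 \<partial>M) = (t - s) * (\<integral>\<omega>. \<phi> \<omega> \<partial>M)"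
proof -
  show i: "integrable M \<phi>"
    by (rule integrable_const_bound[of _ K]) (use bd F_measurable_M[OF st(1) \<phi>] in auto)
  have id: "(\<lambda>x::real. x) \<in> borel_measurable borel" and sq: "(\<lambda>x::real. x^2) \<in> borel_measurable borel" by simp_all
  show "integrable M (\<lambda>\<omega>. \<phi> \<omega> * (B t \<omega> - B s \<omega>))"
    by (rule integrable_mult_increment[OF st \<phi> i id integrable_increment[OF st]])
  show "(\<integral>\<omega>. \<phi> \<omega> * (B t \<omega> - B s \<omega>) \<partial>M) = 0"
    using integral_mult_increment[OF st \<phi> i id integrable_increment[OF st]] integral_increment[OF st] by simp
  show "integrable M (\<lambda>\<omega>. \<phi> \<omega> * (B t \<omega> - B s \<omega>)^2)"
    by (rule integrable_mult_increment[OF st \<phi> i sq integrable_increment2[OF st]])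
  show "(\<integral>\<omega>. \<phi> \<omega> * (B t \<omega> - B s \<omega>)^2 \<partial>M) = (t - s) * (\<integral>\<omega>. \<phi> \<omega> \<partial>M)"
    using integral_mult_increment[OF st \<phi> i sq integrable_increment2[OF st]] integral_increment2[OF st] by simp
qed

end

text \<open>\<open>B\<close> drives the horizontal and \<open>V\<close> the vertical coordinate.  Both are adapted to \<open>F\<close>, while the increments
  of \<open>V\<close> are independent of the larger \<open>\<sigma>\<close>-algebras \<open>G\<close>, which contain the entire path of \<open>B\<close>.\<close>

locale independent_drivers = ito_integrator M F B + V: ito_integrator M G V
  for M :: "'a measure" and F B G V +
  assumes F_le_G: "0 \<le> s \<Longrightarrow> subalgebra (G s) (F s)"
    and V_adapted_F: "0 \<le> t \<Longrightarrow> V t \<in> borel_measurable (F t)"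
    and B_measurable_G: "0 \<le> r \<Longrightarrow> 0 \<le> s \<Longrightarrow> B r \<in> borel_measurable (G s)"
begin

lemma V_measurable: "0 \<le> t \<Longrightarrow> V t \<in> borel_measurable M"
  by (rule V.B_measurable)

text \<open>One step of the Euler scheme, restricted to an event \<open>E\<close> of the past.  First the increment of \<open>V\<close> is
  averaged with the new horizontal position held fixed, then the increment of \<open>B\<close>.  First-order terms
  vanish, the second-order terms add up to a nonpositive quantity by superharmonicity, and the
  remainders contribute \<open>37/6 \<cdot> 2 + 4 \<cdot> 2 + 21/2 < 31\<close> times \<open>p\<^sup>3 h\<^bsup>3/2\<^esup>\<close>.\<close>

lemma plummer_step:
  assumes p: "p > 0" and st: "0 \<le> s" "s < t" and x: "x \<in> borel_measurable (F s)" and E: "E \<in> sets (F s)"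
  shows "(\<integral>\<omega>. indicator E \<omega> * plummer p (x \<omega> + exp (p * V s \<omega>) * (B t \<omega> - B s \<omega>)) (V t \<omega>) \<partial>M)
    \<le> (\<integral>\<omega>. indicator E \<omega> * plummer p (x \<omega>) (V s \<omega>) \<partial>M) + 31 * p^3 * ((t - s) * sqrt (t - s))"
proof -
  define h where "h = t - s"
  have h: "0 < h" using st by (simp add: h_def)
  let ?b = "\<lambda>\<omega>. B t \<omega> - B s \<omega>" and ?v = "\<lambda>\<omega>. V t \<omega> - V s \<omega>" and ?z = "V s"
  let ?i = "\<lambda>\<omega>. indicator E \<omega> :: real"
  let ?y = "\<lambda>\<omega>. x \<omega> + exp (p * ?z \<omega>) * ?b \<omega>"
  let ?A = "\<lambda>\<omega>. (exp (p * ?z \<omega>) / p)\<^sup>2"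
  have i01: "0 \<le> ?i \<omega>" "?i \<omega> \<le> 1" for \<omega> by (auto simp: indicator_def)
  have iF: "?i \<in> borel_measurable (F s)" using E by simp
  have zF: "?z \<in> borel_measurable (F s)" by (rule V_adapted_F[OF st(1)])
  have FG: "f \<in> borel_measurable (F s) \<Longrightarrow> f \<in> borel_measurable (G s)" for f :: "'a \<Rightarrow> real"
    using measurable_from_subalg[OF F_le_G[OF st(1)]] .
  have bG: "?b \<in> borel_measurable (G s)" using B_measurable_G st by (intro borel_measurable_diff) auto
  note [measurable] = FG[OF iF] FG[OF zF] FG[OF x] bG
  have yG[measurable]: "?y \<in> borel_measurable (G s)" by measurable
  have zzm: "(\<lambda>\<omega>. plummer_zz p (f \<omega>) (g \<omega>)) \<in> borel_measurable N"
    if [measurable]: "f \<in> borel_measurable N" "g \<in> borel_measurable N" for f g and N :: "'a measure"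
    unfolding plummer_zz_def Let_def by measurable
  have xxm: "(\<lambda>\<omega>. plummer_xx p (f \<omega>) (g \<omega>)) \<in> borel_measurable N"
    if [measurable]: "f \<in> borel_measurable N" "g \<in> borel_measurable N" for f g and N :: "'a measure"
    unfolding plummer_xx_def Let_def by measurable
  have ibd: "\<bar>?i \<omega> * c\<bar> \<le> K" if "\<bar>c\<bar> \<le> K" for c K \<omega>
    using that abs_product_le[of "?i \<omega>" 1 c K] i01[of \<omega>] by simp
  \<comment> \<open>\<open>?\<phi>1\<close>, \<open>?\<phi>2\<close> and \<open>?gy\<close> involve the increment of \<open>B\<close> and are only \<open>G s\<close>-measurable; the others are \<open>F s\<close>-measurable\<close>
  let ?\<phi>1 = "\<lambda>\<omega>. ?i \<omega> * (- p * ?A \<omega> * (plummer p (?y \<omega>) (?z \<omega>))^3)"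
  let ?\<phi>2 = "\<lambda>\<omega>. ?i \<omega> * plummer_zz p (?y \<omega>) (?z \<omega>)"
  let ?\<psi>1 = "\<lambda>\<omega>. ?i \<omega> * (- x \<omega> * (plummer p (x \<omega>) (?z \<omega>))^3 * exp (p * ?z \<omega>))"
  let ?\<psi>2 = "\<lambda>\<omega>. ?i \<omega> * (plummer_xx p (x \<omega>) (?z \<omega>) * (exp (p * ?z \<omega>))\<^sup>2)"
  let ?\<chi> = "\<lambda>\<omega>. ?i \<omega> * plummer_zz p (x \<omega>) (?z \<omega>)"
  let ?gy = "\<lambda>\<omega>. ?i \<omega> * plummer p (?y \<omega>) (?z \<omega>)"
  let ?gx = "\<lambda>\<omega>. ?i \<omega> * plummer p (x \<omega>) (?z \<omega>)"
  let ?g' = "\<lambda>\<omega>. ?i \<omega> * plummer p (?y \<omega>) (V t \<omega>)"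
  have \<phi>1: "?\<phi>1 \<in> borel_measurable (G s)" "\<And>\<omega>. \<bar>?\<phi>1 \<omega>\<bar> \<le> p"
    by measurable (rule ibd[OF plummer_z_bounded[OF p]])
  have \<phi>2: "?\<phi>2 \<in> borel_measurable (G s)" "\<And>\<omega>. \<bar>?\<phi>2 \<omega>\<bar> \<le> 5 * p\<^sup>2"
    by (intro borel_measurable_times zzm) (measurable, rule ibd[OF plummer_zz_bounded[OF p]])
  have gy: "?gy \<in> borel_measurable (G s)" "\<And>\<omega>. \<bar>?gy \<omega>\<bar> \<le> 1"
    by measurable (rule ibd[OF plummer_unit(1)[OF p]])
  note mF = iF zF x
  have \<psi>1: "?\<psi>1 \<in> borel_measurable (F s)" "\<And>\<omega>. \<bar>?\<psi>1 \<omega>\<bar> \<le> p"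
    using mF by (measurable, intro ibd[OF plummer_x_scaled_bounded[OF p]])
  have \<psi>2: "?\<psi>2 \<in> borel_measurable (F s)" "\<And>\<omega>. \<bar>?\<psi>2 \<omega>\<bar> \<le> 4 * p\<^sup>2"
    using mF xxm[OF x zF] by (measurable, intro ibd[OF plummer_xx_scaled_bounded[OF p]])
  have \<chi>: "?\<chi> \<in> borel_measurable (F s)" "\<And>\<omega>. \<bar>?\<chi> \<omega>\<bar> \<le> 5 * p\<^sup>2"
    using mF zzm[OF x zF] by (measurable, intro ibd[OF plummer_zz_bounded[OF p]])
  have gx: "?gx \<in> borel_measurable (F s)" "\<And>\<omega>. \<bar>?gx \<omega>\<bar> \<le> 1"
    using mF by (measurable, intro ibd[OF plummer_unit(1)[OF p]])
  note I\<phi>1 = V.integrable_bounded_increment[OF st \<phi>1] V.integral_bounded_increment[OF st \<phi>1]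
  note I\<phi>2 = V.integrable_bounded_increment2[OF st \<phi>2] V.integral_bounded_increment2[OF st \<phi>2]
    V.integrable_bounded_adapted[OF st \<phi>2]
  note Igy = V.integrable_bounded_adapted[OF st gy]
  note I\<psi>1 = integrable_bounded_increment[OF st \<psi>1] integral_bounded_increment[OF st \<psi>1]
  note I\<psi>2 = integrable_bounded_increment2[OF st \<psi>2] integral_bounded_increment2[OF st \<psi>2]
    integrable_bounded_adapted[OF st \<psi>2]
  note I\<chi> = integrable_bounded_adapted[OF st \<chi>]
  note Igx = integrable_bounded_adapted[OF st gx]
  note Iv3 = V.integrable_increment_abs3[OF st]
  note Ib3 = integrable_increment_abs3[OF st]
  note Ib1 = integrable_increment_abs[OF st]
  have Ig': "integrable M ?g'"
  proof (rule integrable_const_bound[of _ 1])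
    show "AE \<omega> in M. norm (?g' \<omega>) \<le> 1" using ibd[OF plummer_unit(1)[OF p]] by simp
    have [measurable]: "?i \<in> borel_measurable M" "?y \<in> borel_measurable M" "V t \<in> borel_measurable M"
      using F_measurable_M[OF st(1) iF] V.F_measurable_M[OF st(1) yG] V_measurable[of t] st by auto
    show "?g' \<in> borel_measurable M" by measurable
  qed
  \<comment> \<open>averaging the increment of \<open>V\<close>\<close>
  have le1: "?g' \<omega> \<le> ?gy \<omega> + ?\<phi>1 \<omega> * ?v \<omega> + ?\<phi>2 \<omega> * (?v \<omega>)^2 / 2 + 37 * p^3 / 6 * \<bar>?v \<omega>\<bar>^3" for \<omega>
  proof -
    have "plummer p (?y \<omega>) (?z \<omega> + ?v \<omega>) \<le> plummer p (?y \<omega>) (?z \<omega>)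
       - p * ?A \<omega> * (plummer p (?y \<omega>) (?z \<omega>))^3 * ?v \<omega> + plummer_zz p (?y \<omega>) (?z \<omega>) * (?v \<omega>)^2 / 2 + 37 * p^3 / 6 * \<bar>?v \<omega>\<bar>^3"
      by (rule plummer_taylor_z[OF p])
    moreover have "0 \<le> 37 * p^3 / 6 * \<bar>?v \<omega>\<bar>^3" using p by simp
    ultimately show ?thesis by (auto simp: indicator_def)
  qed
  have "(\<integral>\<omega>. ?g' \<omega> \<partial>M) \<le> (\<integral>\<omega>. ?gy \<omega> + ?\<phi>1 \<omega> * ?v \<omega> + ?\<phi>2 \<omega> * (?v \<omega>)^2 / 2 + 37 * p^3 / 6 * \<bar>?v \<omega>\<bar>^3 \<partial>M)"
    by (rule integral_mono[OF Ig' _ le1]) (use Igy I\<phi>1(1) I\<phi>2(1) Iv3 in simp)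
  also have "\<dots> = (\<integral>\<omega>. ?gy \<omega> \<partial>M) + 0 + (h * (\<integral>\<omega>. ?\<phi>2 \<omega> \<partial>M)) / 2 + 37 * p^3 / 6 * (\<integral>\<omega>. \<bar>?v \<omega>\<bar>^3 \<partial>M)"
    using Igy I\<phi>1 I\<phi>2 Iv3 by (simp add: h_def)
  finally have S1: "(\<integral>\<omega>. ?g' \<omega> \<partial>M) \<le> (\<integral>\<omega>. ?gy \<omega> \<partial>M) + h / 2 * (\<integral>\<omega>. ?\<phi>2 \<omega> \<partial>M) + 37 * p^3 / 6 * (\<integral>\<omega>. \<bar>?v \<omega>\<bar>^3 \<partial>M)"
    by simp
  \<comment> \<open>averaging the increment of \<open>B\<close>; the second derivative in \<open>z\<close> is first moved back to the old position\<close>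
  have le2: "?\<phi>2 \<omega> \<le> ?\<chi> \<omega> + 21 * p^3 * \<bar>?b \<omega>\<bar>" for \<omega>
    using plummer_zz_lipschitz[OF p, of "x \<omega>" "?z \<omega>" "?b \<omega>"] p by (auto simp: indicator_def)
  have "(\<integral>\<omega>. ?\<phi>2 \<omega> \<partial>M) \<le> (\<integral>\<omega>. ?\<chi> \<omega> + 21 * p^3 * \<bar>?b \<omega>\<bar> \<partial>M)"
    by (rule integral_mono[OF I\<phi>2(3) _ le2]) (use I\<chi> Ib1 in simp)
  also have "\<dots> = (\<integral>\<omega>. ?\<chi> \<omega> \<partial>M) + 21 * p^3 * (\<integral>\<omega>. \<bar>?b \<omega>\<bar> \<partial>M)" using I\<chi> Ib1 by simp
  finally have S2: "(\<integral>\<omega>. ?\<phi>2 \<omega> \<partial>M) \<le> (\<integral>\<omega>. ?\<chi> \<omega> \<partial>M) + 21 * p^3 * (\<integral>\<omega>. \<bar>?b \<omega>\<bar> \<partial>M)" .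
  have le3: "?gy \<omega> \<le> ?gx \<omega> + ?\<psi>1 \<omega> * ?b \<omega> + ?\<psi>2 \<omega> * (?b \<omega>)^2 / 2 + 4 * p^3 * \<bar>?b \<omega>\<bar>^3" for \<omega>
    using plummer_taylor_x[OF p, of "x \<omega>" "?z \<omega>" "?b \<omega>"] p by (auto simp: indicator_def)
  have "(\<integral>\<omega>. ?gy \<omega> \<partial>M) \<le> (\<integral>\<omega>. ?gx \<omega> + ?\<psi>1 \<omega> * ?b \<omega> + ?\<psi>2 \<omega> * (?b \<omega>)^2 / 2 + 4 * p^3 * \<bar>?b \<omega>\<bar>^3 \<partial>M)"
    by (rule integral_mono[OF Igy _ le3]) (use Igx I\<psi>1(1) I\<psi>2(1) Ib3 in simp)
  also have "\<dots> = (\<integral>\<omega>. ?gx \<omega> \<partial>M) + 0 + (h * (\<integral>\<omega>. ?\<psi>2 \<omega> \<partial>M)) / 2 + 4 * p^3 * (\<integral>\<omega>. \<bar>?b \<omega>\<bar>^3 \<partial>M)"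
    using Igx I\<psi>1 I\<psi>2 Ib3 by (simp add: h_def)
  finally have S3: "(\<integral>\<omega>. ?gy \<omega> \<partial>M) \<le> (\<integral>\<omega>. ?gx \<omega> \<partial>M) + h / 2 * (\<integral>\<omega>. ?\<psi>2 \<omega> \<partial>M) + 4 * p^3 * (\<integral>\<omega>. \<bar>?b \<omega>\<bar>^3 \<partial>M)"
    by simp
  have "(\<integral>\<omega>. ?\<psi>2 \<omega> + ?\<chi> \<omega> \<partial>M) \<le> (\<integral>\<omega>. 0 \<partial>M)"
  proof (rule integral_mono)
    show "?\<psi>2 \<omega> + ?\<chi> \<omega> \<le> 0" for \<omega>
      using plummer_superharmonic[OF p, of "x \<omega>" "?z \<omega>"] by (auto simp: indicator_def)
  qed (use I\<psi>2(3) I\<chi> in auto)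
  then have S4: "(\<integral>\<omega>. ?\<psi>2 \<omega> \<partial>M) + (\<integral>\<omega>. ?\<chi> \<omega> \<partial>M) \<le> 0" using I\<psi>2(3) I\<chi> by simp
  let ?q = "h * sqrt h"
  have p3: "0 \<le> p^3" using p by simp
  have T1: "37 * p^3 / 6 * (\<integral>\<omega>. \<bar>?v \<omega>\<bar>^3 \<partial>M) \<le> 37 * p^3 / 6 * (2 * ?q)"
    by (rule mult_left_mono) (use V.integral_increment_abs3_le[OF st] p3 in \<open>auto simp: h_def\<close>)
  have T2: "4 * p^3 * (\<integral>\<omega>. \<bar>?b \<omega>\<bar>^3 \<partial>M) \<le> 4 * p^3 * (2 * ?q)"
    by (rule mult_left_mono) (use integral_increment_abs3_le[OF st] p3 in \<open>auto simp: h_def\<close>)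
  have "21 * p^3 * (\<integral>\<omega>. \<bar>?b \<omega>\<bar> \<partial>M) \<le> 21 * p^3 * sqrt h"
    by (rule mult_left_mono) (use integral_increment_abs_le[OF st] p3 in \<open>auto simp: h_def\<close>)
  then have "(\<integral>\<omega>. ?\<phi>2 \<omega> \<partial>M) + (\<integral>\<omega>. ?\<psi>2 \<omega> \<partial>M) \<le> 21 * p^3 * sqrt h" using S2 S4 by linarith
  then have "h / 2 * ((\<integral>\<omega>. ?\<phi>2 \<omega> \<partial>M) + (\<integral>\<omega>. ?\<psi>2 \<omega> \<partial>M)) \<le> h / 2 * (21 * p^3 * sqrt h)"
    by (rule mult_left_mono) (use h in simp)
  then have "h / 2 * (\<integral>\<omega>. ?\<phi>2 \<omega> \<partial>M) + h / 2 * (\<integral>\<omega>. ?\<psi>2 \<omega> \<partial>M) \<le> 21 / 2 * (p^3 * ?q)"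
    by (simp add: distrib_left mult_ac)
  moreover have "37 * p^3 / 6 * (2 * ?q) = 37 / 3 * (p^3 * ?q)" "4 * p^3 * (2 * ?q) = 8 * (p^3 * ?q)" by simp_all
  moreover have "0 \<le> p^3 * ?q" using p3 h by simp
  ultimately have "(\<integral>\<omega>. ?g' \<omega> \<partial>M) \<le> (\<integral>\<omega>. ?gx \<omega> \<partial>M) + 31 * (p^3 * ?q)"
    using S1 S3 T1 T2 by linarith
  then show ?thesis by (simp add: h_def mult_ac)
qed

end


section \<open>Transience of the driftless process\<close>

context independent_drivers
begin

abbreviation uniform_grid :: "real \<Rightarrow> nat \<Rightarrow> real" where
  "uniform_grid h i \<equiv> real i * h"

definition euler_sum :: "real \<Rightarrow> real \<Rightarrow> nat \<Rightarrow> 'a \<Rightarrow> real" where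
  "euler_sum p h = elementary_sum (uniform_grid h) (\<lambda>i \<omega>. exp (p * V (uniform_grid h i) \<omega>))"

lemma euler_sum_adapted:
  assumes h: "0 < h"
  shows "euler_sum p h k \<in> borel_measurable (F (uniform_grid h k))"
  unfolding euler_sum_def
proof (rule elementary_sum_adapted[where m=k])
  show "0 \<le> uniform_grid h 0" by simp
  show "uniform_grid h i < uniform_grid h (Suc i)" for i using h by simp
  show "(\<lambda>\<omega>. exp (p * V (uniform_grid h i) \<omega>)) \<in> borel_measurable (F (uniform_grid h i))" for i
    using V_adapted_F[of "uniform_grid h i"] h by simp
qed simp_all

text \<open>
  The supermartingale maximal inequality for the Euler scheme, after the first time at which \<open>V \<ge> K\<close>.
  The process \<open>\<Phi>\<close> equals the constant \<open>c\<close> before that time, follows \<open>g\<close> from then on, and stays at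
  \<open>\<epsilon>\<close> once \<open>g\<close> has reached the level \<open>\<epsilon>\<close>.  Its expectation grows by at most the error of one step: the
  switch from \<open>c\<close> to \<open>g\<close> is downward because \<open>g \<le> p exp (- p V) \<le> c\<close> when \<open>V \<ge> K\<close>, and stopping replaces a
  value of at least \<open>\<epsilon>\<close> by \<open>\<epsilon>\<close>.\<close>

lemma euler_escape:
  assumes p: "p > 0" and h: "0 < h" and \<epsilon>: "0 < \<epsilon>"
  shows "prob {\<omega> \<in> space M. \<exists>k\<le>m. (\<exists>j\<le>k. K \<le> V (uniform_grid h j) \<omega>)
      \<and> \<epsilon> \<le> plummer p (euler_sum p h k \<omega>) (V (uniform_grid h k) \<omega>)}
    \<le> (p * exp (- p * K) + real m * (31 * p^3 * (h * sqrt h))) / \<epsilon>"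
proof -
  let ?t = "uniform_grid h"
  define g where "g = (\<lambda>k \<omega>. plummer p (euler_sum p h k \<omega>) (V (?t k) \<omega>))"
  define S where "S = (\<lambda>i \<omega>. \<exists>j\<in>{..i}. K \<le> V (?t j) \<omega>)"
  define A where "A = (\<lambda>i \<omega>. \<exists>k\<in>{..i}. S k \<omega> \<and> \<epsilon> \<le> g k \<omega>)"
  define c where "c = p * exp (- p * K)"
  define \<Phi> where "\<Phi> = (\<lambda>i \<omega>. if A i \<omega> then \<epsilon> else if S i \<omega> then g i \<omega> else c)"
  have tnn: "0 \<le> ?t i" for i using h by simp
  have tle: "?t i \<le> ?t j" if "i \<le> j" for i j using that h by (intro mult_right_mono) auto
  have VF: "V (?t j) \<in> borel_measurable (F (?t i))" if "j \<le> i" for i j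
    by (rule F_measurable_mono[OF tnn tle[OF that] V_adapted_F[OF tnn]])
  have xF: "euler_sum p h j \<in> borel_measurable (F (?t i))" if "j \<le> i" for i j
    by (rule F_measurable_mono[OF tnn tle[OF that] euler_sum_adapted[OF h]])
  have gF: "g j \<in> borel_measurable (F (?t i))" if "j \<le> i" for i j
    unfolding g_def by (rule borel_measurable_plummer[OF xF[OF that] VF[OF that]])
  have SF: "Measurable.pred (F (?t i)) (S j)" if "j \<le> i" for i j
  proof -
    have [measurable]: "V (?t k) \<in> borel_measurable (F (?t i))" if "k \<in> {..j}" for k
      using VF[of k i] that \<open>j \<le> i\<close> by simp
    show ?thesis unfolding S_def by measurable
  qed
  have AF: "Measurable.pred (F (?t i)) (A i)" for i
  proof -
    have [measurable]: "Measurable.pred (F (?t i)) (S k)" "g k \<in> borel_measurable (F (?t i))" if "k \<in> {..i}" for k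
      using SF[of k i] gF[of k i] that by simp_all
    show ?thesis unfolding A_def by measurable
  qed
  have g01: "0 < g k \<omega>" "g k \<omega> \<le> 1" for k \<omega>
    unfolding g_def using plummer_pos plummer_le_1 by auto
  have c0: "0 < c" unfolding c_def using p by simp
  have gc: "g k \<omega> \<le> c" if "K \<le> V (?t k) \<omega>" for k \<omega>
  proof -
    have "g k \<omega> \<le> p * exp (- p * V (?t k) \<omega>)" unfolding g_def by (rule plummer_le_exp[OF p])
    also have "\<dots> \<le> c" unfolding c_def using p that by (intro mult_left_mono) auto
    finally show ?thesis .
  qed
  have \<Phi>F: "\<Phi> i \<in> borel_measurable (F (?t i))" for i
  proof -
    note [measurable] = AF[of i] SF[of i i, OF order_refl] gF[of i i, OF order_refl]
    show ?thesis unfolding \<Phi>_def by measurable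
  qed
  have \<Phi>M: "\<Phi> i \<in> borel_measurable M" for i by (rule F_measurable_M[OF tnn \<Phi>F])
  have \<Phi>pos: "0 < \<Phi> i \<omega>" for i \<omega> unfolding \<Phi>_def using \<epsilon> c0 g01 by auto
  have \<Phi>int: "integrable M (\<Phi> i)" for i
  proof (rule integrable_const_bound[of _ "\<epsilon> + 1 + c"])
    have "\<bar>\<Phi> i \<omega>\<bar> \<le> \<epsilon> + 1 + c" for \<omega>
      using \<Phi>pos[of i \<omega>] g01[of i \<omega>] \<epsilon> c0 unfolding \<Phi>_def by (auto split: if_splits)
    then show "AE \<omega> in M. norm (\<Phi> i \<omega>) \<le> \<epsilon> + 1 + c" by simp
  qed (rule \<Phi>M)
  have A_Suc: "A (Suc i) \<omega> \<longleftrightarrow> A i \<omega> \<or> (S (Suc i) \<omega> \<and> \<epsilon> \<le> g (Suc i) \<omega>)" for i \<omega>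
    unfolding A_def atMost_Suc by auto
  have S_Suc: "S (Suc i) \<omega> \<longleftrightarrow> S i \<omega> \<or> K \<le> V (?t (Suc i)) \<omega>" for i \<omega>
    unfolding S_def atMost_Suc by auto
  let ?E = "\<lambda>i. {\<omega> \<in> space M. S i \<omega> \<and> \<not> A i \<omega>}"
  have EF: "?E i \<in> sets (F (?t i))" for i
  proof -
    note [measurable] = AF[of i] SF[of i i, OF order_refl]
    have "{\<omega> \<in> space (F (?t i)). S i \<omega> \<and> \<not> A i \<omega>} \<in> sets (F (?t i))" by measurable
    then show ?thesis unfolding space_F[OF tnn] .
  qed
  have EM: "?E i \<in> events" for i
    using EF[of i] F_sub[OF tnn[of i]] unfolding subalgebra_def by (meson subsetD)
  have \<Phi>0: "\<Phi> 0 \<omega> \<le> c" for \<omega>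
    using gc[of 0 \<omega>] unfolding \<Phi>_def A_def S_def by auto
  have \<Phi>S: "\<Phi> (Suc i) \<omega> \<le> \<Phi> i \<omega> + indicator (?E i) \<omega> * (g (Suc i) \<omega> - g i \<omega>)" if w: "\<omega> \<in> space M" for i \<omega>
  proof (cases "A i \<omega>")
    case True
    then show ?thesis unfolding \<Phi>_def A_Suc by simp
  next
    case nA: False
    show ?thesis
    proof (cases "S i \<omega>")
      case True
      then show ?thesis using nA w unfolding \<Phi>_def A_Suc S_Suc by simp
    next
      case False
      then show ?thesis using nA w gc[of "Suc i" \<omega>] unfolding \<Phi>_def A_Suc S_Suc by auto
    qed
  qed
  let ?C = "31 * p^3 * (h * sqrt h)"
  have gint: "integrable M (\<lambda>\<omega>. indicator (?E i) \<omega> * g k \<omega>)" for i k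
  proof (rule integrable_const_bound[of _ 1])
    have "\<bar>indicator (?E i) \<omega> * g k \<omega>\<bar> \<le> 1" for \<omega> using g01[of k \<omega>] by (auto simp: indicator_def)
    then show "AE \<omega> in M. norm (indicator (?E i) \<omega> * g k \<omega>) \<le> 1" by simp
    show "(\<lambda>\<omega>. indicator (?E i) \<omega> * g k \<omega>) \<in> borel_measurable M"
      using EM[of i] F_measurable_M[OF tnn gF[of k k]] by simp
  qed
  have step: "(\<integral>\<omega>. indicator (?E i) \<omega> * g (Suc i) \<omega> \<partial>M) \<le> (\<integral>\<omega>. indicator (?E i) \<omega> * g i \<omega> \<partial>M) + ?C" for i
  proof -
    have lt: "?t i < ?t (Suc i)" using h by simp
    have d: "?t (Suc i) - ?t i = h" by (simp add: algebra_simps)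
    have "euler_sum p h (Suc i) \<omega> = euler_sum p h i \<omega> + exp (p * V (?t i) \<omega>) * (B (?t (Suc i)) \<omega> - B (?t i) \<omega>)" for \<omega>
      unfolding euler_sum_def elementary_sum_def by simp
    then show ?thesis
      using plummer_step[OF p tnn lt xF[of i i, OF order_refl] EF[of i]] unfolding d g_def by simp
  qed
  have E\<Phi>: "(\<integral>\<omega>. \<Phi> i \<omega> \<partial>M) \<le> c + real i * ?C" for i
  proof (induction i)
    case 0
    have "(\<integral>\<omega>. \<Phi> 0 \<omega> \<partial>M) \<le> (\<integral>\<omega>. c \<partial>M)" by (rule integral_mono[OF \<Phi>int _ \<Phi>0]) simp
    then show ?case by (simp add: prob_space)
  next
    case (Suc i)
    have int: "integrable M (\<lambda>\<omega>. indicator (?E i) \<omega> * (g (Suc i) \<omega> - g i \<omega>))"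
      using Bochner_Integration.integrable_diff[OF gint[of i "Suc i"] gint[of i i]] by (simp add: right_diff_distrib)
    have "(\<integral>\<omega>. \<Phi> (Suc i) \<omega> \<partial>M) \<le> (\<integral>\<omega>. \<Phi> i \<omega> + indicator (?E i) \<omega> * (g (Suc i) \<omega> - g i \<omega>) \<partial>M)"
      by (rule integral_mono[OF \<Phi>int _ \<Phi>S]) (rule Bochner_Integration.integrable_add[OF \<Phi>int int])
    also have "\<dots> = (\<integral>\<omega>. \<Phi> i \<omega> \<partial>M) + (\<integral>\<omega>. indicator (?E i) \<omega> * (g (Suc i) \<omega> - g i \<omega>) \<partial>M)"
      by (rule Bochner_Integration.integral_add[OF \<Phi>int int])
    also have "(\<integral>\<omega>. indicator (?E i) \<omega> * (g (Suc i) \<omega> - g i \<omega>) \<partial>M)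
        = (\<integral>\<omega>. indicator (?E i) \<omega> * g (Suc i) \<omega> \<partial>M) - (\<integral>\<omega>. indicator (?E i) \<omega> * g i \<omega> \<partial>M)"
      using Bochner_Integration.integral_diff[OF gint[of i "Suc i"] gint[of i i]] by (simp add: right_diff_distrib)
    finally show ?case using step[of i] Suc by (simp add: algebra_simps)
  qed
  let ?A = "{\<omega> \<in> space M. A m \<omega>}"
  have Am: "?A \<in> events"
  proof -
    have "{\<omega> \<in> space (F (?t m)). A m \<omega>} \<in> sets (F (?t m))" using AF[of m] by measurable
    then show ?thesis using F_sub[OF tnn[of m]] unfolding subalgebra_def by auto
  qed
  have "\<epsilon> * prob ?A = (\<integral>\<omega>. \<epsilon> * indicator ?A \<omega> \<partial>M)" using Am by simp
  also have "\<dots> \<le> (\<integral>\<omega>. \<Phi> m \<omega> \<partial>M)"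
  proof (rule integral_mono[OF _ \<Phi>int])
    show "integrable M (\<lambda>\<omega>. \<epsilon> * indicator ?A \<omega>)" using Am by (simp add: less_top[symmetric])
    show "\<epsilon> * indicator ?A \<omega> \<le> \<Phi> m \<omega>" for \<omega> using \<Phi>pos[of m \<omega>] by (auto simp: indicator_def \<Phi>_def)
  qed
  also have "\<dots> \<le> c + real m * ?C" by (rule E\<Phi>)
  finally have "prob ?A \<le> (c + real m * ?C) / \<epsilon>" using \<epsilon> by (simp add: field_simps)
  moreover have "?A = {\<omega> \<in> space M. \<exists>k\<le>m. (\<exists>j\<le>k. K \<le> V (?t j) \<omega>)
      \<and> \<epsilon> \<le> plummer p (euler_sum p h k \<omega>) (V (?t k) \<omega>)}"
    unfolding A_def S_def g_def by auto
  ultimately show ?thesis unfolding c_def by simp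
qed

definition euler_step :: "real \<Rightarrow> real \<Rightarrow> nat \<Rightarrow> 'a step_process" where
  "euler_step p h m = map (\<lambda>i. (uniform_grid h i, uniform_grid h (Suc i), \<lambda>\<omega>. exp (p * V (uniform_grid h i) \<omega>))) [0..<m]"

lemma adapted_euler_step:
  assumes h: "0 < h"
  shows "adapted_step F (euler_step p h m)"
proof -
  have "(\<lambda>\<omega>. exp (p * V (uniform_grid h i) \<omega>)) \<in> borel_measurable (F (uniform_grid h i))" for i
    using V_adapted_F[of "uniform_grid h i"] h by simp
  then show ?thesis using h unfolding adapted_step_def euler_step_def by (auto simp del: of_nat_Suc intro: mult_right_mono)
qed

lemma euler_step_Suc:
  "euler_step p h (Suc m) = euler_step p h m @ [(uniform_grid h m, uniform_grid h (Suc m), \<lambda>\<omega>. exp (p * V (uniform_grid h m) \<omega>))]"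
  unfolding euler_step_def by simp

lemma step_until_append: "step_until t (L @ L') = step_until t L @ step_until t L'"
  unfolding step_until_def by simp

lemma euler_step_integral:
  assumes h: "0 < h" and k: "k \<le> m"
  shows "step_integral B (step_until (uniform_grid h k) (euler_step p h m)) \<omega> = euler_sum p h k \<omega>"
proof -
  let ?t = "uniform_grid h"
  let ?d = "\<lambda>i. exp (p * V (?t i) \<omega>) * (B (?t (Suc i)) \<omega> - B (?t i) \<omega>)"
  have "step_integral B (step_until (?t k) (euler_step p h m)) \<omega> = (\<Sum>i<m. if i < k then ?d i else 0)"
  proof (induction m)
    case 0
    then show ?case by (simp add: euler_step_def)
  next
    case (Suc m)
    have mx: "max (?t m) (min (?t (Suc m)) (?t k)) = (if m < k then ?t (Suc m) else ?t m)"
    proof (cases "m < k")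
      case True
      then have "?t (Suc m) \<le> ?t k" "?t m \<le> ?t (Suc m)" using h by (auto intro!: mult_right_mono)
      with True show ?thesis by simp
    next
      case False
      then have "?t k \<le> ?t m" using h by (auto intro!: mult_right_mono)
      with False show ?thesis by simp
    qed
    show ?case unfolding euler_step_Suc step_until_append step_integral_append Suc step_ops_simps mx by simp
  qed
  also have "\<dots> = (\<Sum>i<k. ?d i)"
    by (rule sum.mono_neutral_cong_right) (use k in auto)
  finally show ?thesis unfolding euler_sum_def elementary_sum_def .
qed

lemma euler_step_value:
  assumes h: "0 < h" and i: "i < m" and s: "uniform_grid h i < s" "s \<le> uniform_grid h (Suc i)"
  shows "step_value (euler_step p h m) s \<omega> = exp (p * V (uniform_grid h i) \<omega>)"
proof -
  let ?t = "uniform_grid h"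
  have "step_value (euler_step p h m) s \<omega> = (\<Sum>j<m. exp (p * V (?t j) \<omega>) * indicator {?t j<..?t (Suc j)} s)"
  proof (induction m)
    case (Suc m)
    then show ?case unfolding euler_step_Suc step_value_append by (simp del: sum_mult_indicator)
  qed (simp add: euler_step_def)
  also have "\<dots> = (\<Sum>j\<in>{i}. exp (p * V (?t j) \<omega>) * indicator {?t j<..?t (Suc j)} s)"
  proof (rule sum.mono_neutral_right)
    show "\<forall>j\<in>{..<m} - {i}. exp (p * V (?t j) \<omega>) * indicator {?t j<..?t (Suc j)} s = 0"
    proof
      fix j assume "j \<in> {..<m} - {i}"
      then consider "Suc j \<le> i" | "Suc i \<le> j" by fastforce
      then have "s \<notin> {?t j<..?t (Suc j)}"
      proof cases
        case 1
        then have "?t (Suc j) \<le> ?t i" using h by (intro mult_right_mono) auto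
        then show ?thesis using s by (simp del: of_nat_Suc)
      next
        case 2
        then have "?t (Suc i) \<le> ?t j" using h by (intro mult_right_mono) auto
        then show ?thesis using s by (simp del: of_nat_Suc)
      qed
      then show "exp (p * V (?t j) \<omega>) * indicator {?t j<..?t (Suc j)} s = 0" by simp
    qed
  qed (use i in auto)
  also have "\<dots> = exp (p * V (?t i) \<omega>)" using s by (simp del: of_nat_Suc)
  finally show ?thesis .
qed

lemma euler_step_value_outside:
  assumes h: "0 < h" and s: "uniform_grid h m < s"
  shows "step_value (euler_step p h m) s \<omega> = 0"
  using s
proof (induction m)
  case (Suc m)
  have "uniform_grid h m \<le> uniform_grid h (Suc m)" using h by (intro mult_right_mono) auto
  then have "uniform_grid h m < s" using Suc.prems by linarith
  then show ?case using Suc unfolding euler_step_Suc step_value_append by (simp del: of_nat_Suc)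
qed (simp add: euler_step_def)

text \<open>
  The Euler integrand approximates \<open>exp (p V)\<close> because paths are uniformly continuous on compact time
  intervals.  At time \<open>0\<close> the step process vanishes while \<open>H\<close> does not, but a single time has measure zero.\<close>

lemma euler_energy_tendsto_0:
  assumes cont: "continuous_on {0..} (\<lambda>t. V t \<omega>)"
    and H: "\<And>s. 0 \<le> s \<Longrightarrow> H s \<omega> = exp (p * V s \<omega>)"
  shows "(\<lambda>n. energy (\<lambda>s \<omega>. step_value (euler_step p (1 / 2^n) (N * 2^n)) s \<omega>
      - indicator {0..real N} s * H s \<omega>) \<omega>) \<longlonglongrightarrow> 0"
proof (rule order_tendstoI)
  let ?d = "\<lambda>n s. step_value (euler_step p (1 / 2^n) (N * 2^n)) s \<omega> - indicator {0..real N} s * H s \<omega>"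
  let ?e = "\<lambda>n. energy (\<lambda>s \<omega>. step_value (euler_step p (1 / 2^n) (N * 2^n)) s \<omega> - indicator {0..real N} s * H s \<omega>) \<omega>"
  fix a :: ennreal assume "0 < a"
  then obtain b where b: "0 < b" "b < a" using dense by blast
  obtain r where r: "b = ennreal r" "0 < r"
    using b by (cases b) (auto simp: ennreal_less_iff)
  define \<eta> where "\<eta> = sqrt (r / (real N + 1))"
  have \<eta>: "0 < \<eta>" using r by (simp add: \<eta>_def)
  have "\<eta>^2 * real N \<le> \<eta>^2 * (real N + 1)" by (intro mult_left_mono) auto
  also have "\<dots> = r" using r by (simp add: \<eta>_def)
  finally have \<eta>r: "\<eta>^2 * real N \<le> r" .
  let ?f = "\<lambda>s. exp (p * V s \<omega>)"
  have "continuous_on {0..real N} ?f"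
    by (intro continuous_intros continuous_on_subset[OF cont]) auto
  then have "uniformly_continuous_on {0..real N} ?f" by (rule compact_uniformly_continuous) simp
  then obtain d where d: "0 < d" "\<And>x y. x \<in> {0..real N} \<Longrightarrow> y \<in> {0..real N} \<Longrightarrow> dist y x < d \<Longrightarrow> dist (?f y) (?f x) < \<eta>"
    using \<eta> unfolding uniformly_continuous_on_def by metis
  have "(\<lambda>n. (1/2::real)^n) \<longlonglongrightarrow> 0" by (rule LIMSEQ_realpow_zero) auto
  from order_tendstoD(2)[OF this d(1)]
  show "eventually (\<lambda>n. ?e n < a) sequentially"
  proof eventually_elim
    case (elim n)
    let ?h = "1 / 2^n :: real"
    have h: "0 < ?h" by simp
    have hd: "?h < d" using elim by (simp add: power_one_over)
    have top: "uniform_grid ?h (N * 2^n) = real N" by simp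
    have bound: "(?d n s)\<^sup>2 \<le> \<eta>\<^sup>2 * indicator {0<..real N} s" if s: "0 < s" for s
    proof (cases "s \<le> real N")
      case True
      define i where "i = nat (\<lceil>s * 2^n\<rceil> - 1)"
      have pos: "0 < s * 2^n" using s by simp
      then have i1: "real i = of_int \<lceil>s * 2^n\<rceil> - 1" unfolding i_def by (simp add: of_nat_nat)
      have i2: "real i < s * 2^n" "s * 2^n \<le> real (Suc i)" using i1 by linarith+
      have lo: "uniform_grid ?h i < s" using i2(1) by (simp add: field_simps)
      have hi: "s \<le> uniform_grid ?h (Suc i)" using i2(2) by (simp add: field_simps del: of_nat_Suc)
      have "s * 2^n \<le> real N * 2^n" using True by (intro mult_right_mono) auto
      moreover have "real (N * 2^n) = real N * 2^n" by simp
      ultimately have "real i < real (N * 2^n)" using i2(1) by linarith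
      then have im: "i < N * 2^n" by (simp only: of_nat_less_iff)
      have v: "step_value (euler_step p ?h (N * 2^n)) s \<omega> = ?f (uniform_grid ?h i)"
        by (rule euler_step_value[OF h im lo hi])
      have "uniform_grid ?h (Suc i) = uniform_grid ?h i + ?h" by (simp add: add_divide_distrib)
      then have "dist (uniform_grid ?h i) s < d" using lo hi hd unfolding dist_real_def by linarith
      moreover have "0 \<le> uniform_grid ?h i" by simp
      ultimately have "dist (?f (uniform_grid ?h i)) (?f s) < \<eta>"
        using s True lo by (intro d(2)) auto
      then have "\<bar>?d n s\<bar> \<le> \<eta>" using v H[of s] s True unfolding dist_real_def by simp
      then have "\<bar>?d n s\<bar>^2 \<le> \<eta>^2" by (rule power_mono) simp
      then show ?thesis using s True by simp
    next
      case False
      then have "step_value (euler_step p ?h (N * 2^n)) s \<omega> = 0"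
        by (intro euler_step_value_outside[OF h]) (use top in linarith)
      then show ?thesis using False by simp
    qed
    have "?e n \<le> (\<integral>\<^sup>+ s. ennreal (\<eta>\<^sup>2) * indicator {0<..real N} s \<partial>lborel)"
      unfolding energy_def
    proof (rule nn_integral_mono_AE)
      show "AE s in lborel. ennreal ((?d n s)\<^sup>2) * indicator {0..} s \<le> ennreal (\<eta>\<^sup>2) * indicator {0<..real N} s"
        using AE_lborel_singleton[of 0]
      proof eventually_elim
        case (elim s)
        show ?case
        proof (cases "0 < s")
          case True
          from ennreal_leI[OF bound[OF True]] show ?thesis by (auto simp: indicator_def split: if_splits)
        next
          case False
          then show ?thesis using elim by (simp add: indicator_def)
        qed
      qed
    qed
    also have "\<dots> = ennreal (\<eta>\<^sup>2 * real N)" by (simp add: nn_integral_cmult_indicator ennreal_mult)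
    also have "\<dots> \<le> ennreal r" using \<eta>r by (rule ennreal_leI)
    finally show ?case using b r by (auto intro: le_less_trans)
  qed
qed simp

text \<open>The same bound \<open>N\<close> works for all finer grids, so the mesh can tend to zero while the times stay fixed.\<close>

lemma dyadics_common_grid:
  assumes "finite D" "D \<subseteq> dyadics"
  shows "\<exists>N n0. \<forall>n\<ge>n0. \<forall>d\<in>D. \<exists>k\<le>N * 2^n. d = real k * (1 / 2^n)"
  using assms
proof (induction D rule: finite_induct)
  case (insert d D)
  then obtain N n0 where N: "\<forall>n\<ge>n0. \<forall>d\<in>D. \<exists>k\<le>N * 2^n. d = real k * (1 / 2^n)" by auto
  obtain j m where d: "d = real j / 2^m" using insert.prems unfolding dyadics_def by auto
  have new: "\<exists>k\<le>j * 2^n. d = real k * (1 / 2^n)" if "m \<le> n" for n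
  proof (intro exI conjI)
    have "(2::nat)^(n - m) \<le> 2^n" by (intro power_increasing) auto
    then show "j * 2^(n - m) \<le> j * 2^n" by (rule mult_left_mono) simp
    have "(2::real)^n = 2^(n - m) * 2^m" using that by (simp add: power_add[symmetric])
    then show "d = real (j * 2^(n - m)) * (1 / 2^n)" unfolding d by simp
  qed
  show ?case
  proof (rule exI[of _ "max N j"], rule exI[of _ "max n0 m"], intro allI impI ballI)
    fix n e assume n: "max n0 m \<le> n" and e: "e \<in> insert d D"
    have "\<exists>k. k \<le> max N j * 2^n \<and> e = real k * (1 / 2^n)"
    proof (cases "e = d")
      case True
      obtain k where "k \<le> j * 2^n" "d = real k * (1 / 2^n)" using new[of n] n by auto
      moreover have "j * 2^n \<le> max N j * 2^n" by (intro mult_right_mono) auto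
      ultimately show ?thesis using True order_trans by blast
    next
      case False
      then obtain k where "k \<le> N * 2^n" "e = real k * (1 / 2^n)" using N n e by auto
      moreover have "N * 2^n \<le> max N j * 2^n" by (intro mult_right_mono) auto
      ultimately show ?thesis using order_trans by blast
    qed
    then show "\<exists>k\<le>max N j * 2^n. e = real k * (1 / 2^n)" by blast
  qed
qed simp

text \<open>For finitely many dyadic times the Euler sums converge in probability to the integrals, and \<open>g\<close> is
  Lipschitz in \<open>x\<close>, so the bound for the Euler scheme passes to the limit at the cost of replacing
  the level \<open>\<epsilon>\<close> by \<open>2 \<epsilon>\<close>.  The accumulated error is \<open>N 2\<^sup>n\<close> steps of order \<open>2\<^bsup>-3n/2\<^esup>\<close>.\<close>

lemma escape_finite:
  assumes p: "p > 0" and \<epsilon>: "0 < \<epsilon>"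
    and X: "\<And>t. 0 \<le> t \<Longrightarrow> has_ito_integral M F B (\<lambda>s \<omega>. indicator {0..t} s * H s \<omega>) (X t)"
    and JH: "jointly_measurable M H"
    and H: "\<And>s \<omega>. 0 \<le> s \<Longrightarrow> \<omega> \<in> space M \<Longrightarrow> H s \<omega> = exp (p * V s \<omega>)"
    and cont: "AE \<omega> in M. continuous_on {0..} (\<lambda>t. V t \<omega>)"
    and P: "finite P" "P \<subseteq> {(s, t). s \<in> dyadics \<and> t \<in> dyadics \<and> s \<le> t}"
  shows "prob {\<omega> \<in> space M. \<exists>v\<in>P. K \<le> V (fst v) \<omega> \<and> 2 * \<epsilon> < plummer p (X (snd v) \<omega>) (V (snd v) \<omega>)}
     \<le> p * exp (- p * K) / \<epsilon>"
proof -
  have "finite (fst ` P \<union> snd ` P)" "fst ` P \<union> snd ` P \<subseteq> dyadics" using P by auto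
  from dyadics_common_grid[OF this] obtain N n0 where
    grid': "\<forall>n\<ge>n0. \<forall>d\<in>fst ` P \<union> snd ` P. \<exists>k\<le>N * 2^n. d = real k * (1 / 2^n)" by (elim exE)
  have grid: "\<exists>k. k \<le> N * 2^n \<and> d = real k * (1 / 2^n)" if "n0 \<le> n" "d \<in> fst ` P \<union> snd ` P" for n d
    using grid'[rule_format, OF that] .
  let ?h = "\<lambda>n::nat. 1 / 2^n :: real"
  have h: "0 < ?h n" for n by simp
  let ?L = "\<lambda>n. euler_step p (?h n) (N * 2^n)"
  have L: "adapted_step F (?L n)" for n by (rule adapted_euler_step[OF h])
  let ?T = "snd ` P"
  have T: "0 \<le> t" "t \<le> real N" if "t \<in> ?T" for t
  proof -
    have "t \<in> fst ` P \<union> snd ` P" using that by simp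
    from grid[OF order_refl this] obtain k where k: "k \<le> N * 2^n0" "t = real k * (1 / 2^n0)" by (elim exE conjE)
    then show "0 \<le> t" by simp
    have "real k \<le> real (N * 2^n0)" using k(1) by (simp only: of_nat_le_iff)
    then have "real k \<le> real N * 2^n0" by simp
    then show "t \<le> real N" unfolding k(2) by (simp add: field_simps)
  qed
  have JHN: "jointly_measurable M (\<lambda>s \<omega>. indicator {0..real N} s * H s \<omega>)"
    by (rule jointly_measurable_restrict[OF JH]) simp
  have "AE \<omega> in M. (\<lambda>n. energy (\<lambda>s \<omega>. step_value (?L n) s \<omega> - indicator {0..real N} s * H s \<omega>) \<omega>) \<longlonglongrightarrow> 0"
    using cont AE_space
  proof eventually_elim
    case (elim \<omega>)
    have "H s \<omega> = exp (p * V s \<omega>)" if "0 \<le> s" for s by (rule H[OF that elim(2)])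
    from euler_energy_tendsto_0[where H=H and \<omega>=\<omega> and p=p and N=N, OF elim(1) this] show ?case .
  qed
  then have e: "conv_zero_in_prob M (\<lambda>n. energy (\<lambda>s \<omega>. step_value (?L n) s \<omega> - indicator {0..real N} s * H s \<omega>))"
    by (rule conv_zero_AE[OF energy_diff_measurable[OF L JHN]])
  let ?J = "\<lambda>n t. step_integral B (step_until t (?L n))"
  have conv: "conv_zero_in_prob M (\<lambda>n \<omega>. ennreal \<bar>?J n t \<omega> - X t \<omega>\<bar>)" if t: "t \<in> ?T" for t
    by (rule ito_integral_until_limit[OF X[OF T(1)[OF t]] L T(2)[OF t] JH e])
  let ?D = "\<lambda>n t. {\<omega> \<in> space M. ennreal \<bar>?J n t \<omega> - X t \<omega>\<bar> > ennreal \<epsilon>}"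
  have Xm: "X t \<in> borel_measurable M" if "0 \<le> t" for t using X[OF that] unfolding has_ito_integral_def by auto
  have Jm: "?J n t \<in> borel_measurable M" for n t
    by (rule step_integral_measurable[OF adapted_step_until[OF L]])
  have Dm: "?D n t \<in> events" if "t \<in> ?T" for n t
    using Xm[OF T(1)[OF that]] Jm[of t n] by measurable
  let ?Q = "\<lambda>n. {\<omega> \<in> space M. \<exists>k\<le>N * 2^n. (\<exists>j\<le>k. K \<le> V (uniform_grid (?h n) j) \<omega>)
      \<and> \<epsilon> \<le> plummer p (euler_sum p (?h n) k \<omega>) (V (uniform_grid (?h n) k) \<omega>)}"
  have Qm: "?Q n \<in> events" for n
  proof -
    have [measurable]: "V (uniform_grid (?h n) k) \<in> borel_measurable M" for k
      by (rule V_measurable) simp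
    have [measurable]: "euler_sum p (?h n) k \<in> borel_measurable M" for k
      by (rule F_measurable_M[OF _ euler_sum_adapted[OF h]]) simp
    have [measurable]: "(\<lambda>\<omega>. plummer p (euler_sum p (?h n) k \<omega>) (V (uniform_grid (?h n) k) \<omega>)) \<in> borel_measurable M" for k
      by (rule borel_measurable_plummer) measurable
    have "{\<omega> \<in> space M. \<exists>k\<in>{..N * 2^n}. (\<exists>j\<in>{..k}. K \<le> V (uniform_grid (?h n) j) \<omega>)
      \<and> \<epsilon> \<le> plummer p (euler_sum p (?h n) k \<omega>) (V (uniform_grid (?h n) k) \<omega>)} \<in> events" by measurable
    then show ?thesis by (simp only: Bex_def atMost_iff)
  qed
  define c where "c = p * exp (- p * K)"
  define err where "err = (\<lambda>n. real N * (31 * p^3) / \<epsilon> * sqrt (?h n) + (\<Sum>t\<in>?T. prob (?D n t)))"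
  let ?E = "{\<omega> \<in> space M. \<exists>v\<in>P. K \<le> V (fst v) \<omega> \<and> 2 * \<epsilon> < plummer p (X (snd v) \<omega>) (V (snd v) \<omega>)}"
  have main: "prob ?E \<le> c / \<epsilon> + err n" if n: "n0 \<le> n" for n
  proof -
    have Um: "(\<Union>t\<in>?T. ?D n t) \<in> events" using P(1) Dm by (intro sets.finite_UN) auto
    have sub: "?E \<subseteq> ?Q n \<union> (\<Union>t\<in>?T. ?D n t)"
    proof (rule subsetI, rule ccontr)
      fix \<omega> assume "\<omega> \<in> ?E" and no: "\<omega> \<notin> ?Q n \<union> (\<Union>t\<in>?T. ?D n t)"
      then obtain s t where w: "\<omega> \<in> space M" and v: "(s, t) \<in> P" "K \<le> V s \<omega>" "2 * \<epsilon> < plummer p (X t \<omega>) (V t \<omega>)"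
        by auto
      have "s \<in> fst ` P \<union> snd ` P" "t \<in> fst ` P \<union> snd ` P" and tT: "t \<in> ?T"
        using imageI[OF v(1), of fst] imageI[OF v(1), of snd] by simp_all
      from grid[OF n this(1)] obtain j where j: "j \<le> N * 2^n" "s = uniform_grid (?h n) j" by (elim exE conjE)
      from grid[OF n \<open>t \<in> fst ` P \<union> snd ` P\<close>] obtain k where k: "k \<le> N * 2^n" "t = uniform_grid (?h n) k"
        by (elim exE conjE)
      have "s \<le> t" using v(1) P by auto
      then have jk: "j \<le> k" unfolding j(2) k(2) by (simp add: divide_le_cancel)
      have "\<omega> \<notin> ?D n t" using no tT by auto
      then have "\<bar>?J n t \<omega> - X t \<omega>\<bar> \<le> \<epsilon>" using w \<epsilon> by (auto simp: ennreal_less_iff not_less)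
      moreover have "?J n t \<omega> = euler_sum p (?h n) k \<omega>"
        unfolding k(2) by (rule euler_step_integral[OF h k(1)])
      moreover have "\<bar>plummer p (euler_sum p (?h n) k \<omega>) (V t \<omega>) - plummer p (X t \<omega>) (V t \<omega>)\<bar> \<le> \<bar>euler_sum p (?h n) k \<omega> - X t \<omega>\<bar>"
        by (rule plummer_lipschitz[OF p])
      ultimately have "\<epsilon> \<le> plummer p (euler_sum p (?h n) k \<omega>) (V t \<omega>)" using v(3) by linarith
      then have "\<omega> \<in> ?Q n" using w v(2) jk k j by blast
      then show False using no by blast
    qed
    have "prob ?E \<le> prob (?Q n \<union> (\<Union>t\<in>?T. ?D n t))"
      by (rule finite_measure_mono[OF sub sets.Un[OF Qm Um]])
    also have "\<dots> \<le> prob (?Q n) + prob (\<Union>t\<in>?T. ?D n t)" by (rule measure_Un_le[OF Qm Um])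
    finally have 1: "prob ?E \<le> prob (?Q n) + prob (\<Union>t\<in>?T. ?D n t)" .
    have 2: "prob (\<Union>t\<in>?T. ?D n t) \<le> (\<Sum>t\<in>?T. prob (?D n t))"
      by (rule measure_UNION_le) (use P Dm in auto)
    have 3: "prob (?Q n) \<le> (c + real (N * 2^n) * (31 * p^3 * (?h n * sqrt (?h n)))) / \<epsilon>"
      unfolding c_def by (rule euler_escape[OF p h \<epsilon>])
    have Nh: "real (N * 2^n) * ?h n = real N" by simp
    have rearrange: "u * (v * (d * e)) = (u * d) * (v * e)" for u v d e :: real by simp
    have "real (N * 2^n) * (31 * p^3 * (?h n * sqrt (?h n))) = real N * (31 * p^3 * sqrt (?h n))"
      by (subst rearrange) (simp only: Nh)
    then have 4: "(c + real (N * 2^n) * (31 * p^3 * (?h n * sqrt (?h n)))) / \<epsilon> = c / \<epsilon> + real N * (31 * p^3) / \<epsilon> * sqrt (?h n)"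
      by (simp add: add_divide_distrib)
    show ?thesis using 1 2 3 unfolding 4 err_def by linarith
  qed
  have "(\<lambda>n. sqrt (?h n)) \<longlonglongrightarrow> sqrt 0"
  proof (rule tendsto_real_sqrt)
    have "(\<lambda>n. (1/2::real)^n) \<longlonglongrightarrow> 0" by (rule LIMSEQ_realpow_zero) auto
    then show "?h \<longlonglongrightarrow> 0" by (simp add: power_one_over)
  qed
  then have "err \<longlonglongrightarrow> real N * (31 * p^3) / \<epsilon> * sqrt 0 + 0"
    unfolding err_def by (intro tendsto_add tendsto_mult tendsto_const conv_zero_sum) (use P conv \<epsilon> in auto)
  then have "(\<lambda>n. c / \<epsilon> + err n) \<longlonglongrightarrow> c / \<epsilon> + (real N * (31 * p^3) / \<epsilon> * sqrt 0 + 0)" by (intro tendsto_add tendsto_const)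
  then have "prob ?E \<le> c / \<epsilon> + (real N * (31 * p^3) / \<epsilon> * sqrt 0 + 0)"
    by (rule LIMSEQ_le_const) (use main in auto)
  then show ?thesis by (simp add: c_def)
qed

lemma plummer_ge_of_bounded:
  assumes p: "p > 0" and C: "0 < C" and b: "\<bar>x\<bar> + exp z < C"
  shows "plummer p C (ln C) \<le> plummer p x z"
proof -
  have x: "\<bar>x\<bar> \<le> C" "exp z \<le> C" using b exp_gt_zero[of z] by linarith+
  then have z: "z \<le> ln C" using C by (simp add: ln_ge_iff)
  have "\<bar>x\<bar>^2 \<le> C^2" by (rule power_mono[OF x(1)]) simp
  moreover have "(exp (p * z) / p)^2 \<le> (exp (p * ln C) / p)^2"
    by (rule power_mono) (use p z in \<open>auto intro: divide_right_mono\<close>)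
  ultimately have le: "1 + x^2 + (exp (p * z) / p)^2 \<le> 1 + C^2 + (exp (p * ln C) / p)^2" by simp
  have pos: "0 < 1 + x^2 + (exp (p * z) / p)^2" by (intro add_pos_nonneg) auto
  show ?thesis unfolding plummer_def
    by (rule divide_left_mono) (use le pos in \<open>auto intro!: mult_pos_pos intro: less_le_trans\<close>)
qed

text \<open>Letting \<open>K\<close> tend to infinity, almost surely for each level there is a \<open>K\<close> such that \<open>g\<close> stays below the
  level once \<open>V\<close> has reached \<open>K\<close>, which does happen.  On a region where \<open>\<bar>x\<bar> + exp z\<close> is bounded, \<open>g\<close> is
  bounded away from zero.\<close>

theorem driftless_transience:
  assumes p: "p > 0" and X: "ito_integral_process M F B H X" and JH: "jointly_measurable M H"
    and H: "\<And>s \<omega>. 0 \<le> s \<Longrightarrow> \<omega> \<in> space M \<Longrightarrow> H s \<omega> = exp (p * V s \<omega>)"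
    and cont: "AE \<omega> in M. continuous_on {0..} (\<lambda>t. V t \<omega>)" and V0: "AE \<omega> in M. V 0 \<omega> = 0"
  shows "AE \<omega> in M. filterlim (\<lambda>t. \<bar>X t \<omega>\<bar> + exp (V t \<omega>)) at_top at_top"
proof -
  have Xt: "\<And>t. 0 \<le> t \<Longrightarrow> has_ito_integral M F B (\<lambda>s \<omega>. indicator {0..t} s * H s \<omega>) (X t)"
    and contX: "AE \<omega> in M. continuous_on {0..} (\<lambda>t. X t \<omega>)"
    using X unfolding ito_integral_process_def by auto
  have Xm: "X t \<in> borel_measurable M" if "0 \<le> t" for t using Xt[OF that] unfolding has_ito_integral_def by auto
  define D where "D = {(s, t). s \<in> dyadics \<and> t \<in> dyadics \<and> s \<le> t}"
  have Dc: "countable D" unfolding D_def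
    by (rule countable_subset[of _ "dyadics \<times> dyadics"]) (use countable_dyadics in auto)
  let ?b = "\<lambda>K \<epsilon> v \<omega>. K \<le> V (fst v) \<omega> \<and> 2 * \<epsilon> < plummer p (X (snd v) \<omega>) (V (snd v) \<omega>)"
  let ?E = "\<lambda>\<epsilon> K. {\<omega> \<in> space M. \<exists>v\<in>D. ?b (real K) \<epsilon> v \<omega>}"
  have evm: "{\<omega> \<in> space M. ?b K \<epsilon> v \<omega>} \<in> events" if "v \<in> D" for K \<epsilon> v
  proof -
    have nn: "0 \<le> fst v" "0 \<le> snd v" using that dyadics_nonneg unfolding D_def by auto
    note [measurable] = V_measurable[OF nn(1)] V_measurable[OF nn(2)] Xm[OF nn(2)]
    show ?thesis by measurable
  qed
  have Em: "?E \<epsilon> K \<in> events" for \<epsilon> K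
    by (rule sets.sets_Collect_countable_Ex'[OF evm Dc])
  have Ele: "prob (?E \<epsilon> K) \<le> p * exp (- p * real K) / \<epsilon>" if \<epsilon>: "0 < \<epsilon>" for \<epsilon> K
  proof (rule prob_ex_countable_le[OF Dc evm])
    fix P assume P: "finite P" "P \<subseteq> D"
    show "prob {\<omega> \<in> space M. \<exists>v\<in>P. ?b (real K) \<epsilon> v \<omega>} \<le> p * exp (- p * real K) / \<epsilon>"
      by (rule escape_finite[OF p \<epsilon> Xt JH H cont P[unfolded D_def]])
  qed
  have Elim: "(\<lambda>K. prob (?E \<epsilon> K)) \<longlonglongrightarrow> 0" if \<epsilon>: "0 < \<epsilon>" for \<epsilon>
  proof -
    have "(\<lambda>K. (exp (- p))^K) \<longlonglongrightarrow> 0" by (rule LIMSEQ_realpow_zero) (use p in auto)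
    then have "(\<lambda>K. p * (exp (- p))^K / \<epsilon>) \<longlonglongrightarrow> p * 0 / \<epsilon>"
      by (intro tendsto_divide tendsto_mult tendsto_const) (use \<epsilon> in auto)
    moreover have "p * (exp (- p))^K / \<epsilon> = p * exp (- p * real K) / \<epsilon>" for K
      by (simp add: exp_of_nat_mult[symmetric] mult.commute)
    ultimately have lim: "(\<lambda>K. p * exp (- p * real K) / \<epsilon>) \<longlonglongrightarrow> 0" by simp
    show ?thesis
      by (rule tendsto_sandwich[OF always_eventually always_eventually tendsto_const lim])
        (use Ele[OF \<epsilon>] in auto)
  qed
  have "AE \<omega> in M. \<forall>j::nat. \<exists>K. \<omega> \<notin> ?E (1 / Suc j) K"
    unfolding AE_all_countable by (intro allI AE_not_all_of_prob_tendsto_0 Em Elim) simp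
  with V.unbounded_above[OF cont V0] cont contX AE_space show ?thesis
  proof eventually_elim
    case (elim \<omega>)
    show ?case
      unfolding filterlim_at_top_gt[where c=0]
    proof (intro allI impI)
      fix C :: real assume C: "0 < C"
      let ?\<epsilon> = "plummer p C (ln C)"
      have "0 < ?\<epsilon> / 2" using plummer_pos[of p C "ln C"] by simp
      then obtain j where j: "1 / real (Suc j) < ?\<epsilon> / 2" using nat_approx_posE by blast
      obtain K where K: "\<omega> \<notin> ?E (1 / Suc j) K" using elim(5) by blast
      obtain n where n: "real K \<le> V (real n) \<omega>" using elim(1) by blast
      have cg: "continuous_on {0..} (\<lambda>t. plummer p (X t \<omega>) (V t \<omega>))"
      proof -
        have "continuous_on {0..} (\<lambda>t. (\<lambda>(x, z). plummer p x z) (X t \<omega>, V t \<omega>))"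
          by (rule continuous_on_compose2[OF continuous_plummer]) (use elim in \<open>auto intro!: continuous_on_Pair\<close>)
        then show ?thesis by simp
      qed
      have small: "plummer p (X t \<omega>) (V t \<omega>) \<in> {..2 * (1 / Suc j)}" if "real n \<le> t" for t
      proof (rule continuous_closed_from_dyadics[OF cg closed_atMost _ _ that])
        fix d assume d: "d \<in> dyadics" "real n \<le> d"
        have "(real n, d) \<in> D" unfolding D_def using d of_nat_dyadic by simp
        then have "\<not> ?b (real K) (1 / Suc j) (real n, d) \<omega>" using K elim(4) by blast
        then show "plummer p (X d \<omega>) (V d \<omega>) \<in> {..2 * (1 / Suc j)}" using n by simp
      qed simp
      show "\<forall>\<^sub>F t in at_top. C \<le> \<bar>X t \<omega>\<bar> + exp (V t \<omega>)"
        using eventually_ge_at_top[of "real n"]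
      proof eventually_elim
        case t: (elim t)
        show ?case
        proof (rule ccontr)
          assume "\<not> ?case"
          then have "?\<epsilon> \<le> plummer p (X t \<omega>) (V t \<omega>)"
            by (intro plummer_ge_of_bounded[OF p C]) simp
          then show False using small[OF t] j by simp
        qed
      qed
    qed
  qed
qed

end


section \<open>The filtration of three Brownian motions\<close>

lemma (in prob_space) process_measurable:
  assumes "independent_processes M Ws" "j < length Ws" "0 \<le> r"
  shows "(Ws ! j) r \<in> borel_measurable M"
proof -
  have "(\<lambda>\<omega>. \<lambda>t\<in>{0..}. (Ws ! j) t \<omega>) \<in> measurable M (PiM {0..} (\<lambda>_. borel))"
    using assms unfolding independent_processes_def indep_vars_def by auto
  from measurable_compose[OF this measurable_component_singleton[of r]] show ?thesis
    using assms(3) by simp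
qed

lemma past_and_others_measurable:
  assumes "j < length Ws" "0 \<le> r" "j = i \<longrightarrow> r \<le> s"
  shows "(Ws ! j) r \<in> borel_measurable (past_and_others M Ws i s)"
proof (rule measurableI)
  fix A :: "real set" assume "A \<in> sets borel"
  then show "(Ws ! j) r -` A \<inter> space (past_and_others M Ws i s) \<in> sets (past_and_others M Ws i s)"
    unfolding sets_past_and_others space_past_and_others
    by (intro sigma_sets.Basic) (use assms in blast)
qed simp

lemma (in prob_space) ito_integrator_past_and_others:
  assumes ind: "independent_processes M Ws" and i: "i < length Ws" and bm: "brownian_motion M (Ws ! i)"
  shows "ito_integrator M (past_and_others M Ws i) (Ws ! i)"
proof
  fix s t :: real
  let ?gen = "\<lambda>s. {(Ws ! j) r -` A \<inter> space M | j r A. j < length Ws \<and> 0 \<le> r \<and> (j = i \<longrightarrow> r \<le> s) \<and> A \<in> sets borel}"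
  show "subalgebra M (past_and_others M Ws i s)" if "0 \<le> s"
    unfolding subalgebra_def sets_past_and_others
  proof
    show "sigma_sets (space M) (?gen s) \<subseteq> events"
      by (rule sets.sigma_sets_subset) (use process_measurable[OF ind] in \<open>auto intro: measurable_sets\<close>)
  qed simp
  show "subalgebra (past_and_others M Ws i t) (past_and_others M Ws i s)" if "0 \<le> s" "s \<le> t"
    unfolding subalgebra_def sets_past_and_others
  proof
    have "?gen s \<subseteq> ?gen t" using that by force
    then show "sigma_sets (space M) (?gen s) \<subseteq> sigma_sets (space M) (?gen t)" by (rule sigma_sets_mono')
  qed simp
  show "(Ws ! i) t \<in> borel_measurable (past_and_others M Ws i t)" if "0 \<le> t"
    by (rule past_and_others_measurable) (use i that in auto)
  assume st: "0 \<le> s" "s < t"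
  show "distributed M lborel (\<lambda>\<omega>. (Ws ! i) t \<omega> - (Ws ! i) s \<omega>) (normal_density 0 (sqrt (t - s)))"
    using bm st unfolding brownian_motion_def by blast
  show "indep_set (sets (past_and_others M Ws i s))
      (sigma_sets (space M) {(\<lambda>\<omega>. (Ws ! i) t \<omega> - (Ws ! i) s \<omega>) -` A \<inter> space M | A. A \<in> sets borel})"
    by (rule indep_set_past_and_others[OF ind i bm st])
qed

lemma space_natural_filtration: "space (natural_filtration M \<W> s) = space M"
  by (simp add: natural_filtration_def space_measure_of_conv)

lemma sets_natural_filtration:
  "sets (natural_filtration M \<W> t) =
     sigma_sets (space M) {W s -` A \<inter> space M | W s A. W \<in> \<W> \<and> 0 \<le> s \<and> s \<le> t \<and> A \<in> sets borel}"
  unfolding natural_filtration_def by (rule sets_measure_of) auto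

lemma natural_filtration_measurable:
  assumes "W \<in> \<W>" "0 \<le> r" "r \<le> s"
  shows "W r \<in> borel_measurable (natural_filtration M \<W> s)"
proof (rule measurableI)
  fix A :: "real set" assume "A \<in> sets borel"
  then show "W r -` A \<inter> space (natural_filtration M \<W> s) \<in> sets (natural_filtration M \<W> s)"
    unfolding sets_natural_filtration space_natural_filtration
    by (intro sigma_sets.Basic) (use assms in blast)
qed simp

lemma natural_filtration_le_past_and_others:
  "subalgebra (past_and_others M Ws i s) (natural_filtration M (set Ws) s)"
  unfolding subalgebra_def sets_past_and_others sets_natural_filtration space_natural_filtration space_past_and_others
proof (intro conjI refl sigma_sets_mono' subsetI)
  fix U assume "U \<in> {W r -` A \<inter> space M | W r A. W \<in> set Ws \<and> 0 \<le> r \<and> r \<le> s \<and> A \<in> sets borel}"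
  then obtain W r A where *: "U = W r -` A \<inter> space M" "W \<in> set Ws" "0 \<le> r" "r \<le> s" "A \<in> sets borel" by blast
  then obtain j where "j < length Ws" "Ws ! j = W" by (meson in_set_conv_nth)
  then show "U \<in> {(Ws ! j) r -` A \<inter> space M | j r A. j < length Ws \<and> 0 \<le> r \<and> (j = i \<longrightarrow> r \<le> s) \<and> A \<in> sets borel}"
    using * by blast
qed

lemma (in ito_integrator) ito_integrator_coarser:
  assumes le: "\<And>s. 0 \<le> s \<Longrightarrow> subalgebra (F s) (F' s)"
    and mono: "\<And>s t. 0 \<le> s \<Longrightarrow> s \<le> t \<Longrightarrow> subalgebra (F' t) (F' s)"
    and ad: "\<And>t. 0 \<le> t \<Longrightarrow> B t \<in> borel_measurable (F' t)"
  shows "ito_integrator M F' B"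
proof
  fix s t :: real
  show "subalgebra M (F' s)" if "0 \<le> s"
    using F_sub[OF that] le[OF that] unfolding subalgebra_def by auto
  show "subalgebra (F' t) (F' s)" if "0 \<le> s" "s \<le> t" using mono that .
  show "B t \<in> borel_measurable (F' t)" if "0 \<le> t" using ad that .
  assume st: "0 \<le> s" "s < t"
  show "distributed M lborel (\<lambda>\<omega>. B t \<omega> - B s \<omega>) (normal_density 0 (sqrt (t - s)))" by (rule increment_normal[OF st])
  show "indep_set (sets (F' s)) (sigma_sets (space M) {(\<lambda>\<omega>. B t \<omega> - B s \<omega>) -` A \<inter> space M | A. A \<in> sets borel})"
    by (rule indep_set_mono[OF increment_indep[OF st]]) (use le[OF st(1)] in \<open>auto simp: subalgebra_def\<close>)
qed

lemma natural_filtration_mono: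
  assumes "s \<le> t"
  shows "subalgebra (natural_filtration M \<W> t) (natural_filtration M \<W> s)"
  unfolding subalgebra_def sets_natural_filtration space_natural_filtration
proof (intro conjI refl sigma_sets_mono')
  show "{W r -` A \<inter> space M | W r A. W \<in> \<W> \<and> 0 \<le> r \<and> r \<le> s \<and> A \<in> sets borel}
    \<subseteq> {W r -` A \<inter> space M | W r A. W \<in> \<W> \<and> 0 \<le> r \<and> r \<le> t \<and> A \<in> sets borel}"
    using assms by force
qed

lemma (in prob_space) ito_integrator_natural_filtration:
  assumes ind: "independent_processes M Ws" and i: "i < length Ws" and bm: "brownian_motion M (Ws ! i)"
  shows "ito_integrator M (natural_filtration M (set Ws)) (Ws ! i)"
proof -
  interpret I: ito_integrator M "past_and_others M Ws i" "Ws ! i"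
    by (rule ito_integrator_past_and_others[OF ind i bm])
  show ?thesis
    by (rule I.ito_integrator_coarser)
      (use i in \<open>auto intro: natural_filtration_le_past_and_others natural_filtration_mono natural_filtration_measurable\<close>)
qed

lemma (in prob_space) independent_drivers_natural_filtration:
  assumes ind: "independent_processes M Ws" and ij: "i < length Ws" "j < length Ws" "i \<noteq> j"
    and bm: "brownian_motion M (Ws ! i)" "brownian_motion M (Ws ! j)"
  shows "independent_drivers M (natural_filtration M (set Ws)) (Ws ! i) (past_and_others M Ws j) (Ws ! j)"
  unfolding independent_drivers_def independent_drivers_axioms_def
  using ito_integrator_natural_filtration[OF ind ij(1) bm(1)] ito_integrator_past_and_others[OF ind ij(2) bm(2)] ij
  by (auto intro: natural_filtration_le_past_and_others natural_filtration_measurable past_and_others_measurable)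

text \<open>The centred normal distribution is symmetric.\<close>

lemma (in ito_integrator) ito_integrator_uminus: "ito_integrator M F (\<lambda>t \<omega>. - B t \<omega>)"
proof
  fix s t :: real
  show "subalgebra M (F s)" if "0 \<le> s" by (rule F_sub[OF that])
  show "subalgebra (F t) (F s)" if "0 \<le> s" "s \<le> t" by (rule F_mono[OF that])
  show "(\<lambda>\<omega>. - B t \<omega>) \<in> borel_measurable (F t)" if "0 \<le> t" using B_adapted[OF that] by simp
  assume st: "0 \<le> s" "s < t"
  have \<sigma>: "0 < sqrt (t - s)" using st by simp
  show "distributed M lborel (\<lambda>\<omega>. - B t \<omega> - - B s \<omega>) (normal_density 0 (sqrt (t - s)))"
    using normal_density_affine[OF increment_normal[OF st] \<sigma>, of "-1" 0] by simp
  have "{(\<lambda>\<omega>. - B t \<omega> - - B s \<omega>) -` A \<inter> space M | A. A \<in> sets borel}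
     \<subseteq> {(\<lambda>\<omega>. B t \<omega> - B s \<omega>) -` A \<inter> space M | A. A \<in> sets borel}"
  proof (rule subsetI)
    fix U assume "U \<in> {(\<lambda>\<omega>. - B t \<omega> - - B s \<omega>) -` A \<inter> space M | A. A \<in> sets borel}"
    then obtain A where A: "A \<in> sets borel" "U = (\<lambda>\<omega>. - B t \<omega> - - B s \<omega>) -` A \<inter> space M" by blast
    have "uminus -` A \<inter> space (borel :: real measure) \<in> sets borel"
      by (rule measurable_sets[OF _ A(1)]) simp
    then have "uminus -` A \<in> sets (borel :: real measure)" by simp
    moreover have "U = (\<lambda>\<omega>. B t \<omega> - B s \<omega>) -` (uminus -` A) \<inter> space M" unfolding A(2) by auto
    ultimately show "U \<in> {(\<lambda>\<omega>. B t \<omega> - B s \<omega>) -` A \<inter> space M | A. A \<in> sets borel}" by blast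
  qed
  from sigma_sets_mono'[OF this]
  show "indep_set (sets (F s)) (sigma_sets (space M) {(\<lambda>\<omega>. - B t \<omega> - - B s \<omega>) -` A \<inter> space M | A. A \<in> sets borel})"
    by (rule indep_set_mono[OF increment_indep[OF st] order_refl])
qed

lemma (in independent_drivers) independent_drivers_uminus:
  "independent_drivers M F B G (\<lambda>t \<omega>. - V t \<omega>)"
  unfolding independent_drivers_def independent_drivers_axioms_def
  using ito_integrator_axioms V.ito_integrator_uminus F_le_G V_adapted_F B_measurable_G by auto

section \<open>Convergence in the compactification\<close>

text \<open>Convergence in the closure of the image amounts to convergence in the two factors; the limit lies in
  the closure because the filter is proper.\<close>

lemma limitin_sol_compactification:
  assumes x: "limitin hyp_compactification (\<lambda>t. hyp_point p (x t) (z t)) l F"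
    and y: "limitin hyp_compactification (\<lambda>t. hyp_point q (y t) (- z t)) m F" and F: "F \<noteq> bot"
  shows "limitin (sol_compactification p q) (\<lambda>t. sol_embedding p q (x t, y t, z t)) (l, m) F"
proof -
  let ?T = "prod_topology hyp_compactification hyp_compactification"
  let ?f = "\<lambda>t. sol_embedding p q (x t, y t, z t)"
  have lim: "limitin ?T ?f (l, m) F"
    using x y by (simp add: limitin_pairwise comp_def sol_embedding_def)
  then have "(l, m) \<in> topspace ?T" by (rule limitin_topspace)
  moreover have "\<exists>y. y \<in> range (sol_embedding p q) \<and> y \<in> U" if "(l, m) \<in> U \<and> openin ?T U" for U
  proof -
    have "eventually (\<lambda>t. ?f t \<in> U) F" using lim that unfolding limitin_def by blast
    from eventually_happens'[OF F this] show ?thesis by blast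
  qed
  ultimately have cl: "(l, m) \<in> ?T closure_of range (sol_embedding p q)"
    unfolding in_closure_of by blast
  have "eventually (\<lambda>t. ?f t \<in> topspace ?T) F"
    using lim openin_topspace[of ?T] \<open>(l, m) \<in> topspace ?T\<close> unfolding limitin_def by blast
  then have "eventually (\<lambda>t. ?f t \<in> ?T closure_of range (sol_embedding p q)) F"
  proof (rule eventually_mono)
    fix t assume "?f t \<in> topspace ?T"
    then show "?f t \<in> ?T closure_of range (sol_embedding p q)" unfolding in_closure_of by blast
  qed
  then show ?thesis
    unfolding sol_compactification_def Let_def limitin_subtopology using cl lim by blast
qed

lemma ito_integral_process_jointly_measurable:
  fixes M :: "'a measure"
  assumes "ito_integral_process M F W H X"
  shows "jointly_measurable M H"
  unfolding jointly_measurable_def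
proof (rule borel_measurable_LIMSEQ_real[where u="\<lambda>n. \<lambda>(s, \<omega>). indicator {0..real n} s * H s \<omega>"])
  fix n :: nat
  have "ito_integrand M F (\<lambda>s \<omega>. indicator {0..real n} s * H s \<omega>)"
    using assms unfolding ito_integral_process_def has_ito_integral_def by auto
  then show "(\<lambda>(s, \<omega>). indicator {0..real n} s * H s \<omega>) \<in> borel_measurable (restrict_space borel {0..} \<Otimes>\<^sub>M M)"
    unfolding ito_integrand_def by blast
next
  fix v :: "real \<times> 'a" assume v: "v \<in> space (restrict_space borel {0..} \<Otimes>\<^sub>M M)"
  obtain s \<omega> where sw: "v = (s, \<omega>)" by (cases v)
  have s: "0 \<le> s" using v unfolding sw by (auto simp: space_pair_measure space_restrict_space)
  obtain N :: nat where N: "s \<le> real N" using real_arch_simple by blast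
  have "eventually (\<lambda>n. (case v of (s, \<omega>) \<Rightarrow> indicator {0..real n} s * H s \<omega>) = (case v of (s, \<omega>) \<Rightarrow> H s \<omega>)) sequentially"
    using eventually_ge_at_top[of N] by eventually_elim (use s N in \<open>simp add: sw\<close>)
  then show "(\<lambda>n. case v of (s, \<omega>) \<Rightarrow> indicator {0..real n} s * H s \<omega>) \<longlonglongrightarrow> (case v of (s, \<omega>) \<Rightarrow> H s \<omega>)"
    by (rule tendsto_eventually)
qed

lemma ito_integral_process_energy:
  assumes "ito_integral_process M F W H X"
  shows "AE \<omega> in M. energy (\<lambda>s \<omega>. indicator {0..real n} s * H s \<omega>) \<omega> < \<infinity>"
proof -
  have "ito_integrand M F (\<lambda>s \<omega>. indicator {0..real n} s * H s \<omega>)"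
    using assms unfolding ito_integral_process_def has_ito_integral_def by auto
  then show ?thesis by (rule ito_integrand_energy)
qed

lemma (in ito_integrator) drift_dominates:
  assumes cont: "AE \<omega> in M. continuous_on {0..} (\<lambda>t. B t \<omega>)" and B0: "AE \<omega> in M. B 0 \<omega> = 0"
    and a: "0 < a"
  shows "AE \<omega> in M. filterlim (\<lambda>t. a * t + B t \<omega>) at_top at_top"
proof -
  have a2: "0 < a / 2" using a by simp
  from sublinear_growth[OF cont B0 a2] show ?thesis
  proof eventually_elim
    case (elim \<omega>)
    show ?case
    proof (rule filterlim_at_top_mono)
      show "filterlim (\<lambda>t. a / 2 * t) at_top at_top"
        by (rule filterlim_tendsto_pos_mult_at_top[OF tendsto_const a2 filterlim_ident])
      show "eventually (\<lambda>t. a / 2 * t \<le> a * t + B t \<omega>) at_top"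
        using elim
      proof eventually_elim
        case (elim t)
        then have "- (a / 2 * t) \<le> B t \<omega>" by linarith
        moreover have "a * t = a / 2 * t + a / 2 * t" by simp
        ultimately show ?case by linarith
      qed
    qed
  qed
qed

lemma filterlim_abs_plus_exp:
  assumes "filterlim z at_top F"
  shows "filterlim (\<lambda>t. \<bar>x t\<bar> + exp (z t :: real)) at_top F"
proof (rule filterlim_at_top_mono)
  show "filterlim (\<lambda>t. exp (z t)) at_top F" by (rule filterlim_compose[OF exp_at_top assms])
qed simp

text \<open>
  The condition \<open>r * a < 0\<close> says that the drift contracts this coordinate; it covers \<open>Y\<close> for \<open>a > 0\<close> (with
  \<open>r = - q\<close>) and \<open>X\<close> for \<open>a < 0\<close> (with \<open>r = p\<close>).\<close>

lemma (in independent_drivers) contracting_integral: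
  assumes cont: "AE \<omega> in M. continuous_on {0..} (\<lambda>t. V t \<omega>)" and V0: "AE \<omega> in M. V 0 \<omega> = 0"
    and Y: "ito_integral_process M F B H Y" and ra: "r * a < 0"
    and H: "\<And>s \<omega>. 0 \<le> s \<Longrightarrow> \<omega> \<in> space M \<Longrightarrow> H s \<omega> = exp (r * (a * s + V s \<omega>))"
  shows "\<exists>I. has_ito_integral M F B H I"
    and "has_ito_integral M F B H I \<Longrightarrow> AE \<omega> in M. ((\<lambda>t. Y t \<omega>) \<longlongrightarrow> I \<omega>) at_top"
proof -
  have JH: "jointly_measurable M H" by (rule ito_integral_process_jointly_measurable[OF Y])
  have fin: "AE \<omega> in M. energy H \<omega> < \<infinity>"
    by (rule V.exponential_energy_finite[OF cont V0 ra H JH ito_integral_process_energy[OF Y]])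
  show "\<exists>I. has_ito_integral M F B H I" by (rule ito_integral_process_tendsto(1)[OF Y fin JH])
  show "has_ito_integral M F B H I \<Longrightarrow> AE \<omega> in M. ((\<lambda>t. Y t \<omega>) \<longlongrightarrow> I \<omega>) at_top"
    by (rule ito_integral_process_tendsto(2)[OF Y fin JH])
qed

section \<open>Limits of Brownian motion with drift on Sol(p,q)\<close>

theorem proposition4p2:
  fixes M :: "'a measure" and p q a :: real
    and W W1 W2 X Y Z :: "real \<Rightarrow> 'a \<Rightarrow> real"
  assumes "prob_space M" and "p > 0" and "q > 0"
    and "brownian_motion M W" and "brownian_motion M W1" and "brownian_motion M W2"
    and "independent_processes M [W, W1, W2]"
    and "\<And>t \<omega>. t \<ge> 0 \<Longrightarrow> \<omega> \<in> space M \<Longrightarrow> Z t \<omega> = a * t + W t \<omega>"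
    and "ito_integral_process M (natural_filtration M {W, W1, W2}) W1 (\<lambda>s \<omega>. exp (p * Z s \<omega>)) X"
    and "ito_integral_process M (natural_filtration M {W, W1, W2}) W2 (\<lambda>s \<omega>. exp (- q * Z s \<omega>)) Y"
  shows "
    (a > 0 \<longrightarrow>
      (\<exists>Yinf. has_ito_integral M (natural_filtration M {W, W1, W2}) W2 (\<lambda>s \<omega>. exp (- q * Z s \<omega>)) Yinf) \<and>
      (\<forall>Yinf. has_ito_integral M (natural_filtration M {W, W1, W2}) W2 (\<lambda>s \<omega>. exp (- q * Z s \<omega>)) Yinf \<longrightarrow>
        (AE \<omega> in M. ((\<lambda>t. Y t \<omega>) \<longlongrightarrow> Yinf \<omega>) at_top) \<and>
        (AE \<omega> in M. limitin (sol_compactification p q)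
           (\<lambda>t. sol_embedding p q (X t \<omega>, Y t \<omega>, Z t \<omega>))
           (hyp_infinity, hyp_boundary (Yinf \<omega>)) at_top))) \<and>
    (a < 0 \<longrightarrow>
      (\<exists>Xinf. has_ito_integral M (natural_filtration M {W, W1, W2}) W1 (\<lambda>s \<omega>. exp (p * Z s \<omega>)) Xinf) \<and>
      (\<forall>Xinf. has_ito_integral M (natural_filtration M {W, W1, W2}) W1 (\<lambda>s \<omega>. exp (p * Z s \<omega>)) Xinf \<longrightarrow>
        (AE \<omega> in M. ((\<lambda>t. X t \<omega>) \<longlongrightarrow> Xinf \<omega>) at_top) \<and>
        (AE \<omega> in M. limitin (sol_compactification p q)
           (\<lambda>t. sol_embedding p q (X t \<omega>, Y t \<omega>, Z t \<omega>))
           (hyp_boundary (Xinf \<omega>), hyp_infinity) at_top))) \<and>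
    (a = 0 \<longrightarrow>
      (AE \<omega> in M. filterlim (\<lambda>t. \<bar>X t \<omega>\<bar> + exp (Z t \<omega>)) at_top at_top) \<and>
      (AE \<omega> in M. filterlim (\<lambda>t. \<bar>Y t \<omega>\<bar> + exp (- Z t \<omega>)) at_top at_top) \<and>
      (AE \<omega> in M. limitin (sol_compactification p q)
         (\<lambda>t. sol_embedding p q (X t \<omega>, Y t \<omega>, Z t \<omega>))
         (hyp_infinity, hyp_infinity) at_top))"
proof -
  interpret prob_space M by fact
  note p = \<open>p > 0\<close> and q = \<open>q > 0\<close> and bm = \<open>brownian_motion M W\<close> and ind = \<open>independent_processes M [W, W1, W2]\<close>
  note Z = assms(8) and X = assms(9) and Y = assms(10)
  let ?F = "natural_filtration M {W, W1, W2}"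
  let ?G = "past_and_others M [W, W1, W2] 0"
  interpret DX: independent_drivers M ?F W1 ?G W
    using independent_drivers_natural_filtration[OF ind, of 1 0] assms(4,5) by simp
  interpret DY: independent_drivers M ?F W2 ?G W
    using independent_drivers_natural_filtration[OF ind, of 2 0] assms(4,6) by simp
  interpret DN: independent_drivers M ?F W2 ?G "\<lambda>t \<omega>. - W t \<omega>"
    by (rule DY.independent_drivers_uminus)
  have cont: "AE \<omega> in M. continuous_on {0..} (\<lambda>t. W t \<omega>)"
    using bm unfolding brownian_motion_def by (elim conjE)
  have W0: "AE \<omega> in M. W 0 \<omega> = 0"
    using bm unfolding brownian_motion_def by (elim conjE)
  have contN: "AE \<omega> in M. continuous_on {0..} (\<lambda>t. - W t \<omega>)" and W0N: "AE \<omega> in M. - W 0 \<omega> = 0"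
    using cont W0 by (auto intro: continuous_on_minus)
  have Zev: "eventually (\<lambda>t. Z t \<omega> = a * t + W t \<omega>) at_top" if "\<omega> \<in> space M" for \<omega>
    using eventually_ge_at_top[of 0] by eventually_elim (use Z that in simp)
  have positive: "(\<exists>Yinf. has_ito_integral M ?F W2 (\<lambda>s \<omega>. exp (- q * Z s \<omega>)) Yinf) \<and>
      (\<forall>Yinf. has_ito_integral M ?F W2 (\<lambda>s \<omega>. exp (- q * Z s \<omega>)) Yinf \<longrightarrow>
        (AE \<omega> in M. ((\<lambda>t. Y t \<omega>) \<longlongrightarrow> Yinf \<omega>) at_top) \<and>
        (AE \<omega> in M. limitin (sol_compactification p q)
           (\<lambda>t. sol_embedding p q (X t \<omega>, Y t \<omega>, Z t \<omega>))
           (hyp_infinity, hyp_boundary (Yinf \<omega>)) at_top))" if a: "a > 0"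
  proof -
    have neg: "- q * a < 0" using q a by simp
    have H: "exp (- q * Z s \<omega>) = exp (- q * (a * s + W s \<omega>))" if "0 \<le> s" "\<omega> \<in> space M" for s \<omega>
      using Z[OF that] by simp
    have ex: "\<exists>I. has_ito_integral M ?F W2 (\<lambda>s \<omega>. exp (- q * Z s \<omega>)) I"
      by (rule DY.contracting_integral(1)[OF cont W0 Y neg H])
    have up: "AE \<omega> in M. filterlim (\<lambda>t. Z t \<omega>) at_top at_top"
      using DX.V.drift_dominates[OF cont W0 a] AE_space
    proof eventually_elim
      case (elim \<omega>)
      from filterlim_cong[OF refl refl Zev[OF elim(2)]] show ?case using elim(1) by simp
    qed
    have lim: "AE \<omega> in M. ((\<lambda>t. Y t \<omega>) \<longlongrightarrow> I \<omega>) at_top"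
      if "has_ito_integral M ?F W2 (\<lambda>s \<omega>. exp (- q * Z s \<omega>)) I" for I
      by (rule DY.contracting_integral(2)[OF cont W0 Y neg H that])
    have "AE \<omega> in M. limitin (sol_compactification p q)
           (\<lambda>t. sol_embedding p q (X t \<omega>, Y t \<omega>, Z t \<omega>)) (hyp_infinity, hyp_boundary (I \<omega>)) at_top"
      if I: "has_ito_integral M ?F W2 (\<lambda>s \<omega>. exp (- q * Z s \<omega>)) I" for I
      using lim[OF I] up
    proof eventually_elim
      case (elim \<omega>)
      show ?case
      proof (rule limitin_sol_compactification)
        show "limitin hyp_compactification (\<lambda>t. hyp_point p (X t \<omega>) (Z t \<omega>)) hyp_infinity at_top"
          unfolding limitin_hyp_infinity_iff[OF p] by (rule filterlim_abs_plus_exp[OF elim(2)])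
        show "limitin hyp_compactification (\<lambda>t. hyp_point q (Y t \<omega>) (- Z t \<omega>)) (hyp_boundary (I \<omega>)) at_top"
          unfolding limitin_hyp_boundary_iff[OF q] using elim by (simp add: filterlim_uminus_at_bot)
      qed simp
    qed
    with ex lim show ?thesis by blast
  qed
  have negative: "(\<exists>Xinf. has_ito_integral M ?F W1 (\<lambda>s \<omega>. exp (p * Z s \<omega>)) Xinf) \<and>
      (\<forall>Xinf. has_ito_integral M ?F W1 (\<lambda>s \<omega>. exp (p * Z s \<omega>)) Xinf \<longrightarrow>
        (AE \<omega> in M. ((\<lambda>t. X t \<omega>) \<longlongrightarrow> Xinf \<omega>) at_top) \<and>
        (AE \<omega> in M. limitin (sol_compactification p q)
           (\<lambda>t. sol_embedding p q (X t \<omega>, Y t \<omega>, Z t \<omega>))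
           (hyp_boundary (Xinf \<omega>), hyp_infinity) at_top))" if a: "a < 0"
  proof -
    have neg: "p * a < 0" using p a by (simp add: mult_pos_neg)
    have H: "exp (p * Z s \<omega>) = exp (p * (a * s + W s \<omega>))" if "0 \<le> s" "\<omega> \<in> space M" for s \<omega>
      using Z[OF that] by simp
    have ex: "\<exists>I. has_ito_integral M ?F W1 (\<lambda>s \<omega>. exp (p * Z s \<omega>)) I"
      by (rule DX.contracting_integral(1)[OF cont W0 X neg H])
    have a': "0 < - a" using a by simp
    have up: "AE \<omega> in M. filterlim (\<lambda>t. - Z t \<omega>) at_top at_top"
      using DN.V.drift_dominates[OF contN W0N a'] AE_space
    proof eventually_elim
      case (elim \<omega>)
      have "eventually (\<lambda>t. - Z t \<omega> = - a * t + - W t \<omega>) at_top"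
        using Zev[OF elim(2)] by eventually_elim simp
      from filterlim_cong[OF refl refl this] show ?case using elim(1) by simp
    qed
    have lim: "AE \<omega> in M. ((\<lambda>t. X t \<omega>) \<longlongrightarrow> I \<omega>) at_top"
      if "has_ito_integral M ?F W1 (\<lambda>s \<omega>. exp (p * Z s \<omega>)) I" for I
      by (rule DX.contracting_integral(2)[OF cont W0 X neg H that])
    have "AE \<omega> in M. limitin (sol_compactification p q)
           (\<lambda>t. sol_embedding p q (X t \<omega>, Y t \<omega>, Z t \<omega>)) (hyp_boundary (I \<omega>), hyp_infinity) at_top"
      if I: "has_ito_integral M ?F W1 (\<lambda>s \<omega>. exp (p * Z s \<omega>)) I" for I
      using lim[OF I] up
    proof eventually_elim
      case (elim \<omega>)
      show ?case
      proof (rule limitin_sol_compactification)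
        show "limitin hyp_compactification (\<lambda>t. hyp_point q (Y t \<omega>) (- Z t \<omega>)) hyp_infinity at_top"
          unfolding limitin_hyp_infinity_iff[OF q] by (rule filterlim_abs_plus_exp[OF elim(2)])
        show "limitin hyp_compactification (\<lambda>t. hyp_point p (X t \<omega>) (Z t \<omega>)) (hyp_boundary (I \<omega>)) at_top"
          unfolding limitin_hyp_boundary_iff[OF p] using elim by (simp add: filterlim_uminus_at_top)
      qed simp
    qed
    with ex lim show ?thesis by blast
  qed
  have zero: "(AE \<omega> in M. filterlim (\<lambda>t. \<bar>X t \<omega>\<bar> + exp (Z t \<omega>)) at_top at_top) \<and>
      (AE \<omega> in M. filterlim (\<lambda>t. \<bar>Y t \<omega>\<bar> + exp (- Z t \<omega>)) at_top at_top) \<and>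
      (AE \<omega> in M. limitin (sol_compactification p q)
         (\<lambda>t. sol_embedding p q (X t \<omega>, Y t \<omega>, Z t \<omega>))
         (hyp_infinity, hyp_infinity) at_top)" if a: "a = 0"
  proof -
    have Z0: "Z s \<omega> = W s \<omega>" if "0 \<le> s" "\<omega> \<in> space M" for s \<omega> using Z[OF that] a by simp
    have HX: "exp (p * Z s \<omega>) = exp (p * W s \<omega>)" if "0 \<le> s" "\<omega> \<in> space M" for s \<omega>
      using Z0[OF that] by simp
    have HY: "exp (- q * Z s \<omega>) = exp (q * - W s \<omega>)" if "0 \<le> s" "\<omega> \<in> space M" for s \<omega>
      using Z0[OF that] by simp
    have "AE \<omega> in M. filterlim (\<lambda>t. \<bar>X t \<omega>\<bar> + exp (W t \<omega>)) at_top at_top"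
      by (rule DX.driftless_transience[OF p X ito_integral_process_jointly_measurable[OF X] HX cont W0])
    then have x: "AE \<omega> in M. filterlim (\<lambda>t. \<bar>X t \<omega>\<bar> + exp (Z t \<omega>)) at_top at_top"
      using AE_space
    proof eventually_elim
      case (elim \<omega>)
      have "eventually (\<lambda>t. \<bar>X t \<omega>\<bar> + exp (Z t \<omega>) = \<bar>X t \<omega>\<bar> + exp (W t \<omega>)) at_top"
        using Zev[OF elim(2)] by eventually_elim (simp add: a)
      from filterlim_cong[OF refl refl this] show ?case using elim(1) by simp
    qed
    have "AE \<omega> in M. filterlim (\<lambda>t. \<bar>Y t \<omega>\<bar> + exp (- W t \<omega>)) at_top at_top"
      by (rule DN.driftless_transience[OF q Y ito_integral_process_jointly_measurable[OF Y] HY contN W0N])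
    then have y: "AE \<omega> in M. filterlim (\<lambda>t. \<bar>Y t \<omega>\<bar> + exp (- Z t \<omega>)) at_top at_top"
      using AE_space
    proof eventually_elim
      case (elim \<omega>)
      have "eventually (\<lambda>t. \<bar>Y t \<omega>\<bar> + exp (- Z t \<omega>) = \<bar>Y t \<omega>\<bar> + exp (- W t \<omega>)) at_top"
        using Zev[OF elim(2)] by eventually_elim (simp add: a)
      from filterlim_cong[OF refl refl this] show ?case using elim(1) by simp
    qed
    from x y have "AE \<omega> in M. limitin (sol_compactification p q)
         (\<lambda>t. sol_embedding p q (X t \<omega>, Y t \<omega>, Z t \<omega>)) (hyp_infinity, hyp_infinity) at_top"
    proof eventually_elim
      case (elim \<omega>)
      show ?case
        by (rule limitin_sol_compactification)
          (use elim in \<open>simp_all add: limitin_hyp_infinity_iff[OF p] limitin_hyp_infinity_iff[OF q]\<close>)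
    qed
    with x y show ?thesis by blast
  qed
  show ?thesis using positive negative zero by blast
qed


end
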